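(* Let $1\to A\to E\to G\to 1$ be an exact sequence of compactly generated groups with $A$ closed and central in $E$. Assume there exist a compact neighborhood $U=U^{-1}$ of $1$ in $G$ which generates $G$ and a Borel section $\sigma:G\to E$ of the canonical projection $p:E\to G$ such that $\sigma(1)=1$, such that $\sigma(U)$ is compact, and such that the cocycle $c:G\times G\to A$ defined by $c(g,g')=\sigma(g)\sigma(g')\sigma(gg')^{-1}$ has polynomial growth. If $G$ has property RD then $E$ has property RD as well.
   Context: Exact sequences are exact sequences of topological groups: $A$ is a closed normal subgroup of $E$ and $G$ is identified with $E/A$. Let $G$ be a locally compact group with left Haar measure $\vec{\nu}(dx)=\vec{d}x$ and modular function $m$ defined by $\vec{\nu}(Vg)=m(g)\vec{\nu}(V)$ for Borel sets $V$ and $g\in G$; $L^2(G)=L^2(G,\vec{\nu})$ with norm $\|\cdot\|_2$. A length function on $G$ is a Borel map $L:G\to\mathbb{R}^+$ with $L(1)=0$, $L(gh)\le L(g)+L(h)$, $L(g)=L(g^{-1})$; $B_L(R)=\{x\in G: L(x)\le R\}$. It is proper if it is bounded on every compact set. For a compactly supported locally integrable function $f$ put $dF=f\,\vec{d}x$ and let $R_F$ be the right convolution operator $R_F g(x)=\int_G m(y)^{-1}g(xy^{-1})f(y)\,\vec{d}y$ on $L^2(G)$; $\|\cdot\|_{2\to2}$ denotes the operator norm on $L^2(G)$. For a proper length function $L$, the pair $(G,L)$ has property RD if there are constants $C,D\ge 0$ such that $\|R_F\|_{2\to 2}\le CR^D\|f\|_2$ for every $R\ge1$ and every $f\in L^2(G)$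 with compact support contained in $B_L(R)$. $G$ is compactly generated if it has a compact neighborhood $K$ of $1$ with $G=\bigcup_{n}K^n$. For a compact generating set $K=K^{-1}$, the algebraic length function is $L_K(g)=\inf\{n: g\in K^n\}$, $L_K(1)=0$. A compactly generated group $G$ has property RD if $(G,L)$ has property RD for one (hence any) algebraic length function $L$. For compactly generated groups $A$ (abelian) and $G$ with algebraic length functions $L_A$, $L_G$, and a function $\mathrm{Gr}:\mathbb{N}\to\mathbb{N}$, a 2-cocycle $c:G\times G\to A$ has growth at most $\mathrm{Gr}$ if $\sup\{L_A(c(g,g')): g,g'\in G,\ L_G(g)\le n,\ L_G(g')\le n\}\le\mathrm{Gr}(n)$ for all $n$; it has polynomial growth if $\mathrm{Gr}$ can be taken to be a polynomial. *)

theory Defs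
  imports "HOL-Analysis.Analysis" "HOL-Computational_Algebra.Polynomial"
begin

text \<open>
  A topological group is a type of class \<open>topological_group_add\<close>. The group law is written
  additively but is not assumed to be commutative: \<open>x + y\<close> stands for the product \<open>xy\<close>,
  \<open>- x\<close> for \<open>x\<inverse>\<close>, \<open>x - y\<close> for \<open>xy\<inverse>\<close> and \<open>0\<close> for the neutral element \<open>1\<close>.
  Closed subgroups are sets with the induced topology.
\<close>

section \<open>Haar measure and convolution operators\<close>

definition radon_measure :: "'a::topological_space measure \<Rightarrow> bool" where
  "radon_measure M \<longleftrightarrow>
     sets M = sets borel \<and>
     (\<forall>K. compact K \<longrightarrow> emeasure M K < \<infinity>) \<and>
     (\<forall>B\<in>sets borel. emeasure M B = (INF U\<in>{U. open U \<and> B \<subseteq> U}. emeasure M U)) \<and>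
     (\<forall>U. open U \<longrightarrow> emeasure M U = (SUP K\<in>{K. compact K \<and> K \<subseteq> U}. emeasure M K))"

definition left_haar_measure :: "'a::topological_group_add measure \<Rightarrow> bool" where
  "left_haar_measure M \<longleftrightarrow>
     radon_measure M \<and>
     emeasure M UNIV \<noteq> 0 \<and>
     (\<forall>g. \<forall>V\<in>sets borel. emeasure M ((\<lambda>v. g + v) ` V) = emeasure M V)"

text \<open>
  The modular function is determined by \<open>\<nu>(Vg) = m(g) \<nu>(V)\<close>; on a locally compact group exactly
  one positive real number satisfies this, by uniqueness of the Haar measure.
\<close>

definition modular_function :: "'a::topological_group_add measure \<Rightarrow> 'a \<Rightarrow> real" where
  "modular_function M g =
     (THE c. c > 0 \<and> (\<forall>V\<in>sets borel. emeasure M ((\<lambda>v. v + g) ` V) = ennreal c * emeasure M V))"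

text \<open>
  Elements of \<open>L\<^sup>2\<close> are represented by Borel functions. A class has compact (essential) support in a set
  iff it has a representative whose topological support is compact and contained in that set.
\<close>

definition L2_functions :: "'a measure \<Rightarrow> ('a \<Rightarrow> complex) set" where
  "L2_functions M = {h \<in> borel_measurable M. integrable M (\<lambda>x. (cmod (h x))\<^sup>2)}"

definition L2_norm :: "'a measure \<Rightarrow> ('a \<Rightarrow> complex) \<Rightarrow> real" where
  "L2_norm M h = sqrt (LINT x|M. (cmod (h x))\<^sup>2)"

text \<open>The value is \<open>\<infinity>\<close> if \<open>T\<close> is not a bounded operator on \<open>L\<^sup>2\<close>.\<close>

definition L2_operator_norm :: "'a measure \<Rightarrow> (('a \<Rightarrow> complex) \<Rightarrow> 'a \<Rightarrow> complex) \<Rightarrow> ennreal" where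
  "L2_operator_norm M T =
     Inf {ennreal k | k. 0 \<le> k \<and>
       (\<forall>g\<in>L2_functions M. T g \<in> L2_functions M \<and> L2_norm M (T g) \<le> k * L2_norm M g)}"

definition right_convolution ::
    "'a::topological_group_add measure \<Rightarrow> ('a \<Rightarrow> complex) \<Rightarrow> ('a \<Rightarrow> complex) \<Rightarrow> 'a \<Rightarrow> complex" where
  "right_convolution M f g x =
     (LINT y|M. complex_of_real (inverse (modular_function M y)) * g (x - y) * f y)"

section \<open>Length functions and property RD\<close>

definition length_function :: "('a::topological_group_add \<Rightarrow> real) \<Rightarrow> bool" where
  "length_function L \<longleftrightarrow>
     L \<in> borel_measurable borel \<and> (\<forall>g. 0 \<le> L g) \<and> L 0 = 0 \<and>
     (\<forall>g h. L (g + h) \<le> L g + L h) \<and> (\<forall>g. L (- g) = L g)"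

definition proper_length_function :: "('a::topological_group_add \<Rightarrow> real) \<Rightarrow> bool" where
  "proper_length_function L \<longleftrightarrow>
     length_function L \<and> (\<forall>K. compact K \<longrightarrow> bdd_above (L ` K))"

definition length_ball :: "('a \<Rightarrow> real) \<Rightarrow> real \<Rightarrow> 'a set" where
  "length_ball L R = {x. L x \<le> R}"

definition pair_property_RD ::
    "'a::topological_group_add measure \<Rightarrow> ('a \<Rightarrow> real) \<Rightarrow> bool" where
  "pair_property_RD M L \<longleftrightarrow>
     proper_length_function L \<and>
     (\<exists>C\<ge>0. \<exists>D\<ge>0. \<forall>R\<ge>1. \<forall>f\<in>L2_functions M.
        compact (closure {x. f x \<noteq> 0}) \<and> closure {x. f x \<noteq> 0} \<subseteq> length_ball L R \<longrightarrow>
        L2_operator_norm M (right_convolution M f) \<le> ennreal (C * R powr D * L2_norm M f))"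

text \<open>\<open>set_word_power K n\<close> is \<open>K\<^sup>n\<close>, the set of products of \<open>n\<close> elements of \<open>K\<close>.\<close>

primrec set_word_power :: "'a::monoid_add set \<Rightarrow> nat \<Rightarrow> 'a set" where
  "set_word_power K 0 = {0}"
| "set_word_power K (Suc n) = {x + y | x y. x \<in> set_word_power K n \<and> y \<in> K}"

text \<open>Here \<open>S\<close> is a subgroup, and neighbourhoods of the neutral element are taken in \<open>S\<close>.\<close>

definition compactly_generated :: "'a::topological_group_add set \<Rightarrow> bool" where
  "compactly_generated S \<longleftrightarrow>
     (\<exists>K. compact K \<and> (\<exists>V. open V \<and> 0 \<in> V \<and> V \<inter> S \<subseteq> K) \<and> (\<Union>n. set_word_power K n) = S)"

definition symmetric_compact_generating_set :: "'a::topological_group_add set \<Rightarrow> 'a set \<Rightarrow> bool" where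
  "symmetric_compact_generating_set S K \<longleftrightarrow>
     compact K \<and> uminus ` K = K \<and> (\<Union>n. set_word_power K n) = S"

text \<open>Only meaningful on the subgroup generated by \<open>K\<close>.\<close>

definition algebraic_length :: "'a::topological_group_add set \<Rightarrow> 'a \<Rightarrow> nat" where
  "algebraic_length K g = Inf {n. g \<in> set_word_power K n}"

definition property_RD :: "'a::topological_group_add measure \<Rightarrow> bool" where
  "property_RD M \<longleftrightarrow>
     compactly_generated (UNIV :: 'a set) \<and>
     (\<exists>K. symmetric_compact_generating_set UNIV K \<and>
          pair_property_RD M (\<lambda>g. real (algebraic_length K g)))"

section \<open>Extensions and cocycles\<close>

text \<open>
  The quotient topology condition identifies the topological group of type \<open>'g\<close> with \<open>E/A\<close>.
\<close>

definition topological_extension ::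
    "'e::topological_group_add set \<Rightarrow> ('e \<Rightarrow> 'g::topological_group_add) \<Rightarrow> bool" where
  "topological_extension A p \<longleftrightarrow>
     (\<forall>x y. p (x + y) = p x + p y) \<and> surj p \<and>
     closed A \<and> A = {x. p x = 0} \<and>
     (\<forall>W. open W \<longleftrightarrow> open (p -` W))"

definition central_subset :: "'e::group_add set \<Rightarrow> bool" where
  "central_subset A \<longleftrightarrow> (\<forall>a\<in>A. \<forall>x. a + x = x + a)"

definition borel_section ::
    "('e::topological_space \<Rightarrow> 'g::topological_space) \<Rightarrow> ('g \<Rightarrow> 'e) \<Rightarrow> bool" where
  "borel_section p s \<longleftrightarrow> s \<in> borel_measurable borel \<and> (\<forall>g. p (s g) = g)"

definition section_cocycle :: "('g::group_add \<Rightarrow> 'e::group_add) \<Rightarrow> 'g \<Rightarrow> 'g \<Rightarrow> 'e" where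
  "section_cocycle s g h = s g + s h - s (g + h)"

definition cocycle_growth_at_most ::
    "('a \<Rightarrow> nat) \<Rightarrow> ('g \<Rightarrow> nat) \<Rightarrow> ('g \<Rightarrow> 'g \<Rightarrow> 'a) \<Rightarrow> (nat \<Rightarrow> nat) \<Rightarrow> bool" where
  "cocycle_growth_at_most LA LG c Gr \<longleftrightarrow>
     (\<forall>n g h. LG g \<le> n \<and> LG h \<le> n \<longrightarrow> LA (c g h) \<le> Gr n)"

definition cocycle_polynomial_growth ::
    "('a \<Rightarrow> nat) \<Rightarrow> ('g \<Rightarrow> nat) \<Rightarrow> ('g \<Rightarrow> 'g \<Rightarrow> 'a) \<Rightarrow> bool" where
  "cocycle_polynomial_growth LA LG c \<longleftrightarrow>
     (\<exists>Gr. (\<exists>P :: real poly. \<forall>n. real (Gr n) = poly P (real n)) \<and>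
           cocycle_growth_at_most LA LG c Gr)"

end

theory Submission
  imports Defs
begin

text \<open>
  Let \<open>f\<close> be supported in the ball of radius \<open>R\<close> of \<open>E\<close>. Because the cocycle grows polynomially, an element
  of \<open>A\<close> that is a word of length \<open>R\<close> in the generators of \<open>E\<close> is a word of polynomial length in those of
  \<open>A\<close> (\<open>KE_word_fibre\<close>), and because \<open>A\<close> is abelian the set of these elements has polynomial Haar measure
  (\<open>fibre_word_growth\<close>). So on each coset of \<open>A\<close> the \<open>L\<^sup>1\<close> norm of \<open>f\<close> is at most a polynomial in \<open>R\<close> times its
  \<open>L\<^sup>2\<close> norm. On the other hand, in the spirit of Young's inequality \<open>\<parallel>h * k\<parallel>\<^sub>2 \<le> \<parallel>h\<parallel>\<^sub>2 \<parallel>k\<parallel>\<^sub>1\<close> on the fibres, the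
  convolution of \<open>g\<close> with \<open>f\<close> on \<open>E\<close> is controlled by the convolution on \<open>G\<close> of the fibrewise \<open>L\<^sup>2\<close> norms of \<open>g\<close> with the fibrewise
  \<open>L\<^sup>1\<close> norms of \<open>f\<close> (\<open>convolution_fibrewise_bound\<close>), and property RD of \<open>G\<close> bounds the latter
  (\<open>operator_norm_transfer\<close>, \<open>pair_property_RD_extension\<close>).

  The groups are not assumed second countable, so the Borel sets of \<open>E \<times> E\<close> may exceed the product
  \<open>\<sigma>\<close>-algebra and the Tonelli theorem for product measures does not apply to functions such as \<open>g(xy)\<close>.
  It is replaced by a Tonelli theorem for Radon measures on \<open>\<sigma>\<close>-compact spaces and all Borel functions on the
  topological product (\<open>radon_borel_fubini\<close>). Everything about Haar measure follows from it:
  \<open>shear_identity\<close> yields uniqueness, hence the modular function, and also the formula for the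
  substitution \<open>x \<mapsto> x\<inverse>\<close>.

  The integral along the fibres needs a Haar measure on \<open>A\<close>. Since \<open>\<sigma>(U)\<close> is compact, \<open>\<sigma>\<close> is
  continuous on \<open>U\<close>, the extension is a product over \<open>U\<close>, and projecting the part of the Haar measure of \<open>E\<close>
  that lies over \<open>U\<close> to the \<open>A\<close>-coordinate gives such a measure. Weil's formula relating the three Haar measures
  is then a computation with Tonelli's theorem and translations (\<open>weil_formula\<close>).
\<close>

section \<open>Radon measures on \<open>\<sigma>\<close>-compact spaces\<close>

lemma radon_sets: "radon_measure M \<Longrightarrow> sets M = sets borel"
  by (simp add: radon_measure_def)

lemma radon_outer_regular:
  assumes "radon_measure M" "S \<in> sets borel" "emeasure M S < d"
  obtains U where "open U" "S \<subseteq> U" "emeasure M U < d"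
proof -
  have "emeasure M S = (INF U\<in>{U. open U \<and> S \<subseteq> U}. emeasure M U)"
    using assms(1,2) unfolding radon_measure_def by blast
  then show ?thesis using assms(3) that by (auto simp: INF_less_iff)
qed

lemma radon_inner_regular_open:
  assumes "radon_measure M" "open U" "d < emeasure M U"
  obtains K where "compact K" "K \<subseteq> U" "d < emeasure M K"
proof -
  have "emeasure M U = (SUP K\<in>{K. compact K \<and> K \<subseteq> U}. emeasure M K)"
    using assms(1,2) unfolding radon_measure_def by blast
  then show ?thesis using assms(3) that by (auto simp: less_SUP_iff)
qed

text \<open>Choose an open \<open>O \<supseteq> B\<close> of finite measure and, by outer regularity, an open \<open>W \<supseteq> O - B\<close> with little
  excess. A compact subset that nearly exhausts \<open>O\<close> stays compact when \<open>W\<close> is removed, and then lies in \<open>B\<close>.\<close>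

lemma radon_inner_regular_finite:
  fixes M :: "'a::t2_space measure"
  assumes M: "radon_measure M" and B: "B \<in> sets borel" and fin: "emeasure M B < \<infinity>"
    and c: "c < emeasure M B"
  obtains K where "compact K" "K \<subseteq> B" "c < emeasure M K"
proof -
  note sets_M = radon_sets[OF M]
  obtain O1 where O1: "open O1" "B \<subseteq> O1" "emeasure M O1 < \<infinity>"
    using radon_outer_regular[OF M B fin] by blast
  have sM: "O1 \<in> sets M" "B \<in> sets M" using O1 B sets_M by auto
  have val: "emeasure M S = ennreal (measure M S)" if "S \<subseteq> O1" for S
  proof (rule emeasure_eq_ennreal_measure)
    have "emeasure M S \<le> emeasure M O1" using that sM by (intro emeasure_mono) auto
    then show "emeasure M S \<noteq> top" using O1 by (auto simp: top_unique)
  qed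
  obtain r where r: "c = ennreal r" "r \<ge> 0"
    using c by (cases c) auto
  define b where "b = measure M B"
  define w where "w = measure M O1"
  have rb: "r < b"
    using c r val[OF O1(2)] by (simp add: ennreal_less_iff b_def)
  define e where "e = (b - r) / 3"
  have e: "e > 0" "r + 2 * e < b" using rb by (auto simp: e_def field_simps)
  have diff: "measure M (O1 - B) = w - b"
    unfolding w_def b_def using O1 sM val[OF O1(2)] by (intro measure_Diff) auto
  have "0 \<le> w - b" using diff by (metis measure_nonneg)
  have "emeasure M (O1 - B) < ennreal (w - b + e)"
    using val[of "O1 - B"] diff e \<open>0 \<le> w - b\<close> by (simp add: ennreal_less_iff)
  then obtain W where W: "open W" "O1 - B \<subseteq> W" "emeasure M W < ennreal (w - b + e)"
    using radon_outer_regular[OF M, of "O1 - B"] O1 B by (metis borel_open sets.Diff)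
  have "ennreal (w - e) < emeasure M O1"
    using val[of O1] e rb r \<open>0 \<le> w - b\<close> by (simp add: w_def[symmetric] ennreal_lessI)
  then obtain K where K: "compact K" "K \<subseteq> O1" "ennreal (w - e) < emeasure M K"
    using radon_inner_regular_open[OF M O1(1)] by blast
  have sK: "K \<in> sets M" "W \<in> sets M" using K W sets_M by (auto intro: borel_compact)
  have Kval: "w - e < measure M K"
    using K(3) unfolding val[OF K(2)] by (meson ennreal_leI not_le)
  have Wval: "measure M (K \<inter> W) < w - b + e"
  proof -
    have "emeasure M (K \<inter> W) < ennreal (w - b + e)"
      using W(3) sK by (meson emeasure_mono inf_le2 order_le_less_trans)
    then show ?thesis
      using val[of "K \<inter> W"] K by (metis le_infI1 ennreal_leI not_le)
  qed
  have "measure M (K - W) = measure M K - measure M (K \<inter> W)"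
    using sK val[OF K(2)] by (subst measure_Diff[symmetric]) (auto simp: Diff_Int)
  then have *: "r < measure M (K - W)" using Kval Wval e by linarith
  have "c < emeasure M (K - W)"
  proof -
    have "emeasure M (K - W) = ennreal (measure M (K - W))" using K(2) by (intro val) auto
    then show ?thesis using * r by (simp add: ennreal_less_iff)
  qed
  moreover have "compact (K - W)" using K W by (simp add: compact_diff)
  moreover have "K - W \<subseteq> B" using K W by auto
  ultimately show ?thesis using that by blast
qed

locale sigma_compact_radon =
  fixes M :: "'a::t2_space measure"
  assumes radon: "radon_measure M"
    and sigma_compact: "\<exists>K::nat \<Rightarrow> 'a set. (\<forall>n. compact (K n)) \<and> (\<Union>n. K n) = UNIV"
begin

lemma sets_eq [simp, measurable_cong]: "sets M = sets borel"
  using radon by (rule radon_sets)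

lemma space_eq [simp]: "space M = UNIV"
  using sets_eq_imp_space_eq[OF sets_eq] by simp

lemma emeasure_compact_finite: "compact K \<Longrightarrow> emeasure M K < \<infinity>"
  using radon by (simp add: radon_measure_def)

lemma emeasure_open: "open U \<Longrightarrow> emeasure M U = (SUP K\<in>{K. compact K \<and> K \<subseteq> U}. emeasure M K)"
  using radon unfolding radon_measure_def by blast

lemma finite_open_cover:
  obtains O1 :: "nat \<Rightarrow> 'a set" where "\<And>n. open (O1 n)" "\<And>n. emeasure M (O1 n) < \<infinity>" "(\<Union>n. O1 n) = UNIV"
proof -
  obtain K :: "nat \<Rightarrow> 'a set" where K: "\<And>n. compact (K n)" "(\<Union>n. K n) = UNIV"
    using sigma_compact by auto
  have "\<forall>n. \<exists>U. open U \<and> K n \<subseteq> U \<and> emeasure M U < \<infinity>"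
    by (intro allI, rule radon_outer_regular[OF radon borel_compact[OF K(1)] emeasure_compact_finite[OF K(1)]]) auto
  from choice[OF this] obtain U where U: "\<forall>n. open (U n) \<and> K n \<subseteq> U n \<and> emeasure M (U n) < \<infinity>" ..
  have "(\<Union>n. U n) = UNIV"
  proof (intro equalityI subsetI UNIV_I)
    fix x obtain n where "x \<in> K n" using K(2) by (metis UN_E UNIV_I)
    then show "x \<in> (\<Union>n. U n)" using U by (intro UN_I[of n]) auto
  qed
  with that[of U] U show ?thesis by simp
qed

lemma sigma_finite: "sigma_finite_measure M"
proof -
  obtain O1 :: "nat \<Rightarrow> 'a set" where "\<And>n. open (O1 n)" "\<And>n. emeasure M (O1 n) < \<infinity>" "(\<Union>n. O1 n) = UNIV"
    using finite_open_cover by blast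
  then show ?thesis
    by unfold_locales (intro exI[of _ "range O1"], auto simp: less_top)
qed

text \<open>Inside each member of a compact exhaustion \<open>B\<close> has finite measure and is approximated from within by a
  sequence of compact sets.\<close>

lemma sigma_compact_approximation:
  assumes B: "B \<in> sets borel"
  obtains C :: "nat \<Rightarrow> 'a set" where "\<And>n. compact (C n)" "\<And>n. C n \<subseteq> B" "emeasure M (B - (\<Union>n. C n)) = 0"
proof -
  obtain K :: "nat \<Rightarrow> 'a set" where K: "\<And>n. compact (K n)" "(\<Union>n. K n) = UNIV"
    using sigma_compact by auto
  have "\<exists>C::nat \<Rightarrow> 'a set. (\<forall>m. compact (C m) \<and> C m \<subseteq> B \<inter> K n) \<and> emeasure M (B \<inter> K n - (\<Union>m. C m)) = 0" for n
  proof -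
    have BK: "B \<inter> K n \<in> sets borel" using B borel_compact[OF K(1)] by auto
    have fin: "emeasure M (B \<inter> K n) < \<infinity>"
      using emeasure_compact_finite[OF K(1)[of n]] emeasure_mono[of "B \<inter> K n" "K n" M] borel_compact[OF K(1)[of n]]
      by (auto simp: order_le_less_trans)
    show ?thesis
    proof (cases "emeasure M (B \<inter> K n) = 0")
      case True
      then show ?thesis by (intro exI[of _ "\<lambda>_. {}"]) auto
    next
      case False
      then obtain c :: "nat \<Rightarrow> ennreal" where c: "\<And>m. c m < emeasure M (B \<inter> K n)" "c \<longlonglongrightarrow> emeasure M (B \<inter> K n)"
        using approx_from_below_dense_linorder[of 0 "emeasure M (B \<inter> K n)"] by (metis not_gr_zero)
      have "\<forall>m. \<exists>C. compact C \<and> C \<subseteq> B \<inter> K n \<and> c m < emeasure M C"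
        by (intro allI, rule radon_inner_regular_finite[OF radon BK fin c(1)]) auto
      from choice[OF this] obtain C where "\<forall>m. compact (C m) \<and> C m \<subseteq> B \<inter> K n \<and> c m < emeasure M (C m)" ..
      then have C: "\<And>m. compact (C m)" "\<And>m. C m \<subseteq> B \<inter> K n" "\<And>m. c m < emeasure M (C m)"
        by blast+
      have Cs: "(\<Union>m. C m) \<in> sets borel" using C(1) borel_compact by (intro sets.countable_UN) auto
      have "emeasure M (B \<inter> K n) \<le> emeasure M (\<Union>m. C m)"
      proof (rule LIMSEQ_le_const2[OF c(2)], intro exI[of _ 0] allI impI)
        fix m
        have "emeasure M (C m) \<le> emeasure M (\<Union>m. C m)"
          using Cs by (intro emeasure_mono) auto
        then show "c m \<le> emeasure M (\<Union>m. C m)" using C(3)[of m] by auto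
      qed
      moreover have sub: "(\<Union>m. C m) \<subseteq> B \<inter> K n" using C by auto
      moreover have fC: "emeasure M (\<Union>m. C m) < \<infinity>"
        using fin emeasure_mono[OF sub, of M] BK by (auto simp: order_le_less_trans)
      ultimately have "emeasure M (B \<inter> K n - (\<Union>m. C m)) = 0"
        using BK Cs by (subst emeasure_Diff) (auto simp: diff_eq_0_iff_ennreal)
      then show ?thesis using C by blast
    qed
  qed
  then have "\<forall>n. \<exists>C::nat \<Rightarrow> 'a set. (\<forall>m. compact (C m) \<and> C m \<subseteq> B \<inter> K n) \<and>
      emeasure M (B \<inter> K n - (\<Union>m. C m)) = 0" ..
  from choice[OF this] obtain C :: "nat \<Rightarrow> nat \<Rightarrow> 'a set" where "\<forall>n. (\<forall>m. compact (C n m) \<and> C n m \<subseteq> B \<inter> K n) \<and>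
      emeasure M (B \<inter> K n - (\<Union>m. C n m)) = 0" ..
  then have C: "\<And>n m. compact (C n m)" "\<And>n m. C n m \<subseteq> B \<inter> K n"
      "\<And>n. emeasure M (B \<inter> K n - (\<Union>m. C n m)) = 0"
    by blast+
  define D where "D k = (case prod_decode k of (n, m) \<Rightarrow> C n m)" for k
  have D: "(\<Union>k. D k) = (\<Union>n m. C n m)"
  proof -
    have "x \<in> (\<Union>n m. C n m)" if "x \<in> D k" for x k
      using that by (cases "prod_decode k") (auto simp: D_def)
    moreover have "x \<in> (\<Union>k. D k)" if "x \<in> C n m" for x n m
      using that by (intro UN_I[of "prod_encode (n, m)"]) (auto simp: D_def)
    ultimately show ?thesis by (intro equalityI subsetI) auto
  qed
  have [measurable]: "C n m \<in> sets borel" "K n \<in> sets borel" for n m by (rule borel_compact[OF C(1)], rule borel_compact[OF K(1)])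
  have "emeasure M (B - (\<Union>k. D k)) \<le> emeasure M (\<Union>n. B \<inter> K n - (\<Union>m. C n m))"
  proof (rule emeasure_mono)
    show "B - (\<Union>k. D k) \<subseteq> (\<Union>n. B \<inter> K n - (\<Union>m. C n m))"
    proof
      fix x assume x: "x \<in> B - (\<Union>k. D k)"
      obtain n where "x \<in> K n" using K(2) by (metis UN_E UNIV_I)
      then show "x \<in> (\<Union>n. B \<inter> K n - (\<Union>m. C n m))" using x unfolding D by (intro UN_I[of n]) auto
    qed
  qed (use B in auto)
  also have "\<dots> \<le> (\<Sum>n. emeasure M (B \<inter> K n - (\<Union>m. C n m)))"
    using B by (intro emeasure_subadditive_countably) auto
  also have "\<dots> = 0" using C by simp
  finally have "emeasure M (B - (\<Union>k. D k)) = 0" by simp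
  moreover have "compact (D k)" "D k \<subseteq> B" for k
    using C(1,2) by (cases "prod_decode k"; force simp: D_def)+
  ultimately show ?thesis using that by blast
qed

end

section \<open>A Tonelli theorem for Borel functions on topological products\<close>

lemma (in sigma_compact_radon) incseq_open_cover:
  obtains V :: "nat \<Rightarrow> 'a set"
  where "\<And>n. open (V n)" "\<And>n. emeasure M (V n) < \<infinity>" "(\<Union>n. V n) = UNIV" "incseq V"
proof -
  obtain O1 :: "nat \<Rightarrow> 'a set" where O1: "\<And>n. open (O1 n)" "\<And>n. emeasure M (O1 n) < \<infinity>" "(\<Union>n. O1 n) = UNIV"
    using finite_open_cover by blast
  define V where "V n = (\<Union>i\<le>n. O1 i)" for n
  have "open (V n)" for n unfolding V_def using O1(1) by (intro open_UN) auto
  moreover have "emeasure M (V n) < \<infinity>" for n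
  proof -
    have "emeasure M (V n) \<le> (\<Sum>i\<le>n. emeasure M (O1 i))"
      unfolding V_def using O1(1) by (intro emeasure_subadditive_finite) auto
    also have "\<dots> < \<infinity>" using O1(2) by (simp add: ennreal_sum_less_top)
    finally show ?thesis .
  qed
  moreover have "(\<Union>n. V n) = UNIV"
  proof (intro equalityI subsetI UNIV_I)
    fix x
    obtain n where "x \<in> O1 n" using O1(3) by (metis UN_E UNIV_I)
    then show "x \<in> (\<Union>n. V n)" by (intro UN_I[of n]) (auto simp: V_def)
  qed
  moreover have "incseq V" unfolding V_def by (intro monoI UN_mono) auto
  ultimately show ?thesis using that by blast
qed

lemma open_section:
  assumes "open B" shows "open (Pair x -` B)"
  using assms by (intro open_vimage continuous_intros)

lemma open_section':
  assumes "open B" shows "open ((\<lambda>x. (x, y)) -` B)"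
  using assms by (intro open_vimage continuous_intros)

definition rectangles :: "('a set \<times> 'b set) set \<Rightarrow> ('a \<times> 'b) set" where
  "rectangles \<R> = (\<Union>(V, W)\<in>\<R>. V \<times> W)"

lemma open_rectangles:
  "(\<And>V W. (V, W) \<in> \<R> \<Longrightarrow> open V \<and> open W) \<Longrightarrow> open (rectangles \<R>)"
  unfolding rectangles_def by (intro open_UN) (auto intro: open_Times)

lemma rectangles_subset:
  "(\<forall>(V, W)\<in>\<R>. open V \<and> open W \<and> V \<times> W \<subseteq> B) \<Longrightarrow> rectangles \<R> \<subseteq> B"
  unfolding rectangles_def by (intro UN_least) auto

context
  fixes N :: "'b::t2_space measure"
  assumes N: "sigma_compact_radon N"
begin

interpretation N: sigma_compact_radon N by (fact N)

text \<open>A compact part \<open>K\<close> of the section with measure above \<open>c\<close> is covered by the second sides of finitely many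
  open rectangles around points of \<open>{x} \<times> K\<close>; the intersection of their first sides is the neighbourhood.\<close>

lemma rectangle_approximation_at:
  fixes B :: "('a::topological_space \<times> 'b) set"
  assumes B: "open B" and c: "c < emeasure N (Pair x -` B)"
  shows "\<exists>\<R> V0. finite \<R> \<and> (\<forall>(V, W)\<in>\<R>. open V \<and> open W \<and> V \<times> W \<subseteq> B) \<and> open V0 \<and> x \<in> V0 \<and>
    (\<forall>x'\<in>V0. c < emeasure N (Pair x' -` rectangles \<R>))"
proof -
  obtain K where K: "compact K" "K \<subseteq> Pair x -` B" "c < emeasure N K"
    using radon_inner_regular_open[OF N.radon open_section[OF B] c] by blast
  have "\<forall>y\<in>K. \<exists>VW. open (fst VW) \<and> open (snd VW) \<and> x \<in> fst VW \<and> y \<in> snd VW \<and> fst VW \<times> snd VW \<subseteq> B"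
  proof
    fix y assume "y \<in> K"
    then have "(x, y) \<in> B" using K(2) by auto
    then obtain V W where "open V" "open W" "(x, y) \<in> V \<times> W" "V \<times> W \<subseteq> B"
      using open_prod_elim[OF B] by metis
    then show "\<exists>VW. open (fst VW) \<and> open (snd VW) \<and> x \<in> fst VW \<and> y \<in> snd VW \<and> fst VW \<times> snd VW \<subseteq> B"
      by (intro exI[of _ "(V, W)"]) simp
  qed
  from bchoice[OF this] obtain f where f: "\<forall>y\<in>K. open (fst (f y)) \<and> open (snd (f y)) \<and> x \<in> fst (f y) \<and>
      y \<in> snd (f y) \<and> fst (f y) \<times> snd (f y) \<subseteq> B" ..
  obtain D where D: "D \<subseteq> K" "finite D" "K \<subseteq> (\<Union>y\<in>D. snd (f y))"
  proof (rule compactE_image[OF K(1), of K "\<lambda>y. snd (f y)"])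
    show "K \<subseteq> (\<Union>y\<in>K. snd (f y))" using f by auto
  qed (use f in auto)
  define V0 where "V0 = (\<Inter>y\<in>D. fst (f y))"
  have "open V0" unfolding V0_def using D f by (intro open_INT) auto
  moreover have "x \<in> V0" unfolding V0_def using D f by auto
  moreover have "c < emeasure N (Pair x' -` rectangles (f ` D))" if "x' \<in> V0" for x'
  proof -
    have "K \<subseteq> Pair x' -` rectangles (f ` D)"
    proof
      fix y assume "y \<in> K"
      then obtain z where "z \<in> D" "y \<in> snd (f z)" using D by auto
      moreover have "x' \<in> fst (f z)" using that \<open>z \<in> D\<close> by (auto simp: V0_def)
      ultimately show "y \<in> Pair x' -` rectangles (f ` D)"
        by (auto simp: rectangles_def case_prod_beta intro!: bexI[of _ z])
    qed
    moreover have "Pair x' -` rectangles (f ` D) \<in> sets N"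
      using f D by (auto simp: image_iff intro!: borel_open open_section open_rectangles) (metis fst_conv snd_conv subsetD)+
    ultimately show ?thesis using K(3) by (meson emeasure_mono order_less_le_trans)
  qed
  moreover have "\<forall>(V, W)\<in>f ` D. open V \<and> open W \<and> V \<times> W \<subseteq> B"
  proof
    fix P assume "P \<in> f ` D"
    then obtain y where "y \<in> D" "P = f y" by auto
    then show "case P of (V, W) \<Rightarrow> open V \<and> open W \<and> V \<times> W \<subseteq> B" using f D(1) by (auto simp: case_prod_beta)
  qed
  ultimately show ?thesis using D(2) by (intro exI[of _ "f ` D"] exI[of _ V0]) simp
qed

lemma rectangle_approximation:
  fixes B :: "('a::topological_space \<times> 'b) set"
  assumes B: "open B" and C: "compact C" and c: "\<forall>x\<in>C. c < emeasure N (Pair x -` B)"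
  shows "\<exists>\<R>. finite \<R> \<and> (\<forall>(V, W)\<in>\<R>. open V \<and> open W \<and> V \<times> W \<subseteq> B) \<and>
    (\<forall>x\<in>C. c < emeasure N (Pair x -` rectangles \<R>))"
proof -
  let ?P = "\<lambda>x \<R> V0. finite \<R> \<and> (\<forall>(V, W)\<in>\<R>. open V \<and> open W \<and> V \<times> W \<subseteq> B) \<and> open V0 \<and> x \<in> V0 \<and>
    (\<forall>x'\<in>V0. c < emeasure N (Pair x' -` rectangles \<R>))"
  have "\<forall>x\<in>C. \<exists>q. ?P x (fst q) (snd q)"
  proof
    fix x assume "x \<in> C"
    then have "c < emeasure N (Pair x -` B)" using c by blast
    from rectangle_approximation_at[OF B this] obtain \<R> V0 where "?P x \<R> V0" by blast
    then show "\<exists>q. ?P x (fst q) (snd q)" by (intro exI[of _ "(\<R>, V0)"]) simp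
  qed
  from bchoice[OF this] obtain f where f: "\<forall>x\<in>C. ?P x (fst (f x)) (snd (f x))" ..
  obtain D where D: "D \<subseteq> C" "finite D" "C \<subseteq> (\<Union>x\<in>D. snd (f x))"
  proof (rule compactE_image[OF C, of C "\<lambda>x. snd (f x)"])
    show "C \<subseteq> (\<Union>x\<in>C. snd (f x))" using f by auto
  qed (use f in auto)
  define \<R> where "\<R> = (\<Union>x\<in>D. fst (f x))"
  have fin: "finite \<R>" unfolding \<R>_def using D f by auto
  have op: "\<forall>(V, W)\<in>\<R>. open V \<and> open W \<and> V \<times> W \<subseteq> B"
  proof
    fix P assume "P \<in> \<R>"
    then obtain x where "x \<in> D" "P \<in> fst (f x)" unfolding \<R>_def by auto
    then show "case P of (V, W) \<Rightarrow> open V \<and> open W \<and> V \<times> W \<subseteq> B" using f D(1) by blast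
  qed
  have "c < emeasure N (Pair x -` rectangles \<R>)" if xC: "x \<in> C" for x
  proof -
    obtain z where z: "z \<in> D" "x \<in> snd (f z)" using subsetD[OF D(3) xC] by auto
    have "c < emeasure N (Pair x -` rectangles (fst (f z)))" using f z D(1) by blast
    also have "\<dots> \<le> emeasure N (Pair x -` rectangles \<R>)"
    proof (rule emeasure_mono)
      have "rectangles (fst (f z)) \<subseteq> rectangles \<R>"
        unfolding rectangles_def \<R>_def using z(1) by (intro UN_mono) auto
      then show "Pair x -` rectangles (fst (f z)) \<subseteq> Pair x -` rectangles \<R>" by auto
      show "Pair x -` rectangles \<R> \<in> sets N"
        using op by (auto intro!: borel_open open_section open_rectangles)
    qed
    finally show ?thesis .
  qed
  with fin op show ?thesis by (intro exI[of _ \<R>]) simp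
qed

text \<open>The measure of the sections of an open set is lower semicontinuous.\<close>

lemma open_superlevel_section:
  fixes B :: "('a::topological_space \<times> 'b) set"
  assumes B: "open B"
  shows "open {x. c < emeasure N (Pair x -` B)}"
proof (subst open_subopen, safe)
  fix x assume "c < emeasure N (Pair x -` B)"
  from rectangle_approximation_at[OF B this] obtain \<R> V0 where
    R: "finite \<R>" "\<forall>(V, W)\<in>\<R>. open V \<and> open W \<and> V \<times> W \<subseteq> B" "open V0" "x \<in> V0"
    "\<forall>x'\<in>V0. c < emeasure N (Pair x' -` rectangles \<R>)" by blast
  have "c < emeasure N (Pair x' -` B)" if "x' \<in> V0" for x'
  proof -
    have "Pair x' -` rectangles \<R> \<subseteq> Pair x' -` B"
      using rectangles_subset[OF R(2)] by auto
    moreover have "Pair x' -` B \<in> sets N" using open_section[OF B] by auto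
    ultimately show ?thesis using R(5) that by (meson emeasure_mono order_less_le_trans)
  qed
  then show "\<exists>T. open T \<and> x \<in> T \<and> T \<subseteq> {x. c < emeasure N (Pair x -` B)}"
    using R by blast
qed

lemma borel_measurable_section_open:
  fixes B :: "('a::topological_space \<times> 'b) set"
  assumes B: "open B"
  shows "(\<lambda>x. emeasure N (Pair x -` B)) \<in> borel_measurable borel"
  by (rule borel_measurableI_greater) (use open_superlevel_section[OF B] in simp)

end

text \<open>Up to a null set of sections, an open set is a countable union of open rectangles. For each rational
  \<open>q\<close> the open set of those \<open>x\<close> whose section has measure above \<open>q\<close> is exhausted by compact sets, up to a null
  set, and over each of these compact sets finitely many rectangles suffice to keep the sections above \<open>q\<close>.\<close>

lemma open_ae_rectangles:
  fixes B :: "('a::t2_space \<times> 'b::t2_space) set"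
  assumes M: "sigma_compact_radon M" and N: "sigma_compact_radon N" and B: "open B"
  shows "\<exists>B'\<in>sets (M \<Otimes>\<^sub>M N). B' \<subseteq> B \<and> (AE x in M. emeasure N (Pair x -` B') = emeasure N (Pair x -` B))"
proof -
  interpret M: sigma_compact_radon M by (fact M)
  interpret N: sigma_compact_radon N by (fact N)
  define S where "S q = {x. ennreal (real_of_rat q) < emeasure N (Pair x -` B)}" for q
  have opS: "open (S q)" for q unfolding S_def by (rule open_superlevel_section[OF N B])
  have "\<forall>q. \<exists>C. (\<forall>n::nat. compact (C n) \<and> C n \<subseteq> S q) \<and> emeasure M (S q - (\<Union>n. C n)) = 0"
    by (intro allI, rule M.sigma_compact_approximation[OF borel_open[OF opS]]) auto
  from choice[OF this] obtain C :: "rat \<Rightarrow> nat \<Rightarrow> 'a set"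
    where C: "\<forall>q. (\<forall>n. compact (C q n) \<and> C q n \<subseteq> S q) \<and> emeasure M (S q - (\<Union>n. C q n)) = 0" ..
  have "\<forall>p. \<exists>\<R>. finite \<R> \<and> (\<forall>(V, W)\<in>\<R>. open V \<and> open W \<and> V \<times> W \<subseteq> B) \<and>
    (\<forall>x\<in>C (fst p) (snd p). ennreal (real_of_rat (fst p)) < emeasure N (Pair x -` rectangles \<R>))"
    by (intro allI rectangle_approximation[OF N B]) (use C in \<open>auto simp: S_def\<close>)
  from choice[OF this] obtain \<R> where \<R>: "\<forall>p. finite (\<R> p) \<and> (\<forall>(V, W)\<in>\<R> p. open V \<and> open W \<and> V \<times> W \<subseteq> B) \<and>
    (\<forall>x\<in>C (fst p) (snd p). ennreal (real_of_rat (fst p)) < emeasure N (Pair x -` rectangles (\<R> p)))" ..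
  define B' where "B' = (\<Union>p. rectangles (\<R> p))"
  have sets: "B' \<in> sets (M \<Otimes>\<^sub>M N)"
  proof -
    have "rectangles (\<R> p) \<in> sets (M \<Otimes>\<^sub>M N)" for p
      unfolding rectangles_def using \<R>[rule_format, of p] by (intro sets.finite_UN) (auto intro!: pair_measureI)
    then show ?thesis unfolding B'_def by (intro sets.countable_UN'') auto
  qed
  have op: "open B'" unfolding B'_def using \<R> by (intro open_UN ballI open_rectangles) blast
  have sub: "B' \<subseteq> B" unfolding B'_def rectangles_def using \<R> by fast
  have "AE x in M. \<forall>q. x \<notin> S q - (\<Union>n. C q n)"
  proof (subst AE_all_countable, intro allI AE_not_in)
    fix q
    have "(\<Union>n. C q n) \<in> sets M"
      using C borel_compact by (intro sets.countable_UN) auto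
    then show "S q - (\<Union>n. C q n) \<in> null_sets M"
      using C opS[of q] by (auto simp: null_sets_def)
  qed
  then have "AE x in M. emeasure N (Pair x -` B') = emeasure N (Pair x -` B)"
  proof eventually_elim
    case (elim x)
    have le: "emeasure N (Pair x -` B') \<le> emeasure N (Pair x -` B)"
      using sub open_section[OF B] by (intro emeasure_mono) auto
    moreover have "\<not> emeasure N (Pair x -` B') < emeasure N (Pair x -` B)"
    proof
      assume "emeasure N (Pair x -` B') < emeasure N (Pair x -` B)"
      then obtain q where q: "emeasure N (Pair x -` B') < real_of_rat q" "real_of_rat q < emeasure N (Pair x -` B)"
        using ennreal_rat_dense by blast
      then have "x \<in> S q" by (simp add: S_def)
      then obtain n where n: "x \<in> C q n" using elim by auto
      have "ennreal (real_of_rat q) < emeasure N (Pair x -` rectangles (\<R> (q, n)))"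
        using \<R>[rule_format, of "(q, n)"] n by simp
      also have "\<dots> \<le> emeasure N (Pair x -` B')"
        using open_section[OF op] unfolding B'_def by (intro emeasure_mono) auto
      finally show False using q by simp
    qed
    ultimately show ?case by simp
  qed
  with sets sub show ?thesis by blast
qed

text \<open>The union of rectangles belongs to the product \<open>\<sigma>\<close>-algebra, so the classical theorem applies to it. As it
  is only contained in \<open>B\<close>, the argument gives an inequality; exchanging the factors gives the other one.\<close>

lemma emeasure_sections_open_le:
  fixes B :: "('a::t2_space \<times> 'b::t2_space) set"
  assumes M: "sigma_compact_radon M" and N: "sigma_compact_radon N" and B: "open B"
  shows "(\<integral>\<^sup>+x. emeasure N (Pair x -` B) \<partial>M) \<le> (\<integral>\<^sup>+y. emeasure M ((\<lambda>x. (x, y)) -` B) \<partial>N)"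
proof -
  interpret M: sigma_compact_radon M by (fact M)
  interpret N: sigma_compact_radon N by (fact N)
  interpret pair_sigma_finite M N
    by (simp add: pair_sigma_finite_def M.sigma_finite N.sigma_finite)
  obtain B' where B': "B' \<in> sets (M \<Otimes>\<^sub>M N)" "B' \<subseteq> B"
    "AE x in M. emeasure N (Pair x -` B') = emeasure N (Pair x -` B)"
    using open_ae_rectangles[OF M N B] by blast
  have "(\<integral>\<^sup>+x. emeasure N (Pair x -` B) \<partial>M) = (\<integral>\<^sup>+x. emeasure N (Pair x -` B') \<partial>M)"
    using B'(3) by (intro nn_integral_cong_AE) auto
  also have "\<dots> = emeasure (M \<Otimes>\<^sub>M N) B'" using B'(1) by (rule M2.emeasure_pair_measure_alt[symmetric])
  also have "\<dots> = (\<integral>\<^sup>+y. emeasure M ((\<lambda>x. (x, y)) -` B') \<partial>N)" using B'(1) by (rule emeasure_pair_measure_alt2)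
  also have "\<dots> \<le> (\<integral>\<^sup>+y. emeasure M ((\<lambda>x. (x, y)) -` B) \<partial>N)"
    using B'(2) open_section'[OF B] by (intro nn_integral_mono emeasure_mono) auto
  finally show ?thesis .
qed

lemma open_swap:
  fixes B :: "('a::topological_space \<times> 'b::topological_space) set"
  assumes "open B" shows "open (prod.swap -` B)"
  using assms by (intro open_vimage) (auto simp: prod.swap_def intro!: continuous_intros)

lemma emeasure_sections_open:
  fixes B :: "('a::t2_space \<times> 'b::t2_space) set"
  assumes M: "sigma_compact_radon M" and N: "sigma_compact_radon N" and B: "open B"
  shows "(\<integral>\<^sup>+x. emeasure N (Pair x -` B) \<partial>M) = (\<integral>\<^sup>+y. emeasure M ((\<lambda>x. (x, y)) -` B) \<partial>N)"
proof (rule antisym)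
  have *: "Pair y -` (prod.swap -` B) = (\<lambda>x. (x, y)) -` B" "(\<lambda>y. (y, x)) -` (prod.swap -` B) = Pair x -` B" for x y
    by auto
  show "(\<integral>\<^sup>+y. emeasure M ((\<lambda>x. (x, y)) -` B) \<partial>N) \<le> (\<integral>\<^sup>+x. emeasure N (Pair x -` B) \<partial>M)"
    using emeasure_sections_open_le[OF N M open_swap[OF B]] unfolding * .
qed (rule emeasure_sections_open_le[OF assms])

lemma borel_measurable_section_open':
  fixes B :: "('a::t2_space \<times> 'b::t2_space) set"
  assumes M: "sigma_compact_radon M" and B: "open B"
  shows "(\<lambda>y. emeasure M ((\<lambda>x. (x, y)) -` B)) \<in> borel_measurable borel"
proof -
  have *: "Pair y -` (prod.swap -` B) = (\<lambda>x. (x, y)) -` B" for y by auto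
  show ?thesis using borel_measurable_section_open[OF M open_swap[OF B]] unfolding * .
qed

lemma sections_in_borel:
  fixes B :: "('a::topological_space \<times> 'b::topological_space) set"
  assumes B: "B \<in> sets borel"
  shows "Pair x -` B \<in> sets borel" "(\<lambda>x. (x, y)) -` B \<in> sets borel"
proof -
  have "Pair x \<in> borel_measurable borel" "(\<lambda>x. (x, y)) \<in> borel_measurable borel"
    by (intro borel_measurable_continuous_onI continuous_intros)+
  from this[THEN measurable_sets, OF B] show "Pair x -` B \<in> sets borel" "(\<lambda>x. (x, y)) -` B \<in> sets borel"
    by auto
qed

lemma emeasure_Int_compl:
  assumes "T \<in> sets M" "S \<in> sets M" "emeasure M T < \<infinity>"
  shows "emeasure M (T \<inter> - S) = emeasure M T - emeasure M (T \<inter> S)"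
proof -
  have "T \<inter> - S = T - T \<inter> S" by auto
  moreover have "emeasure M (T \<inter> S) \<noteq> \<infinity>"
    using assms emeasure_mono[of "T \<inter> S" T M] by (auto simp: top_unique)
  ultimately show ?thesis using assms by (simp add: emeasure_Diff)
qed

lemma emeasure_Int_UN:
  assumes "T \<in> sets M" "\<And>i::nat. S i \<in> sets M" "disjoint_family S"
  shows "emeasure M (T \<inter> (\<Union>i. S i)) = (\<Sum>i. emeasure M (T \<inter> S i))"
proof -
  have "disjoint_family (\<lambda>i. T \<inter> S i)" using assms(3) by (auto simp: disjoint_family_on_def)
  then show ?thesis using assms by (simp add: suminf_emeasure image_subset_iff)
qed

text \<open>Dynkin's argument from open to Borel sets. It is carried out inside a box \<open>V \<times> W\<close> of finite measure
  because the step to the complement subtracts.\<close>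

lemma emeasure_sections_bounded:
  fixes B :: "('a::t2_space \<times> 'b::t2_space) set"
  assumes M: "sigma_compact_radon M" and N: "sigma_compact_radon N"
    and V: "open V" "emeasure M V < \<infinity>" and W: "open W" "emeasure N W < \<infinity>"
    and B: "B \<in> sets borel"
  shows "(\<lambda>x. emeasure N (W \<inter> Pair x -` B)) \<in> borel_measurable borel \<and>
    (\<lambda>y. emeasure M (V \<inter> (\<lambda>x. (x, y)) -` B)) \<in> borel_measurable borel \<and>
    (\<integral>\<^sup>+x. indicator V x * emeasure N (W \<inter> Pair x -` B) \<partial>M) =
      (\<integral>\<^sup>+y. indicator W y * emeasure M (V \<inter> (\<lambda>x. (x, y)) -` B) \<partial>N)"
proof -
  interpret M: sigma_compact_radon M by (fact M)
  interpret N: sigma_compact_radon N by (fact N)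
  have [measurable]: "V \<in> sets borel" "W \<in> sets borel" using V W by auto
  have B': "B \<in> sigma_sets UNIV {S. open S}" using B by (simp add: borel_def)
  have Int: "Int_stable {S :: ('a \<times> 'b) set. open S}" by (auto simp: Int_stable_def)
  have Pow: "{S :: ('a \<times> 'b) set. open S} \<subseteq> Pow UNIV" by simp
  show ?thesis
    using Int Pow B'
  proof (induction rule: sigma_sets_induct_disjoint)
    case (basic A)
    then have A: "open A" by simp
    have *: "Pair x -` (V \<times> W \<inter> A) = (if x \<in> V then W \<inter> Pair x -` A else {})"
      "(\<lambda>x. (x, y)) -` (V \<times> W \<inter> A) = (if y \<in> W then V \<inter> (\<lambda>x. (x, y)) -` A else {})" for x y by auto
    have **: "Pair x -` (UNIV \<times> W \<inter> A) = W \<inter> Pair x -` A"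
      "(\<lambda>x. (x, y)) -` (V \<times> UNIV \<inter> A) = V \<inter> (\<lambda>x. (x, y)) -` A" for x y by auto
    have op: "open (V \<times> W \<inter> A)" "open (UNIV \<times> W \<inter> A)" "open (V \<times> UNIV \<inter> A)"
      using A V W by (auto intro!: open_Times)
    have "(\<integral>\<^sup>+x. indicator V x * emeasure N (W \<inter> Pair x -` A) \<partial>M) = (\<integral>\<^sup>+x. emeasure N (Pair x -` (V \<times> W \<inter> A)) \<partial>M)"
      unfolding * by (intro nn_integral_cong) (simp split: split_indicator)
    also have "\<dots> = (\<integral>\<^sup>+y. emeasure M ((\<lambda>x. (x, y)) -` (V \<times> W \<inter> A)) \<partial>N)"
      by (rule emeasure_sections_open[OF M N op(1)])
    also have "\<dots> = (\<integral>\<^sup>+y. indicator W y * emeasure M (V \<inter> (\<lambda>x. (x, y)) -` A) \<partial>N)"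
      unfolding * by (intro nn_integral_cong) (simp split: split_indicator)
    finally show ?case
      using borel_measurable_section_open[OF N op(2)] borel_measurable_section_open'[OF M op(3)]
      unfolding ** by simp
  next
    case empty
    then show ?case by simp
  next
    case (compl A)
    then have A: "A \<in> sets borel" by (simp add: borel_def)
    note sec = sections_in_borel[OF A]
    have 1: "emeasure N (W \<inter> Pair x -` (UNIV - A)) = emeasure N W - emeasure N (W \<inter> Pair x -` A)" for x
      using emeasure_Int_compl[of W N "Pair x -` A"] sec W(2) by (simp add: Compl_eq_Diff_UNIV vimage_Diff)
    have 2: "emeasure M (V \<inter> (\<lambda>x. (x, y)) -` (UNIV - A)) = emeasure M V - emeasure M (V \<inter> (\<lambda>x. (x, y)) -` A)" for y
      using emeasure_Int_compl[of V M "(\<lambda>x. (x, y)) -` A"] sec V(2) by (simp add: Compl_eq_Diff_UNIV vimage_Diff)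
    have m[measurable]: "(\<lambda>x. emeasure N (W \<inter> Pair x -` A)) \<in> borel_measurable borel"
      "(\<lambda>y. emeasure M (V \<inter> (\<lambda>x. (x, y)) -` A)) \<in> borel_measurable borel" using compl(2) by auto
    define I where "I = (\<integral>\<^sup>+x. indicator V x * emeasure N (W \<inter> Pair x -` A) \<partial>M)"
    have I2: "I = (\<integral>\<^sup>+y. indicator W y * emeasure M (V \<inter> (\<lambda>x. (x, y)) -` A) \<partial>N)"
      unfolding I_def using compl(2) by blast
    have Ifin: "I \<noteq> \<infinity>"
    proof -
      have "I \<le> (\<integral>\<^sup>+x. indicator V x * emeasure N W \<partial>M)"
        unfolding I_def by (intro nn_integral_mono mult_left_mono emeasure_mono) auto
      also have "\<dots> = emeasure M V * emeasure N W" by (simp add: nn_integral_multc)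
      also have "\<dots> < \<infinity>" using V W by (simp add: ennreal_mult_less_top)
      finally show ?thesis by simp
    qed
    have "(\<integral>\<^sup>+x. indicator V x * emeasure N (W \<inter> Pair x -` (UNIV - A)) \<partial>M)
        = (\<integral>\<^sup>+x. indicator V x * emeasure N W - indicator V x * emeasure N (W \<inter> Pair x -` A) \<partial>M)"
      unfolding 1 by (intro nn_integral_cong) (simp split: split_indicator)
    also have "\<dots> = (\<integral>\<^sup>+x. indicator V x * emeasure N W \<partial>M) - I"
      unfolding I_def
    proof (rule nn_integral_diff)
      show "AE x in M. indicator V x * emeasure N (W \<inter> Pair x -` A) \<le> indicator V x * emeasure N W"
        by (intro AE_I2 mult_left_mono emeasure_mono) auto
    qed (use Ifin in \<open>auto simp: I_def\<close>)
    also have "\<dots> = emeasure M V * emeasure N W - I" by (simp add: nn_integral_multc)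
    also have "\<dots> = (\<integral>\<^sup>+y. indicator W y * emeasure M V \<partial>N) - I" by (simp add: nn_integral_multc mult.commute)
    also have "\<dots> = (\<integral>\<^sup>+y. indicator W y * emeasure M V - indicator W y * emeasure M (V \<inter> (\<lambda>x. (x, y)) -` A) \<partial>N)"
      unfolding I2
    proof (rule nn_integral_diff[symmetric])
      show "AE y in N. indicator W y * emeasure M (V \<inter> (\<lambda>x. (x, y)) -` A) \<le> indicator W y * emeasure M V"
        by (intro AE_I2 mult_left_mono emeasure_mono) auto
    qed (use Ifin I2 in auto)
    also have "\<dots> = (\<integral>\<^sup>+y. indicator W y * emeasure M (V \<inter> (\<lambda>x. (x, y)) -` (UNIV - A)) \<partial>N)"
      unfolding 2 by (intro nn_integral_cong) (simp split: split_indicator)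
    finally show ?case unfolding 1 2 by simp
  next
    case (union A)
    have A: "A i \<in> sets borel" for i using union(2) by (auto simp: borel_def)
    note sec = sections_in_borel[OF A]
    have 1: "emeasure N (W \<inter> Pair x -` (\<Union>i. A i)) = (\<Sum>i. emeasure N (W \<inter> Pair x -` A i))" for x
      unfolding vimage_UN using union(1) sec by (intro emeasure_Int_UN) (auto simp: disjoint_family_on_def)
    have 2: "emeasure M (V \<inter> (\<lambda>x. (x, y)) -` (\<Union>i. A i)) = (\<Sum>i. emeasure M (V \<inter> (\<lambda>x. (x, y)) -` A i))" for y
      unfolding vimage_UN using union(1) sec by (intro emeasure_Int_UN) (auto simp: disjoint_family_on_def)
    have m[measurable]: "(\<lambda>x. emeasure N (W \<inter> Pair x -` A i)) \<in> borel_measurable borel"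
      "(\<lambda>y. emeasure M (V \<inter> (\<lambda>x. (x, y)) -` A i)) \<in> borel_measurable borel" for i using union(3) by auto
    have "(\<integral>\<^sup>+x. indicator V x * (\<Sum>i. emeasure N (W \<inter> Pair x -` A i)) \<partial>M)
      = (\<Sum>i. \<integral>\<^sup>+x. indicator V x * emeasure N (W \<inter> Pair x -` A i) \<partial>M)"
      unfolding ennreal_suminf_cmult[symmetric] by (rule nn_integral_suminf) simp
    also have "\<dots> = (\<Sum>i. \<integral>\<^sup>+y. indicator W y * emeasure M (V \<inter> (\<lambda>x. (x, y)) -` A i) \<partial>N)"
      using union(3) by simp
    also have "\<dots> = (\<integral>\<^sup>+y. indicator W y * (\<Sum>i. emeasure M (V \<inter> (\<lambda>x. (x, y)) -` A i)) \<partial>N)"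
      unfolding ennreal_suminf_cmult[symmetric] by (rule nn_integral_suminf[symmetric]) simp
    finally show ?case unfolding 1 2 by simp
  qed
qed

lemma incseq_indicator_mult:
  fixes f :: "nat \<Rightarrow> 'a \<Rightarrow> ennreal"
  assumes "incseq V" "\<And>x. incseq (\<lambda>n. f n x)"
  shows "incseq (\<lambda>n x. indicator (V n) x * f n x)"
proof (intro monoI le_funI mult_mono)
  fix m n :: nat and x assume "m \<le> n"
  then show "(indicator (V m) x :: ennreal) \<le> indicator (V n) x"
    using incseqD[OF assms(1)] by (auto split: split_indicator)
  show "f m x \<le> f n x" using assms(2) \<open>m \<le> n\<close> by (rule incseqD)
qed auto

lemma SUP_indicator_mult:
  fixes f :: "nat \<Rightarrow> ennreal"
  assumes "incseq V" "(\<Union>n. V n) = UNIV" "incseq f"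
  shows "(SUP n. indicator (V n) x * f n) = (SUP n. f n)"
proof (rule antisym)
  show "(SUP n. indicator (V n) x * f n) \<le> (SUP n. f n)"
    by (intro SUP_mono) (auto split: split_indicator)
  obtain m where m: "x \<in> V m" using assms(2) by (metis UN_E UNIV_I)
  show "(SUP n. f n) \<le> (SUP n. indicator (V n) x * f n)"
  proof (rule SUP_mono)
    fix n
    have "x \<in> V (max m n)" using m assms(1) by (meson max.cobounded1 monoD subsetD)
    then show "\<exists>k\<in>UNIV. f n \<le> indicator (V k) x * f k"
      using assms(3) by (intro bexI[of _ "max m n"]) (auto simp: incseq_def)
  qed
qed

lemma emeasure_sections:
  fixes B :: "('a::t2_space \<times> 'b::t2_space) set"
  assumes M: "sigma_compact_radon M" and N: "sigma_compact_radon N" and B: "B \<in> sets borel"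
  shows "(\<lambda>x. emeasure N (Pair x -` B)) \<in> borel_measurable borel"
    and "(\<lambda>y. emeasure M ((\<lambda>x. (x, y)) -` B)) \<in> borel_measurable borel"
    and "(\<integral>\<^sup>+x. emeasure N (Pair x -` B) \<partial>M) = (\<integral>\<^sup>+y. emeasure M ((\<lambda>x. (x, y)) -` B) \<partial>N)"
proof -
  interpret M: sigma_compact_radon M by (fact M)
  interpret N: sigma_compact_radon N by (fact N)
  note sec = sections_in_borel[OF B]
  obtain V :: "nat \<Rightarrow> 'a set" where V: "\<And>n. open (V n)" "\<And>n. emeasure M (V n) < \<infinity>" "(\<Union>n. V n) = UNIV" "incseq V"
    by (rule M.incseq_open_cover) blast
  obtain W :: "nat \<Rightarrow> 'b set" where W: "\<And>n. open (W n)" "\<And>n. emeasure N (W n) < \<infinity>" "(\<Union>n. W n) = UNIV" "incseq W"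
    by (rule N.incseq_open_cover) blast
  note bdd = emeasure_sections_bounded[OF M N V(1,2) W(1,2) B]
  have m[measurable]: "(\<lambda>x. emeasure N (W n \<inter> Pair x -` B)) \<in> borel_measurable borel"
    "(\<lambda>y. emeasure M (V n \<inter> (\<lambda>x. (x, y)) -` B)) \<in> borel_measurable borel"
    "V n \<in> sets borel" "W n \<in> sets borel" for n
    using bdd[of n n] V(1) W(1) by auto
  have incW: "incseq (\<lambda>n. W n \<inter> Pair x -` B)" for x using W(4) by (auto simp: incseq_def)
  have incV: "incseq (\<lambda>n. V n \<inter> (\<lambda>x. (x, y)) -` B)" for y using V(4) by (auto simp: incseq_def)
  have supW: "emeasure N (Pair x -` B) = (SUP n. emeasure N (W n \<inter> Pair x -` B))" for x
  proof -
    have "Pair x -` B = (\<Union>n. W n \<inter> Pair x -` B)" using W(3) by simp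
    then show ?thesis using incW sec by (subst SUP_emeasure_incseq) auto
  qed
  have supV: "emeasure M ((\<lambda>x. (x, y)) -` B) = (SUP n. emeasure M (V n \<inter> (\<lambda>x. (x, y)) -` B))" for y
  proof -
    have "(\<lambda>x. (x, y)) -` B = (\<Union>n. V n \<inter> (\<lambda>x. (x, y)) -` B)" using V(3) by simp
    then show ?thesis using incV sec by (subst SUP_emeasure_incseq) auto
  qed
  show "(\<lambda>x. emeasure N (Pair x -` B)) \<in> borel_measurable borel" unfolding supW by measurable
  show "(\<lambda>y. emeasure M ((\<lambda>x. (x, y)) -` B)) \<in> borel_measurable borel" unfolding supV by measurable
  note indV = SUP_indicator_mult[OF V(4,3)] and indW = SUP_indicator_mult[OF W(4,3)]
  have iN: "incseq (\<lambda>n. emeasure N (W n \<inter> Pair x -` B))" for x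
    using incW[of x] sec by (intro incseq_emeasure) auto
  have iM: "incseq (\<lambda>n. emeasure M (V n \<inter> (\<lambda>x. (x, y)) -` B))" for y
    using incV[of y] sec by (intro incseq_emeasure) auto
  have "(\<integral>\<^sup>+x. emeasure N (Pair x -` B) \<partial>M) = (\<integral>\<^sup>+x. (SUP n. indicator (V n) x * emeasure N (W n \<inter> Pair x -` B)) \<partial>M)"
    unfolding supW indV[OF iN] ..
  also have "\<dots> = (SUP n. \<integral>\<^sup>+x. indicator (V n) x * emeasure N (W n \<inter> Pair x -` B) \<partial>M)"
  proof (rule nn_integral_monotone_convergence_SUP)
    show "incseq (\<lambda>n x. indicator (V n) x * emeasure N (W n \<inter> Pair x -` B))"
      using V(4) iN by (rule incseq_indicator_mult)
  qed simp
  also have "\<dots> = (SUP n. \<integral>\<^sup>+y. indicator (W n) y * emeasure M (V n \<inter> (\<lambda>x. (x, y)) -` B) \<partial>N)"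
    using bdd by simp
  also have "\<dots> = (\<integral>\<^sup>+y. (SUP n. indicator (W n) y * emeasure M (V n \<inter> (\<lambda>x. (x, y)) -` B)) \<partial>N)"
  proof (rule nn_integral_monotone_convergence_SUP[symmetric])
    show "incseq (\<lambda>n y. indicator (W n) y * emeasure M (V n \<inter> (\<lambda>x. (x, y)) -` B))"
      using W(4) iM by (rule incseq_indicator_mult)
  qed simp
  also have "\<dots> = (\<integral>\<^sup>+y. emeasure M ((\<lambda>x. (x, y)) -` B) \<partial>N)"
    unfolding supV indW[OF iM] ..
  finally show "(\<integral>\<^sup>+x. emeasure N (Pair x -` B) \<partial>M) = (\<integral>\<^sup>+y. emeasure M ((\<lambda>x. (x, y)) -` B) \<partial>N)" .
qed

text \<open>Tonelli's theorem for every nonnegative Borel function on the topological product, whose Borel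
  \<open>\<sigma>\<close>-algebra can be larger than that of \<open>M \<Otimes>\<^sub>M N\<close>.\<close>

definition borel_fubini :: "'a::topological_space measure \<Rightarrow> 'b::topological_space measure \<Rightarrow> bool" where
  "borel_fubini M N \<longleftrightarrow> sets M = sets borel \<and> sets N = sets borel \<and>
    (\<forall>K\<in>borel_measurable (borel :: ('a \<times> 'b) measure).
      (\<lambda>x. \<integral>\<^sup>+y. K (x, y) \<partial>N) \<in> borel_measurable borel \<and>
      (\<lambda>y. \<integral>\<^sup>+x. K (x, y) \<partial>M) \<in> borel_measurable borel \<and>
      (\<integral>\<^sup>+x. \<integral>\<^sup>+y. K (x, y) \<partial>N \<partial>M) = (\<integral>\<^sup>+y. \<integral>\<^sup>+x. K (x, y) \<partial>M \<partial>N))"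

lemma borel_measurable_Pair_sections:
  fixes K :: "'a::topological_space \<times> 'b::topological_space \<Rightarrow> 'c::topological_space"
  assumes "K \<in> borel_measurable borel"
  shows "(\<lambda>y. K (x, y)) \<in> borel_measurable borel" "(\<lambda>x. K (x, y)) \<in> borel_measurable borel"
  by (intro measurable_compose[OF _ assms] borel_measurable_continuous_onI continuous_intros)+

lemma radon_borel_fubini:
  fixes M :: "'a::t2_space measure" and N :: "'b::t2_space measure"
  assumes M: "sigma_compact_radon M" and N: "sigma_compact_radon N"
  shows "borel_fubini M N"
proof -
  interpret M: sigma_compact_radon M by (fact M)
  interpret N: sigma_compact_radon N by (fact N)
  have "(\<lambda>x. \<integral>\<^sup>+y. K (x, y) \<partial>N) \<in> borel_measurable borel \<and>
      (\<lambda>y. \<integral>\<^sup>+x. K (x, y) \<partial>M) \<in> borel_measurable borel \<and>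
      (\<integral>\<^sup>+x. \<integral>\<^sup>+y. K (x, y) \<partial>N \<partial>M) = (\<integral>\<^sup>+y. \<integral>\<^sup>+x. K (x, y) \<partial>M \<partial>N)"
    if "K \<in> borel_measurable (borel :: ('a \<times> 'b) measure)" for K :: "'a \<times> 'b \<Rightarrow> ennreal"
    using that
  proof (induction rule: borel_measurable_induct)
    case (cong f g)
    then have "f = g" by auto
    with cong show ?case by simp
  next
    case (set B)
    have "(\<integral>\<^sup>+y. indicator B (x, y) \<partial>N) = emeasure N (Pair x -` B)" for x
    proof -
      have "(\<lambda>y. indicator B (x, y) :: ennreal) = indicator (Pair x -` B)" by (auto simp: indicator_def fun_eq_iff)
      then show ?thesis using sections_in_borel(1)[OF set, of x] by simp
    qed
    moreover have "(\<integral>\<^sup>+x. indicator B (x, y) \<partial>M) = emeasure M ((\<lambda>x. (x, y)) -` B)" for y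
    proof -
      have "(\<lambda>x. indicator B (x, y) :: ennreal) = indicator ((\<lambda>x. (x, y)) -` B)" by (auto simp: indicator_def fun_eq_iff)
      then show ?thesis using sections_in_borel(2)[OF set, of y] by simp
    qed
    ultimately show ?case using emeasure_sections[OF M N set] by simp
  next
    case (mult u c)
    note [measurable] = borel_measurable_Pair_sections[OF mult(2)] mult(4)[THEN conjunct1]
      mult(4)[THEN conjunct2, THEN conjunct1]
    from mult show ?case by (simp add: nn_integral_cmult)
  next
    case (add u v)
    note [measurable] = borel_measurable_Pair_sections[OF add.hyps(1)] borel_measurable_Pair_sections[OF add.hyps(3)]
      add.IH[THEN conjunct1] add.IH[THEN conjunct2, THEN conjunct1]
    from add show ?case by (simp add: nn_integral_add)
  next
    case (seq U)
    note m = borel_measurable_Pair_sections[OF seq(1)]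
    have 1: "(\<integral>\<^sup>+y. (SUP i. U i) (x, y) \<partial>N) = (SUP i. \<integral>\<^sup>+y. U i (x, y) \<partial>N)" for x
      unfolding SUP_apply using seq m
      by (intro nn_integral_monotone_convergence_SUP) (auto simp: incseq_def le_fun_def)
    have 2: "(\<integral>\<^sup>+x. (SUP i. U i) (x, y) \<partial>M) = (SUP i. \<integral>\<^sup>+x. U i (x, y) \<partial>M)" for y
      unfolding SUP_apply using seq m
      by (intro nn_integral_monotone_convergence_SUP) (auto simp: incseq_def le_fun_def)
    have [measurable]: "(\<lambda>x. \<integral>\<^sup>+y. U i (x, y) \<partial>N) \<in> borel_measurable borel"
      "(\<lambda>y. \<integral>\<^sup>+x. U i (x, y) \<partial>M) \<in> borel_measurable borel" for i using seq by auto
    have 3: "(\<integral>\<^sup>+x. (SUP i. \<integral>\<^sup>+y. U i (x, y) \<partial>N) \<partial>M) = (SUP i. \<integral>\<^sup>+x. \<integral>\<^sup>+y. U i (x, y) \<partial>N \<partial>M)"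
      using seq(3) by (intro nn_integral_monotone_convergence_SUP)
        (auto simp: incseq_def le_fun_def intro!: nn_integral_mono)
    have 4: "(\<integral>\<^sup>+y. (SUP i. \<integral>\<^sup>+x. U i (x, y) \<partial>M) \<partial>N) = (SUP i. \<integral>\<^sup>+y. \<integral>\<^sup>+x. U i (x, y) \<partial>M \<partial>N)"
      using seq(3) by (intro nn_integral_monotone_convergence_SUP)
        (auto simp: incseq_def le_fun_def intro!: nn_integral_mono)
    show ?case unfolding 1 2 3 4 using seq by auto
  qed
  then show ?thesis by (simp add: borel_fubini_def)
qed

section \<open>Haar measure: uniqueness and the modular function\<close>

lemma borel_fubini_iterate:
  assumes "borel_fubini M N" "K \<in> borel_measurable borel"
  shows "(\<integral>\<^sup>+x. \<integral>\<^sup>+y. K (x, y) \<partial>N \<partial>M) = (\<integral>\<^sup>+y. \<integral>\<^sup>+x. K (x, y) \<partial>M \<partial>N)"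
  using assms by (simp add: borel_fubini_def)

lemma borel_fubini_measurable:
  assumes "borel_fubini M N" "K \<in> borel_measurable borel"
  shows "(\<lambda>x. \<integral>\<^sup>+y. K (x, y) \<partial>N) \<in> borel_measurable borel"
    and "(\<lambda>y. \<integral>\<^sup>+x. K (x, y) \<partial>M) \<in> borel_measurable borel"
  using assms by (auto simp: borel_fubini_def)

lemma borel_fubini_sets:
  assumes "borel_fubini M N" shows "sets M = sets borel" "sets N = sets borel"
  using assms by (auto simp: borel_fubini_def)

lemma borel_measurable_compose_on_closed:
  fixes K :: "'b::topological_space \<Rightarrow> ennreal" and q :: "'a::topological_space \<Rightarrow> 'b"
  assumes "K \<in> borel_measurable borel" "closed C" "continuous_on C q"
  shows "(\<lambda>x. indicator C x * K (q x)) \<in> borel_measurable borel"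
proof -
  have "q \<in> borel_measurable (restrict_space borel C)"
    using assms(3) by (rule borel_measurable_continuous_on_restrict)
  then have "(\<lambda>x. K (q x)) \<in> borel_measurable (restrict_space borel C)"
    by (rule measurable_compose[OF _ assms(1)])
  moreover have "C \<inter> space borel \<in> sets (borel :: 'a measure)" using assms(2) by simp
  ultimately show ?thesis
    by (subst (asm) borel_measurable_restrict_space_iff_ennreal) (auto simp: mult.commute)
qed

text \<open>Tonelli's theorem for an image of a restriction of \<open>N\<close>. The map has to be continuous where it matters: if
  \<open>t\<close> is merely Borel, then \<open>(x, y) \<mapsto> (x, t y)\<close> need not be Borel. The measure \<open>N'\<close> serves to know that the integral
  over \<open>x\<close> is a Borel function of the second variable.\<close>

lemma borel_fubini_distr:
  fixes M :: "'a::topological_space measure" and N :: "'b::topological_space measure"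
    and t :: "'b \<Rightarrow> 'c::topological_space"
  assumes MN: "borel_fubini M N" and MN': "borel_fubini M (N' :: 'c measure)"
    and C: "closed C" and t: "continuous_on C t" and t_meas: "t \<in> borel_measurable borel"
  shows "borel_fubini M (distr (density N (indicator C)) borel t)" (is "borel_fubini M ?D")
  unfolding borel_fubini_def
proof (intro conjI ballI)
  note sets[measurable_cong] = borel_fubini_sets[OF MN]
  note t_meas[measurable]
  have [measurable]: "C \<in> sets borel" using C by simp
  show "sets M = sets borel" by (rule sets)
  show "sets ?D = sets borel" by simp
  fix K :: "'a \<times> 'c \<Rightarrow> ennreal" assume K: "K \<in> borel_measurable borel"
  note sec[measurable] = borel_measurable_Pair_sections[OF K]
  have "(\<lambda>p. indicator (UNIV \<times> C) p * K (fst p, t (snd p))) \<in> borel_measurable borel"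
    using K C t by (intro borel_measurable_compose_on_closed closed_Times continuous_intros continuous_on_compose2[OF t]) auto
  then have L: "(\<lambda>p. indicator C (snd p) * K (fst p, t (snd p))) \<in> borel_measurable borel"
    by (simp add: indicator_def mem_Times_iff)
  note F = borel_fubini_measurable[OF MN L] borel_fubini_iterate[OF MN L]
  show Mm[measurable]: "(\<lambda>y. \<integral>\<^sup>+x. K (x, y) \<partial>M) \<in> borel_measurable borel"
    using borel_fubini_measurable[OF MN' K] by simp
  have int: "nn_integral ?D k = (\<integral>\<^sup>+y. indicator C y * k (t y) \<partial>N)" if [measurable]: "k \<in> borel_measurable borel" for k
    by (subst nn_integral_distr) (auto simp: nn_integral_density)
  have *: "(\<integral>\<^sup>+y. K (x, y) \<partial>?D) = (\<integral>\<^sup>+y. indicator C y * K (x, t y) \<partial>N)" for x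
    using sec by (intro int) simp
  show "(\<lambda>x. \<integral>\<^sup>+y. K (x, y) \<partial>?D) \<in> borel_measurable borel"
    unfolding * using F(1) by simp
  have "(\<integral>\<^sup>+x. \<integral>\<^sup>+y. K (x, y) \<partial>?D \<partial>M) = (\<integral>\<^sup>+y. \<integral>\<^sup>+x. indicator C y * K (x, t y) \<partial>M \<partial>N)"
    unfolding * using F(3) by simp
  also have "\<dots> = (\<integral>\<^sup>+y. indicator C y * (\<integral>\<^sup>+x. K (x, t y) \<partial>M) \<partial>N)"
    by (intro nn_integral_cong nn_integral_cmult) simp
  also have "\<dots> = (\<integral>\<^sup>+y. \<integral>\<^sup>+x. K (x, y) \<partial>M \<partial>?D)"
    by (rule int[symmetric]) simp
  finally show "(\<integral>\<^sup>+x. \<integral>\<^sup>+y. K (x, y) \<partial>?D \<partial>M) = (\<integral>\<^sup>+y. \<integral>\<^sup>+x. K (x, y) \<partial>M \<partial>?D)" .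
qed

lemma compact_plus_group:
  fixes S T :: "'a::topological_group_add set"
  assumes "compact S" "compact T"
  shows "compact {x + y | x y. x \<in> S \<and> y \<in> T}"
proof -
  have "{x + y | x y. x \<in> S \<and> y \<in> T} = (\<lambda>p. fst p + snd p) ` (S \<times> T)" by force
  then show ?thesis
    using assms by (auto intro!: compact_continuous_image compact_Times continuous_intros)
qed

lemma open_plus_left: "open V \<Longrightarrow> open {x. g + x \<in> V}" for g :: "'a::topological_group_add"
  using open_vimage[of V "\<lambda>x. g + x"] by (simp add: vimage_def continuous_on_add)

lemma open_plus_right: "open V \<Longrightarrow> open {x. x + g \<in> V}" for g :: "'a::topological_group_add"
  using open_vimage[of V "\<lambda>x. x + g"] by (simp add: vimage_def continuous_on_add)

lemma group_operations_measurable [measurable]: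
  fixes g :: "'a::topological_group_add"
  shows "(\<lambda>x. g + x) \<in> borel_measurable borel" "(\<lambda>x. x + g) \<in> borel_measurable borel"
    "(\<lambda>x. g - x) \<in> borel_measurable borel" "(\<lambda>x. x - g) \<in> borel_measurable borel"
    "(\<lambda>x. - g + x) \<in> borel_measurable borel" "(uminus :: 'a \<Rightarrow> 'a) \<in> borel_measurable borel"
  by (intro borel_measurable_continuous_onI continuous_intros)+

definition left_invariant :: "'a::topological_group_add measure \<Rightarrow> bool" where
  "left_invariant N \<longleftrightarrow> sets N = sets borel \<and>
    (\<forall>g. \<forall>f\<in>borel_measurable borel. (\<integral>\<^sup>+x. f (g + x) \<partial>N) = (\<integral>\<^sup>+x. f x \<partial>N))"

lemma haar_left_invariant:
  fixes M :: "'a::topological_group_add measure"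
  assumes "left_haar_measure M"
  shows "left_invariant M"
proof -
  have sets[measurable_cong]: "sets M = sets borel"
    using assms by (simp add: left_haar_measure_def radon_measure_def)
  have sp: "space M = UNIV" using sets_eq_imp_space_eq[OF sets] by simp
  have "distr M borel (\<lambda>x. g + x) = M" for g
  proof (rule measure_eqI)
    fix V assume "V \<in> sets (distr M borel (\<lambda>x. g + x))"
    then have V: "V \<in> sets borel" by simp
    have "(\<lambda>x. g + x) -` V = (\<lambda>x. - g + x) ` V"
      by (auto simp: image_iff intro!: bexI[of _ "g + _"])
    then show "emeasure (distr M borel (\<lambda>x. g + x)) V = emeasure M V"
      using V assms by (simp add: emeasure_distr sp left_haar_measure_def)
  qed (simp add: sets)
  then have "(\<integral>\<^sup>+x. f (g + x) \<partial>M) = (\<integral>\<^sup>+x. f x \<partial>M)" if "f \<in> borel_measurable borel" for f g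
    using nn_integral_distr[of "\<lambda>x. g + x" M borel f] that by simp
  with sets show ?thesis by (simp add: left_invariant_def)
qed

lemma left_invariantD:
  "left_invariant N \<Longrightarrow> f \<in> borel_measurable borel \<Longrightarrow> (\<integral>\<^sup>+x. f (g + x) \<partial>N) = (\<integral>\<^sup>+x. f x \<partial>N)"
  by (simp add: left_invariant_def)

text \<open>The shears \<open>(x, y) \<mapsto> (x, xy)\<close> and \<open>(x, y) \<mapsto> (yx, y)\<close> preserve \<open>M \<times> N\<close>; hence so does
  \<open>(x, y) \<mapsto> (y\<inverse>, xy)\<close>.\<close>

lemma shear_identity:
  fixes M N :: "'a::topological_group_add measure" and u v :: "'a \<Rightarrow> ennreal"
  assumes MN: "borel_fubini M N" and M: "left_invariant M" and N: "left_invariant N"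
    and u: "u \<in> borel_measurable borel" and v: "v \<in> borel_measurable borel"
  shows "(\<integral>\<^sup>+x. u x \<partial>M) * (\<integral>\<^sup>+y. v y \<partial>N) = (\<integral>\<^sup>+y. u (- y) * (\<integral>\<^sup>+x. v (x + y) \<partial>M) \<partial>N)"
proof -
  note [measurable_cong] = borel_fubini_sets[OF MN]
  note u[measurable] v[measurable]
  have comp: "(\<lambda>p. u (q p) * v (r p)) \<in> borel_measurable borel"
    if "continuous_on UNIV q" "continuous_on UNIV r" for q r :: "'a \<times> 'a \<Rightarrow> 'a"
    using measurable_compose[OF borel_measurable_continuous_onI[OF that(1)] u]
      measurable_compose[OF borel_measurable_continuous_onI[OF that(2)] v] by simp
  have comp1: "(\<lambda>p. v (r p)) \<in> borel_measurable borel" if "continuous_on UNIV r" for r :: "'a \<Rightarrow> 'a"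
    using measurable_compose[OF borel_measurable_continuous_onI[OF that] v] by simp
  have comp2: "(\<lambda>p. u (q p) * v (r p)) \<in> borel_measurable borel"
    if "continuous_on UNIV q" "continuous_on UNIV r" for q r :: "'a \<Rightarrow> 'a"
    using measurable_compose[OF borel_measurable_continuous_onI[OF that(1)] u]
      measurable_compose[OF borel_measurable_continuous_onI[OF that(2)] v] by simp
  have [measurable]: "(\<lambda>y. v (x + y)) \<in> borel_measurable borel" "(\<lambda>y. v (y + x)) \<in> borel_measurable borel" for x
    by (intro comp1 continuous_intros)+
  have "(\<integral>\<^sup>+x. u x \<partial>M) * (\<integral>\<^sup>+y. v y \<partial>N) = (\<integral>\<^sup>+x. u x * (\<integral>\<^sup>+y. v (x + y) \<partial>N) \<partial>M)"
    by (simp add: left_invariantD[OF N v] nn_integral_multc)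
  also have "\<dots> = (\<integral>\<^sup>+x. \<integral>\<^sup>+y. u x * v (x + y) \<partial>N \<partial>M)"
    by (simp add: nn_integral_cmult)
  also have "\<dots> = (\<integral>\<^sup>+y. \<integral>\<^sup>+x. u x * v (x + y) \<partial>M \<partial>N)"
    using borel_fubini_iterate[OF MN comp[of fst "\<lambda>p. fst p + snd p"]] by (simp add: continuous_intros)
  also have "\<dots> = (\<integral>\<^sup>+y. \<integral>\<^sup>+x. u (- y + x) * v (- y + x + y) \<partial>M \<partial>N)"
    by (intro nn_integral_cong left_invariantD[OF M, symmetric, where f = "\<lambda>x. u x * v (x + _)"] comp2 continuous_intros)
  also have "\<dots> = (\<integral>\<^sup>+x. \<integral>\<^sup>+y. u (- y + x) * v (- y + x + y) \<partial>N \<partial>M)"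
    using borel_fubini_iterate[OF MN comp[of "\<lambda>p. - snd p + fst p" "\<lambda>p. - snd p + fst p + snd p"]]
    by (simp add: continuous_intros)
  also have "\<dots> = (\<integral>\<^sup>+x. \<integral>\<^sup>+y. u (- (x + y) + x) * v (- (x + y) + x + (x + y)) \<partial>N \<partial>M)"
    by (intro nn_integral_cong left_invariantD[OF N, symmetric, where f = "\<lambda>y. u (- y + _) * v (- y + _ + y)"]
        comp2 continuous_intros)
  also have "\<dots> = (\<integral>\<^sup>+x. \<integral>\<^sup>+y. u (- y) * v (- y + x + y) \<partial>N \<partial>M)"
    by (simp add: minus_add add.assoc)
  also have "\<dots> = (\<integral>\<^sup>+y. \<integral>\<^sup>+x. u (- y) * v (- y + x + y) \<partial>M \<partial>N)"
    using borel_fubini_iterate[OF MN comp[of "\<lambda>p. - snd p" "\<lambda>p. - snd p + fst p + snd p"]]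
    by (simp add: continuous_intros)
  also have "\<dots> = (\<integral>\<^sup>+y. \<integral>\<^sup>+x. u (- y) * v (- y + (y + x) + y) \<partial>M \<partial>N)"
    by (intro nn_integral_cong left_invariantD[OF M, symmetric, where f = "\<lambda>x. u (- _) * v (- _ + x + _)"]
        comp2 continuous_intros)
  also have "\<dots> = (\<integral>\<^sup>+y. u (- y) * (\<integral>\<^sup>+x. v (x + y) \<partial>M) \<partial>N)"
    by (simp add: nn_integral_cmult add.assoc[symmetric])
  finally show ?thesis .
qed

locale haar_group = sigma_compact_radon M
  for M :: "'a::{topological_group_add, t2_space} measure" +
  assumes haar: "left_haar_measure M"
    and compact_nhd: "\<exists>K W. compact K \<and> open W \<and> (0::'a) \<in> W \<and> W \<subseteq> K"
begin

lemma left_inv: "left_invariant M"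
  using haar by (rule haar_left_invariant)

lemma fubini: "borel_fubini M M"
  by (intro radon_borel_fubini) unfold_locales

lemma emeasure_open_pos:
  assumes V: "open V" "V \<noteq> {}" shows "emeasure M V \<noteq> 0"
proof
  assume 0: "emeasure M V = 0"
  have tr: "emeasure M {x. g + x \<in> V} = 0" for g
  proof -
    have "(\<integral>\<^sup>+x. indicator V (g + x) \<partial>M) = (\<integral>\<^sup>+x. indicator V x \<partial>M)"
      using V by (intro left_invariantD[OF left_inv]) auto
    moreover have "(\<lambda>x. indicator V (g + x) :: ennreal) = indicator {x. g + x \<in> V}"
      by (auto simp: indicator_def)
    ultimately show ?thesis using 0 V open_plus_left[OF V(1), of g] by simp
  qed
  obtain v where v: "v \<in> V" using V by auto
  have K0: "emeasure M K = 0" if K: "compact K" for K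
  proof -
    obtain D where D: "D \<subseteq> K" "finite D" "K \<subseteq> (\<Union>y\<in>D. {x. v - y + x \<in> V})"
    proof (rule compactE_image[OF K, of K "\<lambda>y. {x. v - y + x \<in> V}"])
      show "K \<subseteq> (\<Union>y\<in>K. {x. v - y + x \<in> V})" using v by auto
    qed (use open_plus_left[OF V(1)] in auto)
    have "emeasure M K \<le> emeasure M (\<Union>y\<in>D. {x. v - y + x \<in> V})"
      using D open_plus_left[OF V(1)] by (intro emeasure_mono) auto
    also have "\<dots> \<le> (\<Sum>y\<in>D. emeasure M {x. v - y + x \<in> V})"
      using D open_plus_left[OF V(1)] by (intro emeasure_subadditive_finite) auto
    finally show ?thesis using tr by simp
  qed
  have "emeasure M UNIV = 0" using emeasure_open[of UNIV] K0 by (auto intro!: antisym SUP_least)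
  then show False using haar by (simp add: left_haar_measure_def)
qed

lemma emeasure_translate_nontrivial:
  assumes W: "open W" "W \<noteq> {}" "W \<subseteq> K" "compact K"
  shows "emeasure M {x. x + y \<in> W} \<noteq> 0" "emeasure M {x. x + y \<in> W} \<noteq> \<infinity>"
proof -
  obtain a where "a \<in> W" using W by auto
  then have "a - y \<in> {x. x + y \<in> W}" by simp
  then show "emeasure M {x. x + y \<in> W} \<noteq> 0"
    using emeasure_open_pos[OF open_plus_right[OF W(1), of y]] by blast
  have c: "compact ((\<lambda>x. x - y) ` K)"
    using W by (intro compact_continuous_image continuous_intros) auto
  have "{x. x + y \<in> W} \<subseteq> (\<lambda>x. x - y) ` K"
  proof
    fix x assume "x \<in> {x. x + y \<in> W}"
    then show "x \<in> (\<lambda>x. x - y) ` K" using W by (intro image_eqI[of _ _ "x + y"]) auto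
  qed
  then have "emeasure M {x. x + y \<in> W} \<le> emeasure M ((\<lambda>x. x - y) ` K)"
    using c by (intro emeasure_mono) (auto intro: borel_compact)
  then show "emeasure M {x. x + y \<in> W} \<noteq> \<infinity>"
    using emeasure_compact_finite[OF c] by (auto simp: top_unique)
qed

lemma finite_positive_set:
  assumes W: "open W" "W \<noteq> {}" "W \<subseteq> K" "compact K"
  obtains m where "emeasure M W = ennreal m" "m > 0"
  using emeasure_translate_nontrivial[OF W, of 0] that
  by (cases "emeasure M W") (auto simp: zero_less_iff_neq_zero)

lemma measurable_translates:
  assumes "W \<in> sets borel"
  shows "(\<lambda>y. \<integral>\<^sup>+x. indicator W (x + y) \<partial>M) \<in> borel_measurable borel"
proof -
  have "(\<lambda>p. fst p + snd p :: 'a) \<in> borel_measurable borel"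
    by (intro borel_measurable_continuous_onI continuous_intros)
  from measurable_compose[OF this borel_measurable_indicator[OF assms]]
  have "(\<lambda>p. indicator W (fst p + snd p) :: ennreal) \<in> borel_measurable (borel :: ('a \<times> 'a) measure)" .
  from borel_fubini_measurable(2)[OF fubini this] show ?thesis by simp
qed

lemma nn_integral_translate_indicator:
  assumes "W \<in> sets borel"
  shows "(\<integral>\<^sup>+x. indicator W (x + y) \<partial>M) = emeasure M {x. x + y \<in> W}"
proof -
  have "(\<lambda>x. indicator W (x + y) :: ennreal) = indicator {x. x + y \<in> W}"
    by (auto simp: indicator_def)
  moreover have "{x. x + y \<in> W} \<in> sets borel" using assms by measurable
  ultimately show ?thesis by simp
qed

text \<open>Feeding \<open>u(x) = f(x\<inverse>)/w(x\<inverse>)\<close> with \<open>w(y) = M(Wy\<inverse>)\<close> and \<open>v = 1\<^sub>W\<close> to the shear identity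
  makes its right-hand side \<open>N(f)\<close>, while the left-hand side involves \<open>f\<close> through \<open>M\<close> only.\<close>

lemma haar_ratio:
  assumes N: "left_invariant N" and MN: "borel_fubini M N"
    and W: "open W" "W \<noteq> {}" "W \<subseteq> K" "compact K" and f[measurable]: "f \<in> borel_measurable borel"
  shows "(\<integral>\<^sup>+x. f x \<partial>N) = (\<integral>\<^sup>+x. f (- x) / (\<integral>\<^sup>+z. indicator W (z - x) \<partial>M) \<partial>M) * emeasure N W"
proof -
  define w where "w y = (\<integral>\<^sup>+x. indicator W (x + y) \<partial>M)" for y
  have sW: "W \<in> sets borel" using W by simp
  have w[measurable]: "w \<in> borel_measurable borel" unfolding w_def by (rule measurable_translates[OF sW])
  have wn: "w y \<noteq> 0" "w y \<noteq> \<infinity>" for y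
    unfolding w_def nn_integral_translate_indicator[OF sW] using emeasure_translate_nontrivial[OF W] by auto
  have [measurable_cong]: "sets N = sets borel" using N by (simp add: left_invariant_def)
  have "(\<integral>\<^sup>+x. f (- x) / w (- x) \<partial>M) * (\<integral>\<^sup>+y. indicator W y \<partial>N)
      = (\<integral>\<^sup>+y. f (- (- y)) / w (- (- y)) * (\<integral>\<^sup>+x. indicator W (x + y) \<partial>M) \<partial>N)"
    by (rule shear_identity[OF MN left_inv N]) (use W in auto)
  also have "\<dots> = (\<integral>\<^sup>+y. f y / w y * w y \<partial>N)" by (simp add: w_def)
  also have "\<dots> = (\<integral>\<^sup>+y. f y \<partial>N)"
    using wn by (intro nn_integral_cong) (simp add: ennreal_divide_times less_top)
  finally show ?thesis using sW by (simp add: w_def)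
qed

text \<open>The factor that depends on \<open>f\<close> in the previous formula does not involve \<open>N\<close>, so it can be eliminated
  between the formulas for \<open>N\<close> and for \<open>M\<close>.\<close>

lemma haar_unique:
  assumes N: "left_invariant N" and MN: "borel_fubini M N"
    and W: "open W" "W \<noteq> {}" "W \<subseteq> K" "compact K" and f[measurable]: "f \<in> borel_measurable borel"
  shows "(\<integral>\<^sup>+x. f x \<partial>N) * emeasure M W = (\<integral>\<^sup>+x. f x \<partial>M) * emeasure N W"
  unfolding haar_ratio[OF N MN W f] haar_ratio[OF left_inv fubini W f] by (simp add: mult_ac)

text \<open>Right translates of \<open>M\<close> are again left invariant, hence multiples of \<open>M\<close>.\<close>

lemma right_translate:
  "\<exists>c>0. \<forall>f\<in>borel_measurable borel. (\<integral>\<^sup>+x. f (x - g) \<partial>M) = ennreal c * (\<integral>\<^sup>+x. f x \<partial>M)"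
proof -
  obtain K and W :: "'a set" where W: "open W" "0 \<in> W" "W \<subseteq> K" "compact K" using compact_nhd by blast
  then have W': "W \<noteq> {}" and sW: "W \<in> sets borel" by auto
  have cont: "continuous_on UNIV (\<lambda>x. x - g)" by (intro continuous_intros)
  have t[measurable]: "(\<lambda>x. x - g) \<in> borel_measurable borel"
    by (rule borel_measurable_continuous_onI[OF cont])
  define N where "N = distr (density M (indicator UNIV)) borel (\<lambda>x. x - g)"
  have MN: "borel_fubini M N"
    unfolding N_def by (rule borel_fubini_distr[OF fubini fubini _ _ t]) (use cont in auto)
  have int: "(\<integral>\<^sup>+x. f x \<partial>N) = (\<integral>\<^sup>+x. f (x - g) \<partial>M)" if "f \<in> borel_measurable borel" for f
    unfolding N_def using that by (subst nn_integral_distr) (auto simp: nn_integral_density)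
  have "left_invariant N"
    unfolding left_invariant_def
  proof (intro conjI allI ballI)
    fix h :: 'a and f :: "'a \<Rightarrow> ennreal" assume f[measurable]: "f \<in> borel_measurable borel"
    have "(\<integral>\<^sup>+x. f (h + x) \<partial>N) = (\<integral>\<^sup>+x. f (h + x - g) \<partial>M)"
      by (subst int) (auto simp: diff_conv_add_uminus add.assoc simp del: add_uminus_conv_diff)
    also have "\<dots> = (\<integral>\<^sup>+x. f (x - g) \<partial>M)"
      by (rule left_invariantD[OF left_inv]) simp
    also have "\<dots> = (\<integral>\<^sup>+x. f x \<partial>N)" by (simp add: int)
    finally show "(\<integral>\<^sup>+x. f (h + x) \<partial>N) = (\<integral>\<^sup>+x. f x \<partial>N)" .
  qed (simp add: N_def)
  note U = haar_unique[OF this MN W(1) W' W(3,4)]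
  have NW: "emeasure N W = emeasure M {x. x + - g \<in> W}"
  proof -
    have "emeasure N W = (\<integral>\<^sup>+x. indicator W x \<partial>N)" using sW by (simp add: N_def)
    also have "\<dots> = (\<integral>\<^sup>+x. indicator W (x + - g) \<partial>M)" using sW by (subst int) auto
    finally show ?thesis using nn_integral_translate_indicator[OF sW, of "- g"] by simp
  qed
  have "emeasure N W \<noteq> 0" "emeasure N W \<noteq> \<infinity>"
    unfolding NW by (rule emeasure_translate_nontrivial[OF W(1) W' W(3,4)])+
  then obtain n where n: "emeasure N W = ennreal n" "n > 0"
    by (cases "emeasure N W") (auto simp: zero_less_iff_neq_zero)
  obtain m where m: "emeasure M W = ennreal m" "m > 0" by (rule finite_positive_set[OF W(1) W' W(3,4)])
  have "(\<integral>\<^sup>+x. f (x - g) \<partial>M) = ennreal (n / m) * (\<integral>\<^sup>+x. f x \<partial>M)" if f: "f \<in> borel_measurable borel" for f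
  proof -
    have "(\<integral>\<^sup>+x. f (x - g) \<partial>M) = (\<integral>\<^sup>+x. f (x - g) \<partial>M) * emeasure M W / emeasure M W"
      using m by (simp add: ennreal_mult_divide_eq)
    also have "\<dots> = (\<integral>\<^sup>+x. f x \<partial>M) * emeasure N W / emeasure M W"
      using U[OF f] int[OF f] by simp
    also have "\<dots> = ennreal (n / m) * (\<integral>\<^sup>+x. f x \<partial>M)"
      using n m by (simp add: divide_ennreal[symmetric] ennreal_times_divide mult.commute)
    finally show ?thesis .
  qed
  then show ?thesis using n m by (intro exI[of _ "n / m"]) auto
qed

lemma modular:
  shows modular_pos: "modular_function M g > 0"
    and nn_integral_right_translate:
      "f \<in> borel_measurable borel \<Longrightarrow> (\<integral>\<^sup>+x. f (x - g) \<partial>M) = ennreal (modular_function M g) * (\<integral>\<^sup>+x. f x \<partial>M)"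
proof -
  obtain c where c: "c > 0" "\<And>f. f \<in> borel_measurable borel \<Longrightarrow> (\<integral>\<^sup>+x. f (x - g) \<partial>M) = ennreal c * (\<integral>\<^sup>+x. f x \<partial>M)"
    using right_translate[of g] by blast
  have "emeasure M ((\<lambda>v. v + g) ` V) = ennreal c * emeasure M V" if V: "V \<in> sets borel" for V
  proof -
    have *: "(\<lambda>v. v + g) ` V = {x. x + - g \<in> V}"
      by (auto simp: image_iff intro!: bexI[of _ "_ - g"])
    show ?thesis
      unfolding * nn_integral_translate_indicator[OF V, symmetric]
      using c(2)[of "indicator V"] V by simp
  qed
  moreover have "d = c" if d: "d > 0" "\<forall>V\<in>sets borel. emeasure M ((\<lambda>v. v + g) ` V) = ennreal d * emeasure M V" for d
  proof -
    obtain K and W :: "'a set" where W: "open W" "0 \<in> W" "W \<subseteq> K" "compact K" using compact_nhd by blast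
    then have sW: "W \<in> sets borel" "W \<noteq> {}" by auto
    obtain m where m: "emeasure M W = ennreal m" "m > 0" by (rule finite_positive_set[OF W(1) sW(2) W(3,4)])
    have "ennreal c * emeasure M W = ennreal d * emeasure M W"
      using calculation[OF sW(1)] d(2) sW(1) by simp
    then show ?thesis using m c(1) d(1) by (simp add: ennreal_mult[symmetric])
  qed
  ultimately have "modular_function M g = c"
    unfolding modular_function_def using c(1) by (intro the_equality) auto
  then show "modular_function M g > 0"
    "f \<in> borel_measurable borel \<Longrightarrow> (\<integral>\<^sup>+x. f (x - g) \<partial>M) = ennreal (modular_function M g) * (\<integral>\<^sup>+x. f x \<partial>M)"
    using c by auto
qed

text \<open>A set that is used to read off equations between scalars from equations between multiples of \<open>M\<close>.\<close>

lemma reference_set: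
  obtains W K m where "open W" "W \<noteq> {}" "W \<subseteq> K" "compact K"
    "\<And>y. (\<integral>\<^sup>+z. indicator W (z - y) \<partial>M) = ennreal (modular_function M y * m)"
    "emeasure M W = ennreal m" "m > 0"
proof -
  obtain K and W :: "'a set" where W: "open W" "0 \<in> W" "W \<subseteq> K" "compact K" using compact_nhd by blast
  then have W': "W \<noteq> {}" by auto
  obtain m where m: "emeasure M W = ennreal m" "m > 0" by (rule finite_positive_set[OF W(1) W' W(3,4)])
  have "(\<integral>\<^sup>+z. indicator W (z - y) \<partial>M) = ennreal (modular_function M y * m)" for y
    using W m modular_pos[of y] nn_integral_right_translate[of "indicator W" y] by (simp add: ennreal_mult)
  with that[OF W(1) W' W(3,4)] m show ?thesis by simp
qed

lemma measurable_modular [measurable]: "modular_function M \<in> borel_measurable borel"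
proof -
  obtain W K m where W: "open W" "W \<noteq> {}" "W \<subseteq> K" "compact K"
    "\<And>y. (\<integral>\<^sup>+z. indicator W (z - y) \<partial>M) = ennreal (modular_function M y * m)"
    and m: "emeasure M W = ennreal m" "m > 0" by (rule reference_set) blast
  have [measurable]: "(\<lambda>y. \<integral>\<^sup>+x. indicator W (x + y) \<partial>M) \<in> borel_measurable borel"
    using W by (intro measurable_translates) simp
  have "modular_function M y = enn2real ((\<integral>\<^sup>+z. indicator W (z + - y) \<partial>M)) / m" for y
    using W(5)[of y] m modular_pos[of y] by simp
  then have "modular_function M = (\<lambda>y. enn2real ((\<integral>\<^sup>+z. indicator W (z + - y) \<partial>M)) / m)" by auto
  also have "\<dots> \<in> borel_measurable borel"
    by (intro borel_measurable_divide borel_measurable_const borel_measurable_enn2real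
      measurable_compose[of uminus borel borel "\<lambda>y. \<integral>\<^sup>+z. indicator W (z + y) \<partial>M"]) auto
  finally show ?thesis .
qed

text \<open>The case \<open>N = M\<close> of \<open>haar_ratio\<close>, in which \<open>w(x\<inverse>) = m(x) M(W)\<close>.\<close>

lemma nn_integral_inverse:
  assumes f[measurable]: "f \<in> borel_measurable borel"
  shows "(\<integral>\<^sup>+x. f (- x) * ennreal (inverse (modular_function M x)) \<partial>M) = (\<integral>\<^sup>+x. f x \<partial>M)"
proof -
  obtain W K m where W: "open W" "W \<noteq> {}" "W \<subseteq> K" "compact K"
    "\<And>y. (\<integral>\<^sup>+z. indicator W (z - y) \<partial>M) = ennreal (modular_function M y * m)"
    and m: "emeasure M W = ennreal m" "m > 0" by (rule reference_set) blast
  have *: "f (- x) / ennreal (modular_function M x * m) * emeasure M W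
      = f (- x) * ennreal (inverse (modular_function M x))" for x
  proof -
    have "ennreal m / ennreal (modular_function M x * m) = ennreal (inverse (modular_function M x))"
      using m modular_pos[of x] by (subst divide_ennreal) (auto simp: field_simps)
    then show ?thesis using m by (simp add: ennreal_divide_times)
  qed
  show ?thesis
    unfolding haar_ratio[OF left_inv fubini W(1-4) f] W(5)
    by (subst nn_integral_multc[symmetric]) (auto simp: *)
qed

lemma modular_uminus: "modular_function M (- g) = inverse (modular_function M g)"
proof -
  obtain W K m where W: "open W" "W \<noteq> {}" "W \<subseteq> K" "compact K"
    "\<And>y. (\<integral>\<^sup>+z. indicator W (z - y) \<partial>M) = ennreal (modular_function M y * m)"
    and m: "emeasure M W = ennreal m" "m > 0" by (rule reference_set) blast
  have [measurable]: "W \<in> sets borel" using W by simp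
  have "emeasure M W = (\<integral>\<^sup>+z. indicator W (z - g + g) \<partial>M)" using W by simp
  also have "\<dots> = ennreal (modular_function M g) * (\<integral>\<^sup>+z. indicator W (z - (- g)) \<partial>M)"
    using W by (subst nn_integral_right_translate[where f = "\<lambda>z. indicator W (z + g)"]) auto
  also have "\<dots> = ennreal (modular_function M g) * ennreal (modular_function M (- g) * m)"
    using W(5)[of "- g"] by simp
  finally have "m = modular_function M g * (modular_function M (- g) * m)"
    using m modular_pos[of g] modular_pos[of "- g"] by (simp add: ennreal_mult[symmetric])
  then show ?thesis using m modular_pos[of g] by (simp add: field_simps)
qed

text \<open>For \<open>y\<close> in \<open>S\<close> one has \<open>m(y) M(W) = M(Wy) \<le> M(KS)\<close>, and \<open>KS\<close> is compact.\<close>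

lemma modular_bounded:
  assumes "compact S"
  obtains b where "b > 0" "\<And>x. x \<in> S \<Longrightarrow> modular_function M x \<le> b"
proof -
  obtain W K m where W: "open W" "W \<noteq> {}" "W \<subseteq> K" "compact K"
    "\<And>y. (\<integral>\<^sup>+z. indicator W (z - y) \<partial>M) = ennreal (modular_function M y * m)"
    and m: "emeasure M W = ennreal m" "m > 0" by (rule reference_set) blast
  define T where "T = {x + y | x y. x \<in> K \<and> y \<in> S}"
  have T: "compact T" unfolding T_def using W assms by (intro compact_plus_group)
  obtain n where n: "emeasure M T = ennreal n" "n \<ge> 0"
    using emeasure_compact_finite[OF T] by (cases "emeasure M T") auto
  have "modular_function M y \<le> n / m" if y: "y \<in> S" for y
  proof -
    have "(\<integral>\<^sup>+z. indicator W (z - y) \<partial>M) \<le> (\<integral>\<^sup>+z. indicator T z \<partial>M)"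
    proof (intro nn_integral_mono)
      fix z
      have "z \<in> T" if "z - y \<in> W"
        unfolding T_def using that W(3) y by (intro CollectI exI[of _ "z - y"] exI[of _ y]) auto
      then show "(indicator W (z - y) :: ennreal) \<le> indicator T z" by (auto split: split_indicator)
    qed
    also have "\<dots> = ennreal n" using n T by (simp add: borel_compact)
    finally have "modular_function M y * m \<le> n"
      unfolding W(5) using n by simp
    then show ?thesis using m by (simp add: field_simps)
  qed
  then show ?thesis using that[of "n / m + 1"] n m
    by (smt (verit) divide_nonneg_pos)
qed

end

section \<open>Integration along the fibres of a central extension\<close>

locale central_extension =
  E: haar_group \<nu>E + G: haar_group \<nu>G
  for \<nu>E :: "'e::{topological_group_add, t2_space} measure"
    and \<nu>G :: "'g::{topological_group_add, t2_space} measure" +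
  fixes A :: "'e set" and p :: "'e \<Rightarrow> 'g" and s :: "'g \<Rightarrow> 'e" and U :: "'g set"
  assumes ext: "topological_extension A p"
    and central: "central_subset A"
    and sec: "borel_section p s"
    and compact_U: "compact U" and symmetric_U: "uminus ` U = U" and nhd_U: "0 \<in> interior U"
    and compact_sU: "compact (s ` U)"
begin

lemma p_add [simp]: "p (x + y) = p x + p y"
  using ext by (simp add: topological_extension_def)

lemma p_zero [simp]: "p 0 = 0"
  using p_add[of 0 0] unfolding add_0_right by (metis add_left_cancel add_0_right)

lemma p_uminus [simp]: "p (- x) = - p x"
  using p_add[of "- x" x] by (simp add: eq_neg_iff_add_eq_0 del: p_add)

lemma p_diff [simp]: "p (x - y) = p x - p y"
  by (simp only: diff_conv_add_uminus p_add p_uminus)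

lemma p_s [simp]: "p (s g) = g"
  using sec by (simp add: borel_section_def)

lemma s_measurable [measurable]: "s \<in> borel_measurable borel"
  using sec by (simp add: borel_section_def)

lemma A_iff: "x \<in> A \<longleftrightarrow> p x = 0"
  using ext by (auto simp: topological_extension_def)

lemma closed_A: "closed A"
  using ext unfolding topological_extension_def by blast

lemma A_commute: "a \<in> A \<Longrightarrow> a + x = x + a"
  using central by (auto simp: central_subset_def)

lemma p_continuous: "continuous_on S p"
proof -
  have "continuous_on UNIV p"
    using ext by (auto simp: topological_extension_def continuous_on_open_vimage)
  then show ?thesis using continuous_on_subset by blast
qed

lemma p_continuous_intro [continuous_intros]: "continuous_on S f \<Longrightarrow> continuous_on S (\<lambda>x. p (f x))"
  by (rule continuous_on_compose2[OF p_continuous[of UNIV]]) auto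

lemma p_measurable [measurable]: "p \<in> borel_measurable borel"
  by (rule borel_measurable_continuous_onI[OF p_continuous])

text \<open>On the compact set \<open>s(U)\<close> the projection is a continuous bijection onto the Hausdorff space \<open>U\<close>, so its
  inverse is continuous.\<close>

lemma s_continuous: "continuous_on U s"
proof -
  have "continuous_on (p ` s ` U) s"
    by (rule continuous_on_inv[OF p_continuous compact_sU]) auto
  then show ?thesis by (simp add: image_image)
qed

lemma s_continuous_intro: "continuous_on S f \<Longrightarrow> f ` S \<subseteq> U \<Longrightarrow> continuous_on S (\<lambda>x. s (f x))"
  by (rule continuous_on_compose2[OF s_continuous])

lemma closed_U: "closed U"
  using compact_U by (rule compact_imp_closed)

lemma closed_vimage_U: "continuous_on UNIV f \<Longrightarrow> closed {x. f x \<in> U}"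
  using closed_vimage[OF closed_U, of f] by (simp add: vimage_def)

lemma closed_pU: "closed {x. p x \<in> U}"
  by (intro closed_vimage_U continuous_intros)

text \<open>The \<open>A\<close>-coordinate over \<open>U\<close>, where \<open>s\<close> is continuous. Elsewhere \<open>x - s (p x)\<close> might fail to be a Borel
  function of \<open>x\<close>, since the group operation need not be measurable for the product \<open>\<sigma>\<close>-algebra.\<close>

definition fibre_part :: "'e \<Rightarrow> 'e" where
  "fibre_part x = (if p x \<in> U then x - s (p x) else 0)"

lemma fibre_part_measurable [measurable]: "fibre_part \<in> borel_measurable borel"
proof -
  have "(\<lambda>x. if x \<in> {x. p x \<in> U} then x - s (p x) else 0) \<in> borel_measurable borel"
    using closed_pU by (intro borel_measurable_continuous_on_if continuous_intros s_continuous_intro) auto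
  then show ?thesis by (simp add: fibre_part_def[abs_def])
qed

lemma fibre_part_continuous: "continuous_on {x. p x \<in> U} fibre_part"
proof -
  have "continuous_on {x. p x \<in> U} (\<lambda>x. x - s (p x))"
    by (intro continuous_intros s_continuous_intro) auto
  then show ?thesis by (rule continuous_on_eq) (simp add: fibre_part_def)
qed

text \<open>A Haar measure on \<open>A\<close>, viewed as a measure on \<open>E\<close>: over \<open>U\<close> the extension is a product \<open>A \<times> U\<close>, and the
  measure of \<open>B \<subseteq> A\<close> is that of \<open>B \<times> U\<close>.\<close>

definition fibre_measure :: "'e measure" ("\<nu>A") where
  "\<nu>A = distr (density \<nu>E (indicator {x. p x \<in> U})) borel fibre_part"

lemma sets_fibre [simp, measurable_cong]: "sets \<nu>A = sets borel"
  by (simp add: fibre_measure_def)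

lemma space_fibre [simp]: "space \<nu>A = UNIV"
  by (simp add: fibre_measure_def)

lemma pU_sets [measurable]: "{x. p x \<in> U} \<in> sets borel"
  using closed_pU by simp

lemma nn_integral_fibre:
  assumes [measurable]: "f \<in> borel_measurable borel"
  shows "(\<integral>\<^sup>+x. f x \<partial>\<nu>A) = (\<integral>\<^sup>+x. indicator {x. p x \<in> U} x * f (x - s (p x)) \<partial>\<nu>E)"
proof -
  have "(\<integral>\<^sup>+x. f x \<partial>\<nu>A) = (\<integral>\<^sup>+x. indicator {x. p x \<in> U} x * f (fibre_part x) \<partial>\<nu>E)"
    unfolding fibre_measure_def by (subst nn_integral_distr) (auto simp: nn_integral_density)
  also have "\<dots> = (\<integral>\<^sup>+x. indicator {x. p x \<in> U} x * f (x - s (p x)) \<partial>\<nu>E)"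
    by (intro nn_integral_cong) (auto simp: fibre_part_def split: split_indicator)
  finally show ?thesis .
qed

lemma fubini_GE: "borel_fubini \<nu>G \<nu>E"
  by (intro radon_borel_fubini) unfold_locales

lemma fubini_EA: "borel_fubini \<nu>E \<nu>A"
  unfolding fibre_measure_def
  by (rule borel_fubini_distr[OF E.fubini E.fubini closed_pU fibre_part_continuous fibre_part_measurable])

lemma fibre_measurable:
  assumes f: "f \<in> borel_measurable borel"
  shows "(\<lambda>x. indicator {x. p x \<in> U} x * f (x - s (p x)) :: ennreal) \<in> borel_measurable borel"
  using closed_pU by (intro borel_measurable_compose_on_closed[OF f] continuous_intros s_continuous_intro) auto

lemma left_translate_measurable:
  fixes f :: "'e \<Rightarrow> 'x::topological_space"
  shows "f \<in> borel_measurable borel \<Longrightarrow> (\<lambda>x. f (z + x)) \<in> borel_measurable borel"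
  by (rule measurable_compose[OF borel_measurable_continuous_onI]) (auto intro!: continuous_intros)

text \<open>Translation by \<open>a \<in> A\<close> changes the \<open>A\<close>-coordinate by \<open>a\<close> and keeps the projection to \<open>U\<close>.\<close>

lemma fibre_invariant:
  assumes f: "f \<in> borel_measurable borel" and a: "a \<in> A"
  shows "(\<integral>\<^sup>+x. f (a + x) \<partial>\<nu>A) = (\<integral>\<^sup>+x. f x \<partial>\<nu>A)"
proof -
  let ?h = "\<lambda>x. indicator {x. p x \<in> U} x * f (x - s (p x))"
  have "(\<integral>\<^sup>+x. f (a + x) \<partial>\<nu>A) = (\<integral>\<^sup>+x. ?h (a + x) \<partial>\<nu>E)"
    using left_translate_measurable[OF f, of a] a
    by (subst nn_integral_fibre) (auto simp: A_iff indicator_def diff_conv_add_uminus add.assoc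
        simp del: add_uminus_conv_diff intro!: nn_integral_cong)
  also have "\<dots> = (\<integral>\<^sup>+x. ?h x \<partial>\<nu>E)"
    by (rule left_invariantD[OF E.left_inv fibre_measurable[OF f]])
  finally show ?thesis by (simp add: nn_integral_fibre[OF f])
qed

lemma AE_fibre: "AE a in \<nu>A. a \<in> A"
proof -
  have [measurable]: "- A \<in> sets borel" using closed_A by auto
  have "(\<integral>\<^sup>+x. indicator (- A) x \<partial>\<nu>A) = (\<integral>\<^sup>+x. 0 \<partial>\<nu>E)"
    by (subst nn_integral_fibre) (auto simp: A_iff indicator_def intro!: nn_integral_cong)
  then have "emeasure \<nu>A (- A) = 0" by simp
  then show ?thesis by (intro AE_I[of _ _ "- A"]) auto
qed

lemma fibre_compact_finite:
  assumes K: "compact K" shows "emeasure \<nu>A K < \<infinity>"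
proof -
  let ?T = "{x + y | x y. x \<in> K \<and> y \<in> s ` U}"
  have T: "compact ?T" by (intro compact_plus_group K compact_sU)
  have "emeasure \<nu>A K = (\<integral>\<^sup>+x. indicator K x \<partial>\<nu>A)" using K by (simp add: borel_compact)
  also have "\<dots> = (\<integral>\<^sup>+x. indicator {x. p x \<in> U} x * indicator K (x - s (p x)) \<partial>\<nu>E)"
    by (rule nn_integral_fibre[OF borel_measurable_indicator[OF borel_compact[OF K]]])
  also have "\<dots> \<le> (\<integral>\<^sup>+x. indicator ?T x \<partial>\<nu>E)"
  proof (intro nn_integral_mono)
    fix x
    have "x \<in> ?T" if "p x \<in> U" "x - s (p x) \<in> K"
      using that by (intro CollectI exI[of _ "x - s (p x)"] exI[of _ "s (p x)"]) auto
    then show "(indicator {x. p x \<in> U} x * indicator K (x - s (p x)) :: ennreal) \<le> indicator ?T x"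
      by (auto split: split_indicator)
  qed
  also have "\<dots> < \<infinity>" using E.emeasure_compact_finite[OF T] T by (simp add: borel_compact)
  finally show ?thesis .
qed

definition fibre_integral :: "('e \<Rightarrow> ennreal) \<Rightarrow> 'e \<Rightarrow> ennreal" where
  "fibre_integral H z = (\<integral>\<^sup>+a. H (z + a) \<partial>\<nu>A)"

lemma plus_measurable:
  fixes H :: "'e \<Rightarrow> 'x::topological_space"
  shows "H \<in> borel_measurable borel \<Longrightarrow> (\<lambda>p. H (fst p + snd p)) \<in> borel_measurable borel"
  by (rule measurable_compose[OF borel_measurable_continuous_onI]) (auto intro!: continuous_intros)

lemma fibre_integral_measurable [measurable]:
  assumes "H \<in> borel_measurable borel" shows "fibre_integral H \<in> borel_measurable borel"
  using borel_fubini_measurable(1)[OF fubini_EA plus_measurable[OF assms]]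
  by (simp add: fibre_integral_def[abs_def])

lemma fibre_integral_coset:
  assumes H: "H \<in> borel_measurable borel" and "p x = p y"
  shows "fibre_integral H x = fibre_integral H y"
proof -
  have a: "- x + y \<in> A" using assms(2) by (simp add: A_iff)
  have "fibre_integral H y = (\<integral>\<^sup>+a. H (x + (- x + y + a)) \<partial>\<nu>A)"
    by (simp add: fibre_integral_def add.assoc[symmetric])
  also have "\<dots> = fibre_integral H x"
    unfolding fibre_integral_def
    by (rule fibre_invariant[OF left_translate_measurable[OF H] a])
  finally show ?thesis ..
qed

text \<open>The factor in Weil's formula that stems from normalising the measure of \<open>A\<close> by means of \<open>U\<close>.\<close>

definition weil_constant :: ennreal where
  "weil_constant = (\<integral>\<^sup>+g. indicator U g * ennreal (modular_function \<nu>E (s (- g))) \<partial>\<nu>G)"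

lemma indicator_U_uminus: "(indicator U (- g) :: ennreal) = indicator U g"
proof -
  have "- g \<in> U \<longleftrightarrow> g \<in> U" using symmetric_U by (metis image_eqI minus_minus)
  then show ?thesis by (simp add: indicator_def)
qed

lemma U_sets [measurable]: "U \<in> sets borel"
  using closed_U by simp

text \<open>Unfolding the fibre measure, the left-hand side is the double integral over \<open>g \<in> G\<close> and \<open>x \<in> p\<inverse>(U)\<close> of
  \<open>H(s(g) x s(p x)\<inverse>)\<close>. The substitution \<open>x \<mapsto> s(g)\<inverse> x\<close> turns the integrand into \<open>H(x s(g\<inverse> p x)\<inverse>)\<close>, the substitution
  \<open>g \<mapsto> p(x) g\<close> turns that into \<open>H(x s(g\<inverse>)\<inverse>)\<close>, and a right translate of \<open>H\<close> costs the modular function. The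
  section is evaluated on \<open>U\<close> only, which makes all integrands jointly Borel.\<close>

lemma weil_formula:
  assumes H[measurable]: "H \<in> borel_measurable borel"
  shows "(\<integral>\<^sup>+g. fibre_integral H (s g) \<partial>\<nu>G) = weil_constant * (\<integral>\<^sup>+x. H x \<partial>\<nu>E)"
proof -
  define K where "K q = indicator {q. - fst q + p (snd q) \<in> U} q * H (snd q - s (- fst q + p (snd q)))" for q
  have K: "K \<in> borel_measurable borel"
    unfolding K_def[abs_def]
    by (intro borel_measurable_compose_on_closed[OF H] closed_vimage_U continuous_intros s_continuous_intro) auto
  define J where "J q = indicator {q. - fst q \<in> U} q * H (snd q - s (- fst q))" for q
  have J: "J \<in> borel_measurable borel"
    unfolding J_def[abs_def]
    by (intro borel_measurable_compose_on_closed[OF H] closed_vimage_U continuous_intros s_continuous_intro) auto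
  have "(\<integral>\<^sup>+g. fibre_integral H (s g) \<partial>\<nu>G)
      = (\<integral>\<^sup>+g. \<integral>\<^sup>+x. indicator {x. p x \<in> U} x * H (s g + (x - s (p x))) \<partial>\<nu>E \<partial>\<nu>G)"
    unfolding fibre_integral_def by (subst nn_integral_fibre[OF left_translate_measurable[OF H]]) simp
  also have "\<dots> = (\<integral>\<^sup>+g. \<integral>\<^sup>+x. K (g, s g + x) \<partial>\<nu>E \<partial>\<nu>G)"
    by (intro nn_integral_cong) (simp add: K_def indicator_def add.assoc[symmetric] diff_conv_add_uminus
        del: add_uminus_conv_diff)
  also have "\<dots> = (\<integral>\<^sup>+g. \<integral>\<^sup>+x. K (g, x) \<partial>\<nu>E \<partial>\<nu>G)"
    by (intro nn_integral_cong left_invariantD[OF E.left_inv, of "\<lambda>x. K (_, x)"] borel_measurable_Pair_sections K)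
  also have "\<dots> = (\<integral>\<^sup>+x. \<integral>\<^sup>+g. K (g, x) \<partial>\<nu>G \<partial>\<nu>E)"
    by (rule borel_fubini_iterate[OF fubini_GE K])
  also have "\<dots> = (\<integral>\<^sup>+x. \<integral>\<^sup>+g. K (p x + g, x) \<partial>\<nu>G \<partial>\<nu>E)"
    by (intro nn_integral_cong left_invariantD[OF G.left_inv, of "\<lambda>g. K (g, _)", symmetric] borel_measurable_Pair_sections K)
  also have "\<dots> = (\<integral>\<^sup>+x. \<integral>\<^sup>+g. J (g, x) \<partial>\<nu>G \<partial>\<nu>E)"
    by (simp add: K_def J_def minus_add add.assoc indicator_def)
  also have "\<dots> = (\<integral>\<^sup>+g. \<integral>\<^sup>+x. J (g, x) \<partial>\<nu>E \<partial>\<nu>G)"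
    by (rule borel_fubini_iterate[OF fubini_GE J, symmetric])
  also have "\<dots> = (\<integral>\<^sup>+g. indicator U g * ennreal (modular_function \<nu>E (s (- g))) * (\<integral>\<^sup>+x. H x \<partial>\<nu>E) \<partial>\<nu>G)"
  proof (intro nn_integral_cong)
    fix g
    have "(\<integral>\<^sup>+x. J (g, x) \<partial>\<nu>E) = (\<integral>\<^sup>+x. indicator U g * H (x - s (- g)) \<partial>\<nu>E)"
      using indicator_U_uminus[of g] by (intro nn_integral_cong) (simp add: J_def indicator_def)
    also have "\<dots> = indicator U g * (\<integral>\<^sup>+x. H (x - s (- g)) \<partial>\<nu>E)"
      by (rule nn_integral_cmult) simp
    finally show "(\<integral>\<^sup>+x. J (g, x) \<partial>\<nu>E) = indicator U g * ennreal (modular_function \<nu>E (s (- g))) * (\<integral>\<^sup>+x. H x \<partial>\<nu>E)"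
      by (simp add: E.nn_integral_right_translate mult.assoc)
  qed
  also have "\<dots> = weil_constant * (\<integral>\<^sup>+x. H x \<partial>\<nu>E)"
    unfolding weil_constant_def by (rule nn_integral_multc) measurable
  finally show ?thesis .
qed

lemma weil_constant_finite: "weil_constant \<noteq> \<infinity>"
proof -
  obtain b where b: "b > 0" "\<And>x. x \<in> s ` U \<Longrightarrow> modular_function \<nu>E x \<le> b"
    using E.modular_bounded[OF compact_sU] by blast
  have "weil_constant \<le> (\<integral>\<^sup>+g. indicator U g * ennreal b \<partial>\<nu>G)"
    unfolding weil_constant_def
  proof (intro nn_integral_mono)
    fix g
    show "indicator U g * ennreal (modular_function \<nu>E (s (- g))) \<le> indicator U g * ennreal b"
      using b(2)[of "s (- g)"] indicator_U_uminus[of g]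
      by (auto split: split_indicator_asm split_indicator intro!: ennreal_leI)
  qed
  also have "\<dots> = emeasure \<nu>G U * ennreal b" by (simp add: nn_integral_multc)
  also have "\<dots> < \<infinity>" using G.emeasure_compact_finite[OF compact_U] by (simp add: ennreal_mult_less_top)
  finally show ?thesis by simp
qed

lemma weil_constant_pos: "weil_constant \<noteq> 0"
proof
  assume "weil_constant = 0"
  then have "AE g in \<nu>G. indicator U g * ennreal (modular_function \<nu>E (s (- g))) = 0"
    unfolding weil_constant_def by (subst (asm) nn_integral_0_iff_AE) auto
  then have "AE g in \<nu>G. g \<notin> U"
    by eventually_elim (auto split: split_indicator_asm simp: ennreal_eq_0_iff E.modular_pos[unfolded not_le[symmetric]])
  then have "emeasure \<nu>G U = 0" by (subst (asm) AE_iff_measurable[of U]) auto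
  moreover have "emeasure \<nu>G (interior U) \<le> emeasure \<nu>G U"
    by (intro emeasure_mono interior_subset) simp
  ultimately show False
    using G.emeasure_open_pos[of "interior U"] nhd_U by auto
qed

text \<open>Since \<open>A\<close> is central, integrating a right translate of \<open>H\<close> along the fibres amounts to right translation
  on \<open>G\<close>. Weil's formula then compares the two modular functions.\<close>

lemma modular_projection: "modular_function \<nu>E y = modular_function \<nu>G (p y)"
proof -
  obtain W K m where W: "open W" "W \<noteq> {}" "W \<subseteq> K" "compact K"
    "\<And>y. (\<integral>\<^sup>+z. indicator W (z - y) \<partial>\<nu>E) = ennreal (modular_function \<nu>E y * m)"
    and m: "emeasure \<nu>E W = ennreal m" "m > 0" by (rule E.reference_set) blast
  let ?H = "indicator W :: 'e \<Rightarrow> ennreal"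
  have H[measurable]: "?H \<in> borel_measurable borel" using W by simp
  have Hy: "(\<lambda>x. ?H (x - y)) \<in> borel_measurable borel" by measurable
  have PHy: "fibre_integral (\<lambda>x. ?H (x - y)) (s g) = fibre_integral ?H (s (g - p y))" for g
  proof -
    have "fibre_integral (\<lambda>x. ?H (x - y)) (s g) = (\<integral>\<^sup>+a. ?H (s g - y + a) \<partial>\<nu>A)"
      unfolding fibre_integral_def
    proof (intro nn_integral_cong_AE)
      show "AE a in \<nu>A. ?H (s g + a - y) = ?H (s g - y + a)"
        using AE_fibre by eventually_elim (simp add: diff_conv_add_uminus add.assoc A_commute[of _ "- y"] del: add_uminus_conv_diff)
    qed
    also have "\<dots> = fibre_integral ?H (s g - y)" by (simp add: fibre_integral_def)
    also have "\<dots> = fibre_integral ?H (s (g - p y))" by (rule fibre_integral_coset[OF H]) simp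
    finally show ?thesis .
  qed
  obtain k where k: "weil_constant = ennreal k" "k > 0"
    using weil_constant_finite weil_constant_pos by (cases weil_constant) (auto simp: zero_less_iff_neq_zero)
  have "weil_constant * (\<integral>\<^sup>+x. ?H (x - y) \<partial>\<nu>E) = (\<integral>\<^sup>+g. fibre_integral ?H (s (g - p y)) \<partial>\<nu>G)"
    unfolding weil_formula[OF Hy, symmetric] PHy ..
  also have "\<dots> = ennreal (modular_function \<nu>G (p y)) * (\<integral>\<^sup>+g. fibre_integral ?H (s g) \<partial>\<nu>G)"
    by (rule G.nn_integral_right_translate) measurable
  also have "\<dots> = ennreal (modular_function \<nu>G (p y)) * (weil_constant * emeasure \<nu>E W)"
    using W(1) by (simp add: weil_formula[OF H])
  finally have "k * (modular_function \<nu>E y * m) = modular_function \<nu>G (p y) * (k * m)"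
    unfolding W(5) m k(1) using k(2) m(2) E.modular_pos[of y] G.modular_pos[of "p y"]
    by (simp add: ennreal_mult[symmetric])
  then show ?thesis using k m by simp
qed

end

section \<open>Convolution and fibrewise norms\<close>

lemma (in haar_group) AE_left_translate:
  assumes "AE y in M. Q y" shows "AE y in M. Q (x + y)"
proof -
  obtain N where N: "{y \<in> space M. \<not> Q y} \<subseteq> N" "emeasure M N = 0" "N \<in> sets M"
    using assms by (rule AE_E)
  have sN[measurable]: "N \<in> sets borel" using N by simp
  have "(\<integral>\<^sup>+y. indicator N (x + y) \<partial>M) = (\<integral>\<^sup>+y. indicator N y \<partial>M)"
    by (rule left_invariantD[OF left_inv]) simp
  then have "(\<integral>\<^sup>+y. indicator N (x + y) \<partial>M) = 0" using N by simp
  then have "AE y in M. (indicator N (x + y) :: ennreal) = 0"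
    by (subst (asm) nn_integral_0_iff_AE) auto
  then show ?thesis
    by eventually_elim (use N in \<open>auto split: split_indicator_asm\<close>)
qed

lemma nn_integral_product_square:
  assumes [measurable]: "f \<in> borel_measurable M" "g \<in> borel_measurable M" "W \<in> borel_measurable M"
  shows "(\<integral>\<^sup>+x. f x * g x * W x \<partial>M)\<^sup>2 \<le> (\<integral>\<^sup>+x. (f x)\<^sup>2 * W x \<partial>M) * (\<integral>\<^sup>+x. (g x)\<^sup>2 * W x \<partial>M)"
  using Cauchy_Schwarz_nn_integral[of f "density M W" g]
  by (simp add: nn_integral_density mult_ac)

context central_extension
begin

lemma AE_zero_from_fibres:
  assumes [measurable]: "X \<in> borel_measurable borel" and "AE g in \<nu>G. fibre_integral X (s g) = 0"
  shows "AE x in \<nu>E. X x = 0"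
proof -
  have "weil_constant * (\<integral>\<^sup>+x. X x \<partial>\<nu>E) = (\<integral>\<^sup>+g. fibre_integral X (s g) \<partial>\<nu>G)"
    by (rule weil_formula[symmetric]) simp
  also have "\<dots> = (\<integral>\<^sup>+g. 0 \<partial>\<nu>G)" by (rule nn_integral_cong_AE) (use assms(2) in simp)
  finally have "(\<integral>\<^sup>+x. X x \<partial>\<nu>E) = 0" using weil_constant_pos by simp
  then show ?thesis by (subst (asm) nn_integral_0_iff_AE) auto
qed

lemma fibre_integral_cmult_invariant:
  assumes f: "\<And>x y. p x = p y \<Longrightarrow> f x = f y" and [measurable]: "H \<in> borel_measurable borel"
  shows "fibre_integral (\<lambda>x. f x * H x) z = f z * fibre_integral H z"
proof -
  have "fibre_integral (\<lambda>x. f x * H x) z = (\<integral>\<^sup>+a. f z * H (z + a) \<partial>\<nu>A)"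
    unfolding fibre_integral_def
  proof (rule nn_integral_cong_AE)
    show "AE a in \<nu>A. f (z + a) * H (z + a) = f z * H (z + a)"
      using AE_fibre
    proof eventually_elim
      case (elim a)
      then have "f (z + a) = f z" by (intro f) (simp add: A_iff)
      then show ?case by simp
    qed
  qed
  also have "\<dots> = f z * fibre_integral H z"
    unfolding fibre_integral_def by (rule nn_integral_cmult) simp
  finally show ?thesis .
qed

text \<open>The \<open>L\<^sup>2\<close> norm of \<open>H\<close> on the coset of \<open>x\<close>, with value \<open>0\<close> where it is infinite.\<close>

definition fibre_norm :: "('e \<Rightarrow> ennreal) \<Rightarrow> 'e \<Rightarrow> ennreal" where
  "fibre_norm H x = ennreal (sqrt (enn2real (fibre_integral (\<lambda>x. (H x)\<^sup>2) x)))"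

lemma fibre_norm_measurable [measurable]:
  assumes [measurable]: "H \<in> borel_measurable borel" shows "fibre_norm H \<in> borel_measurable borel"
  unfolding fibre_norm_def[abs_def] by measurable

lemma fibre_norm_coset:
  assumes [measurable]: "H \<in> borel_measurable borel" and "p x = p y"
  shows "fibre_norm H x = fibre_norm H y"
  unfolding fibre_norm_def by (subst fibre_integral_coset[OF _ assms(2)]) auto

text \<open>Let \<open>T(x)\<close> be the convolution integral, \<open>\<phi>\<close> the fibrewise norm of \<open>H\<close> and \<open>\<Phi>\<close> the convolution on \<open>G\<close> of \<open>\<phi>\<close> with the
  fibre integrals of \<open>W\<close>. Instead of Minkowski's and Young's inequalities one application of the Cauchy-Schwarz
  inequality with weight \<open>\<phi>\<close> suffices: \<open>T\<^sup>2 \<le> X\<^sub>1 X\<^sub>2\<close>, where \<open>X\<^sub>1\<close> and \<open>X\<^sub>2\<close> are the convolutions with \<open>W\<close> of \<open>\<phi>\<close> and of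
  \<open>H\<^sup>2/\<phi>\<close>. By Weil's formula \<open>X\<^sub>1\<close> is constant on cosets and equals \<open>\<Phi>\<close> there, up to the constant, and the fibre
  integral of \<open>X\<^sub>2\<close> is at most \<open>X\<^sub>1\<close> because that of \<open>H\<^sup>2/\<phi>\<close> is at most \<open>\<phi>\<close>.\<close>

lemma convolution_fibrewise_bound:
  assumes H[measurable]: "H \<in> borel_measurable borel" and W[measurable]: "W \<in> borel_measurable borel"
    and fin: "(\<integral>\<^sup>+x. (H x)\<^sup>2 \<partial>\<nu>E) < \<infinity>"
  shows "weil_constant ^ 3 * (\<integral>\<^sup>+x. (\<integral>\<^sup>+y. H (x + y) * W y \<partial>\<nu>E)\<^sup>2 \<partial>\<nu>E)
    \<le> (\<integral>\<^sup>+t. (\<integral>\<^sup>+g. fibre_norm H (s (t + g)) * fibre_integral W (s g) \<partial>\<nu>G)\<^sup>2 \<partial>\<nu>G)"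
proof -
  define \<phi> where "\<phi> = fibre_norm H"
  define \<Phi> where "\<Phi> t = (\<integral>\<^sup>+g. \<phi> (s (t + g)) * fibre_integral W (s g) \<partial>\<nu>G)" for t
  define P2 where "P2 = fibre_integral (\<lambda>x. (H x)\<^sup>2)"
  define u where "u x = ennreal (sqrt (sqrt (enn2real (P2 x))))" for x
  define S where "S = {x. P2 x \<noteq> 0 \<and> P2 x \<noteq> \<infinity>}"
  define R where "R x = indicator S x * (H x / u x)" for x
  have P2[measurable]: "P2 \<in> borel_measurable borel" unfolding P2_def by measurable
  have P2c: "p x = p y \<Longrightarrow> P2 x = P2 y" for x y unfolding P2_def by (rule fibre_integral_coset) auto
  have P2i: "(indicator {x. Q (P2 x)} x :: ennreal) = indicator {x. Q (P2 x)} y" if "p x = p y" for x y Q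
    using P2c[OF that] by (simp add: indicator_def)
  have \<phi>[measurable]: "\<phi> \<in> borel_measurable borel" unfolding \<phi>_def by measurable
  have \<phi>c: "p x = p y \<Longrightarrow> \<phi> x = \<phi> y" for x y unfolding \<phi>_def by (rule fibre_norm_coset[OF H])
  have u[measurable]: "u \<in> borel_measurable borel" unfolding u_def[abs_def] by measurable
  have u2: "(u x)\<^sup>2 = \<phi> x" for x
    by (simp add: u_def \<phi>_def fibre_norm_def P2_def ennreal_power)
  have S[measurable]: "S \<in> sets borel" unfolding S_def by measurable
  have R[measurable]: "R \<in> borel_measurable borel" unfolding R_def[abs_def] by measurable
  have conv: "(\<lambda>x. \<integral>\<^sup>+y. f (x + y) * W y \<partial>\<nu>E) \<in> borel_measurable borel"
    if f: "f \<in> borel_measurable borel" for f :: "'e \<Rightarrow> ennreal"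
  proof -
    have "(\<lambda>q. f (fst q + snd q) * W (snd q)) \<in> borel_measurable (borel :: ('e \<times> 'e) measure)"
      by (intro borel_measurable_times_ennreal plus_measurable[OF f]
        measurable_compose[OF borel_measurable_continuous_onI W] continuous_intros)
    from borel_fubini_measurable(1)[OF E.fubini this] show ?thesis by simp
  qed

  \<comment> \<open>The weight is \<open>u\<^sup>2\<close>. Where it vanishes or had to be set to zero, \<open>H\<close> is zero almost everywhere or the
    set of points is null; hence \<open>H = u R\<close> almost everywhere, with \<open>R\<^sup>2\<close> in the role of \<open>H\<^sup>2/\<phi>\<close>.\<close>
  have "(\<integral>\<^sup>+g. P2 (s g) \<partial>\<nu>G) = weil_constant * (\<integral>\<^sup>+x. (H x)\<^sup>2 \<partial>\<nu>E)"
    unfolding P2_def by (rule weil_formula) simp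
  also have "\<dots> < \<infinity>" using fin weil_constant_finite by (simp add: ennreal_mult_less_top less_top)
  finally have "AE g in \<nu>G. P2 (s g) \<noteq> \<infinity>" by (intro nn_integral_PInf_AE) auto
  then have "AE g in \<nu>G. fibre_integral (\<lambda>x. indicator {x. P2 x = \<infinity>} x * 1) (s g) = 0"
  proof eventually_elim
    case (elim g)
    have "fibre_integral (\<lambda>x. indicator {x. P2 x = \<infinity>} x * 1) (s g) = indicator {x. P2 x = \<infinity>} (s g) * fibre_integral (\<lambda>_. 1) (s g)"
      by (rule fibre_integral_cmult_invariant[OF P2i]) simp_all
    then show ?case using elim by simp
  qed
  then have "AE x in \<nu>E. indicator {x. P2 x = \<infinity>} x * (1::ennreal) = 0"
    by (intro AE_zero_from_fibres) measurable
  moreover have "AE x in \<nu>E. indicator {x. P2 x = 0} x * (H x)\<^sup>2 = 0"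
  proof (intro AE_zero_from_fibres AE_I2)
    fix g
    have "fibre_integral (\<lambda>x. indicator {x. P2 x = 0} x * (H x)\<^sup>2) (s g) = indicator {x. P2 x = 0} (s g) * P2 (s g)"
      by (subst fibre_integral_cmult_invariant[OF P2i]) (simp_all add: P2_def)
    then show "fibre_integral (\<lambda>x. indicator {x. P2 x = 0} x * (H x)\<^sup>2) (s g) = 0"
      by (simp split: split_indicator)
  qed measurable
  ultimately have H_eq: "AE x in \<nu>E. H x = u x * R x"
  proof eventually_elim
    case (elim x)
    show ?case
    proof (cases "x \<in> S")
      case True
      then have "0 < enn2real (P2 x)"
        by (auto simp: S_def enn2real_positive_iff zero_less_iff_neq_zero less_top)
      then have "u x \<noteq> 0" "u x \<noteq> \<infinity>" by (auto simp: u_def ennreal_eq_0_iff)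
      then show ?thesis using True
        by (simp add: R_def ennreal_times_divide mult.commute[of "u x"] ennreal_mult_divide_eq)
    next
      case False
      then show ?thesis using elim by (auto simp: S_def R_def split: split_indicator_asm)
    qed
  qed

  define X1 where "X1 x = (\<integral>\<^sup>+y. \<phi> (x + y) * W y \<partial>\<nu>E)" for x
  define X2 where "X2 x = (\<integral>\<^sup>+y. (R (x + y))\<^sup>2 * W y \<partial>\<nu>E)" for x
  have X1m[measurable]: "X1 \<in> borel_measurable borel" unfolding X1_def[abs_def] by (rule conv) simp
  have X2m[measurable]: "X2 \<in> borel_measurable borel" unfolding X2_def[abs_def] by (rule conv[of "\<lambda>x. (R x)\<^sup>2"]) simp
  have CS: "(\<integral>\<^sup>+y. H (x + y) * W y \<partial>\<nu>E)\<^sup>2 \<le> X1 x * X2 x" for x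
  proof -
    have "(\<integral>\<^sup>+y. H (x + y) * W y \<partial>\<nu>E) = (\<integral>\<^sup>+y. u (x + y) * R (x + y) * W y \<partial>\<nu>E)"
      using E.AE_left_translate[OF H_eq, of x] by (intro nn_integral_cong_AE) (auto elim: eventually_mono)
    then show ?thesis
      using nn_integral_product_square[of "\<lambda>y. u (x + y)" \<nu>E "\<lambda>y. R (x + y)" W]
      by (simp add: X1_def X2_def u2)
  qed
  have X1_eq: "weil_constant * X1 x = \<Phi> (p x)" for x
  proof -
    have "weil_constant * X1 x = (\<integral>\<^sup>+g. fibre_integral (\<lambda>y. \<phi> (x + y) * W y) (s g) \<partial>\<nu>G)"
      unfolding X1_def by (rule weil_formula[symmetric]) measurable
    also have "\<dots> = (\<integral>\<^sup>+g. \<phi> (x + s g) * fibre_integral W (s g) \<partial>\<nu>G)"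
      by (intro nn_integral_cong fibre_integral_cmult_invariant \<phi>c) auto
    also have "\<dots> = \<Phi> (p x)"
      unfolding \<Phi>_def by (intro nn_integral_cong arg_cong2[where f = "(*)"] \<phi>c) auto
    finally show ?thesis .
  qed
  have PR: "fibre_integral (\<lambda>x. (R x)\<^sup>2) z \<le> \<phi> z" for z
  proof (cases "z \<in> S")
    case True
    then obtain r where r: "P2 z = ennreal r" "r > 0"
      by (cases "P2 z") (auto simp: S_def zero_less_iff_neq_zero)
    have "fibre_integral (\<lambda>x. (R x)\<^sup>2) z = fibre_integral (\<lambda>x. (indicator S x / \<phi> x) * (H x)\<^sup>2) z"
      unfolding fibre_integral_def
      by (intro nn_integral_cong) (auto simp: R_def power_mult_distrib power_divide_distrib_ennreal u2
          ennreal_divide_times split: split_indicator)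
    also have "\<dots> = (indicator S z / \<phi> z) * P2 z"
      unfolding P2_def
    proof (rule fibre_integral_cmult_invariant)
      fix x y assume "p x = p y"
      then show "(indicator S x / \<phi> x :: ennreal) = indicator S y / \<phi> y"
        using P2c[of x y] \<phi>c[of x y] by (simp add: S_def indicator_def)
    qed simp
    also have "\<dots> = \<phi> z"
      using True r by (simp add: \<phi>_def fibre_norm_def P2_def[symmetric] ennreal_divide_times divide_ennreal real_div_sqrt)
    finally show ?thesis by simp
  next
    case False
    have "fibre_integral (\<lambda>x. (R x)\<^sup>2) z = fibre_integral (\<lambda>x. indicator S x * (R x)\<^sup>2) z"
      unfolding fibre_integral_def by (intro nn_integral_cong) (auto simp: R_def split: split_indicator)
    also have "\<dots> = indicator S z * fibre_integral (\<lambda>x. (R x)\<^sup>2) z"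
      unfolding S_def by (rule fibre_integral_cmult_invariant[OF P2i]) simp_all
    finally show ?thesis using False by simp
  qed
  have PX2: "fibre_integral X2 x \<le> X1 x" for x
  proof -
    have "(\<lambda>q. (R (x + snd q + fst q))\<^sup>2 * W (fst q)) \<in> borel_measurable (borel :: ('e \<times> 'e) measure)"
      by (intro borel_measurable_times_ennreal borel_measurable_power_ennreal
        measurable_compose[OF borel_measurable_continuous_onI R]
        measurable_compose[OF borel_measurable_continuous_onI W] continuous_intros)
    from borel_fubini_iterate[OF fubini_EA this]
    have "fibre_integral X2 x = (\<integral>\<^sup>+y. \<integral>\<^sup>+a. (R (x + a + y))\<^sup>2 * W y \<partial>\<nu>A \<partial>\<nu>E)"
      by (simp add: fibre_integral_def X2_def)
    also have "\<dots> = (\<integral>\<^sup>+y. fibre_integral (\<lambda>x. (R x)\<^sup>2) (x + y) * W y \<partial>\<nu>E)"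
    proof (intro nn_integral_cong)
      fix y
      have "(\<integral>\<^sup>+a. (R (x + a + y))\<^sup>2 * W y \<partial>\<nu>A) = (\<integral>\<^sup>+a. (R (x + y + a))\<^sup>2 * W y \<partial>\<nu>A)"
      proof (rule nn_integral_cong_AE)
        show "AE a in \<nu>A. (R (x + a + y))\<^sup>2 * W y = (R (x + y + a))\<^sup>2 * W y"
          using AE_fibre
        proof eventually_elim
          case (elim a)
          show ?case by (simp only: add.assoc A_commute[OF elim, of y])
        qed
      qed
      also have "\<dots> = fibre_integral (\<lambda>x. (R x)\<^sup>2) (x + y) * W y"
        unfolding fibre_integral_def by (rule nn_integral_multc) measurable
      finally show "(\<integral>\<^sup>+a. (R (x + a + y))\<^sup>2 * W y \<partial>\<nu>A) = fibre_integral (\<lambda>x. (R x)\<^sup>2) (x + y) * W y" .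
    qed
    also have "\<dots> \<le> X1 x"
      unfolding X1_def by (intro nn_integral_mono mult_right_mono PR) auto
    finally show ?thesis .
  qed
  have \<Phi>m[measurable]: "\<Phi> \<in> borel_measurable borel"
  proof -
    have "\<Phi> = (\<lambda>t. weil_constant * X1 (s t))" by (simp add: X1_eq fun_eq_iff)
    then show ?thesis by simp
  qed
  have "weil_constant ^ 3 * (\<integral>\<^sup>+x. (\<integral>\<^sup>+y. H (x + y) * W y \<partial>\<nu>E)\<^sup>2 \<partial>\<nu>E)
      \<le> weil_constant ^ 3 * (\<integral>\<^sup>+x. X1 x * X2 x \<partial>\<nu>E)"
    by (intro mult_left_mono nn_integral_mono CS) auto
  also have "\<dots> = weil_constant * (weil_constant * (\<integral>\<^sup>+x. weil_constant * (X1 x * X2 x) \<partial>\<nu>E))"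
    by (simp add: nn_integral_cmult power3_eq_cube mult.assoc)
  also have "\<dots> = weil_constant * (weil_constant * (\<integral>\<^sup>+x. \<Phi> (p x) * X2 x \<partial>\<nu>E))"
    by (simp add: mult.assoc[symmetric] X1_eq)
  also have "\<dots> = weil_constant * (\<integral>\<^sup>+t. fibre_integral (\<lambda>x. \<Phi> (p x) * X2 x) (s t) \<partial>\<nu>G)"
    by (subst weil_formula) auto
  also have "\<dots> = weil_constant * (\<integral>\<^sup>+t. \<Phi> t * fibre_integral X2 (s t) \<partial>\<nu>G)"
    by (subst fibre_integral_cmult_invariant) auto
  also have "\<dots> = (\<integral>\<^sup>+t. \<Phi> t * (weil_constant * fibre_integral X2 (s t)) \<partial>\<nu>G)"
    by (subst nn_integral_cmult[symmetric]) (auto simp: mult_ac)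
  also have "\<dots> \<le> (\<integral>\<^sup>+t. (\<Phi> t)\<^sup>2 \<partial>\<nu>G)"
  proof (intro nn_integral_mono)
    fix t
    have "weil_constant * fibre_integral X2 (s t) \<le> \<Phi> t"
      using X1_eq[of "s t"] mult_left_mono[OF PX2[of "s t"], of weil_constant] by simp
    then show "\<Phi> t * (weil_constant * fibre_integral X2 (s t)) \<le> (\<Phi> t)\<^sup>2"
      by (auto simp: power2_eq_square intro!: mult_left_mono)
  qed
  finally show ?thesis by (simp add: \<Phi>_def \<phi>_def)
qed

end

section \<open>Transfer of operator norm bounds\<close>

lemma L2_functions_iff:
  "h \<in> L2_functions M \<longleftrightarrow> h \<in> borel_measurable M \<and> (\<integral>\<^sup>+x. (ennreal (cmod (h x)))\<^sup>2 \<partial>M) < \<infinity>"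
proof -
  have "integrable M (\<lambda>x. (cmod (h x))\<^sup>2) \<longleftrightarrow> (\<integral>\<^sup>+x. (ennreal (cmod (h x)))\<^sup>2 \<partial>M) < \<infinity>"
    if [measurable]: "h \<in> borel_measurable M"
    by (simp add: integrable_iff_bounded ennreal_power)
  then show ?thesis by (auto simp: L2_functions_def)
qed

lemma ennreal_L2_norm:
  assumes "h \<in> L2_functions M"
  shows "(ennreal (L2_norm M h))\<^sup>2 = (\<integral>\<^sup>+x. (ennreal (cmod (h x)))\<^sup>2 \<partial>M)"
proof -
  have "integrable M (\<lambda>x. (cmod (h x))\<^sup>2)" using assms by (simp add: L2_functions_def)
  then have "(\<integral>\<^sup>+x. ennreal ((cmod (h x))\<^sup>2) \<partial>M) = ennreal (LINT x|M. (cmod (h x))\<^sup>2)"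
    by (intro nn_integral_eq_integral) auto
  then show ?thesis by (simp add: L2_norm_def ennreal_power)
qed

lemma L2_norm_nonneg [simp]: "0 \<le> L2_norm M h"
  by (simp add: L2_norm_def)

lemma L2_norm_leI:
  assumes "h \<in> L2_functions M" "0 \<le> c" "(\<integral>\<^sup>+x. (ennreal (cmod (h x)))\<^sup>2 \<partial>M) \<le> (ennreal c)\<^sup>2"
  shows "L2_norm M h \<le> c"
proof -
  have "ennreal ((L2_norm M h)\<^sup>2) \<le> ennreal (c\<^sup>2)"
    using assms(2,3) unfolding ennreal_L2_norm[OF assms(1), symmetric] by (simp add: ennreal_power)
  then show ?thesis using assms(2) by (simp add: power2_le_iff_abs_le)
qed

lemma L2_operator_norm_leI:
  assumes "0 \<le> c" "\<And>g. g \<in> L2_functions M \<Longrightarrow> T g \<in> L2_functions M \<and> L2_norm M (T g) \<le> c * L2_norm M g"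
  shows "L2_operator_norm M T \<le> ennreal c"
  unfolding L2_operator_norm_def using assms by (intro Inf_lower) auto

text \<open>The infimum that defines the operator norm is attained.\<close>

lemma L2_operator_norm_leD:
  assumes "L2_operator_norm M T \<le> ennreal c" "0 \<le> c" "g \<in> L2_functions M"
  shows "T g \<in> L2_functions M" "L2_norm M (T g) \<le> c * L2_norm M g"
proof -
  have *: "T g \<in> L2_functions M \<and> L2_norm M (T g) \<le> (c + e) * L2_norm M g" if "e > 0" for e
  proof -
    have "L2_operator_norm M T < ennreal (c + e)"
      using assms that by (simp add: order_le_less_trans[OF assms(1)] ennreal_lessI)
    then obtain k where k: "0 \<le> k" "ennreal k < ennreal (c + e)"
      "\<forall>g\<in>L2_functions M. T g \<in> L2_functions M \<and> L2_norm M (T g) \<le> k * L2_norm M g"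
      unfolding L2_operator_norm_def Inf_less_iff by auto
    then have "k \<le> c + e" by (simp add: ennreal_less_iff)
    then have "k * L2_norm M g \<le> (c + e) * L2_norm M g" by (intro mult_right_mono) auto
    with k(3) assms(3) show ?thesis by fastforce
  qed
  from *[of 1] show "T g \<in> L2_functions M" by simp
  show "L2_norm M (T g) \<le> c * L2_norm M g"
  proof (rule field_le_epsilon)
    fix e :: real assume e: "e > 0"
    define d where "d = e / (L2_norm M g + 1)"
    have n: "L2_norm M g + 1 > 0" using L2_norm_nonneg[of M g] by linarith
    have "d > 0" using e n by (simp add: d_def)
    then have "L2_norm M (T g) \<le> (c + d) * L2_norm M g" using * by blast
    also have "\<dots> = c * L2_norm M g + d * L2_norm M g" by (simp add: algebra_simps)
    also have "d * L2_norm M g \<le> d * (L2_norm M g + 1)" using \<open>d > 0\<close> by simp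
    also have "\<dots> = e" using n by (simp add: d_def)
    finally show "L2_norm M (T g) \<le> c * L2_norm M g + e" by simp
  qed
qed

text \<open>The integral is a Borel expression in five nonnegative ones: those of the norm, which decides
  integrability, and of the positive and negative parts of the real and imaginary part.\<close>

lemma borel_fubini_integral_measurable:
  fixes M :: "'a::topological_space measure" and N :: "'b::topological_space measure"
    and K :: "'a \<times> 'b \<Rightarrow> complex"
  assumes MN: "borel_fubini M N" and K[measurable]: "K \<in> borel_measurable borel"
  shows "(\<lambda>x. LINT y|N. K (x, y)) \<in> borel_measurable borel"
proof -
  note [measurable_cong] = borel_fubini_sets[OF MN]
  note sec[measurable] = borel_measurable_Pair_sections[OF K]
  have meas: "(\<lambda>x. \<integral>\<^sup>+y. ennreal (r (K (x, y))) \<partial>N) \<in> borel_measurable borel"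
    if [measurable]: "r \<in> borel_measurable borel" for r :: "complex \<Rightarrow> real"
    by (rule borel_fubini_measurable(1)[OF MN, of "\<lambda>q. ennreal (r (K q))"]) measurable
  define I where "I r x = (\<integral>\<^sup>+y. ennreal (r (K (x, y))) \<partial>N)" for r x
  have I[measurable]: "I r \<in> borel_measurable borel" if "r \<in> borel_measurable borel" for r
    unfolding I_def[abs_def] using that by (rule meas)
  have eq: "(LINT y|N. K (x, y)) = (if I cmod x < \<infinity> then
      complex_of_real (enn2real (I Re x) - enn2real (I (\<lambda>z. - Re z) x)) +
      \<i> * complex_of_real (enn2real (I Im x) - enn2real (I (\<lambda>z. - Im z) x)) else 0)" for x
  proof (cases "I cmod x < \<infinity>")
    case True
    then have int: "integrable N (\<lambda>y. K (x, y))"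
      using sec(1)[of x] by (auto simp: integrable_iff_bounded I_def)
    then have "Re (LINT y|N. K (x, y)) = enn2real (I Re x) - enn2real (I (\<lambda>z. - Re z) x)"
      unfolding integral_Re[OF int, symmetric] I_def by (intro real_lebesgue_integral_def) auto
    moreover have "Im (LINT y|N. K (x, y)) = enn2real (I Im x) - enn2real (I (\<lambda>z. - Im z) x)"
      unfolding integral_Im[OF int, symmetric] I_def using int by (intro real_lebesgue_integral_def) auto
    ultimately show ?thesis using True by (simp add: complex_eq_iff)
  next
    case False
    then have "\<not> integrable N (\<lambda>y. K (x, y))" by (simp add: integrable_iff_bounded I_def)
    then show ?thesis using False by (simp add: not_integrable_integral_eq)
  qed
  have [measurable]: "I cmod \<in> borel_measurable borel" "I Re \<in> borel_measurable borel"
    "I Im \<in> borel_measurable borel" "I (\<lambda>z. - Re z) \<in> borel_measurable borel"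
    "I (\<lambda>z. - Im z) \<in> borel_measurable borel" by (intro I; measurable)+
  show ?thesis unfolding eq by measurable
qed

context haar_group
begin

lemma minus_measurable:
  fixes g :: "'a \<Rightarrow> 'x::topological_space"
  assumes "g \<in> borel_measurable borel" shows "(\<lambda>q. g (fst q - snd q)) \<in> borel_measurable borel"
  by (rule measurable_compose[OF borel_measurable_continuous_onI assms]) (auto intro!: continuous_intros)

lemma snd_measurable:
  fixes g :: "'a \<Rightarrow> 'x::topological_space"
  assumes "g \<in> borel_measurable borel"
  shows "(\<lambda>q. g (snd q)) \<in> borel_measurable (borel :: ('a \<times> 'a) measure)"
  by (rule measurable_compose[OF borel_measurable_continuous_onI assms]) (auto intro!: continuous_intros)

lemma right_convolution_measurable:
  assumes [measurable]: "f \<in> borel_measurable borel" "g \<in> borel_measurable borel"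
  shows "right_convolution M f g \<in> borel_measurable borel"
proof -
  have [measurable]: "(\<lambda>q. g (fst q - snd q)) \<in> borel_measurable borel"
    "(\<lambda>q. f (snd q)) \<in> borel_measurable (borel :: ('a \<times> 'a) measure)"
    "(\<lambda>q. modular_function M (snd q)) \<in> borel_measurable (borel :: ('a \<times> 'a) measure)"
    by (intro minus_measurable snd_measurable; measurable)+
  have "(\<lambda>q. complex_of_real (inverse (modular_function M (snd q))) * g (fst q - snd q) * f (snd q))
      \<in> borel_measurable (borel :: ('a \<times> 'a) measure)"
    by measurable
  from borel_fubini_integral_measurable[OF fubini this] show ?thesis
    by (simp add: right_convolution_def[abs_def])
qed

lemma nn_integral_right_convolution:
  fixes H F :: "'a \<Rightarrow> ennreal"
  assumes [measurable]: "H \<in> borel_measurable borel" "F \<in> borel_measurable borel"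
  shows "(\<integral>\<^sup>+y. ennreal (inverse (modular_function M y)) * H (x - y) * F (- y) \<partial>M) = (\<integral>\<^sup>+y. H (x + y) * F y \<partial>M)"
  using nn_integral_inverse[of "\<lambda>y. H (x + y) * F y"] by (simp add: mult_ac)

lemma norm_right_convolution_le:
  assumes [measurable]: "f \<in> borel_measurable borel" "g \<in> borel_measurable borel"
  shows "ennreal (cmod (right_convolution M f g x)) \<le> (\<integral>\<^sup>+y. ennreal (cmod (g (x + y))) * ennreal (cmod (f (- y))) \<partial>M)"
proof -
  let ?k = "\<lambda>y. complex_of_real (inverse (modular_function M y)) * g (x - y) * f y"
  have "ennreal (cmod (LINT y|M. ?k y)) \<le> (\<integral>\<^sup>+y. ennreal (cmod (?k y)) \<partial>M)"
    by (cases "integrable M ?k") (auto simp: integral_norm_bound_ennreal not_integrable_integral_eq)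
  also have "\<dots> = (\<integral>\<^sup>+y. ennreal (inverse (modular_function M y)) * ennreal (cmod (g (x - y))) * ennreal (cmod (f (- (- y)))) \<partial>M)"
    using modular_pos by (intro nn_integral_cong) (simp add: norm_mult norm_inverse ennreal_mult abs_of_pos less_imp_le)
  also have "\<dots> = (\<integral>\<^sup>+y. ennreal (cmod (g (x + y))) * ennreal (cmod (f (- y))) \<partial>M)"
    by (rule nn_integral_right_convolution) measurable
  finally show ?thesis by (simp add: right_convolution_def)
qed

text \<open>For square-integrable data with compact support the convolution integral converges at every point, by the
  Cauchy-Schwarz inequality and the boundedness of the modular function on compact sets. Thus the value \<open>0\<close> that
  is assigned to divergent integrals never occurs.\<close>

lemma right_convolution_nonneg:
  fixes \<phi> :: "'a \<Rightarrow> real" and \<psi> :: "'a \<Rightarrow> ennreal"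
  assumes [measurable]: "\<phi> \<in> borel_measurable borel" "\<psi> \<in> borel_measurable borel"
    and \<phi>0: "\<And>x. 0 \<le> \<phi> x" and \<phi>2: "(\<integral>\<^sup>+x. (ennreal (\<phi> x))\<^sup>2 \<partial>M) < \<infinity>"
    and \<psi>2: "(\<integral>\<^sup>+x. (\<psi> (- x))\<^sup>2 \<partial>M) < \<infinity>"
    and S: "compact S" "\<And>x. \<psi> (- x) \<noteq> 0 \<Longrightarrow> x \<in> S"
  shows "ennreal (cmod (right_convolution M (\<lambda>x. complex_of_real (enn2real (\<psi> (- x)))) (\<lambda>x. complex_of_real (\<phi> x)) t))
    = (\<integral>\<^sup>+y. ennreal (\<phi> (t + y)) * \<psi> y \<partial>M)"
proof -
  define F where "F x = enn2real (\<psi> (- x))" for x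
  have F[measurable]: "F \<in> borel_measurable borel" unfolding F_def[abs_def] by measurable
  have "AE x in M. (\<psi> (- x))\<^sup>2 \<noteq> \<infinity>" using \<psi>2 by (intro nn_integral_PInf_AE) auto
  then have AE: "AE x in M. ennreal (F x) = \<psi> (- x)"
    by eventually_elim (auto simp: F_def less_top power_less_top_ennreal)
  define k where "k y = inverse (modular_function M y) * \<phi> (t - y) * F y" for y
  have [measurable]: "k \<in> borel_measurable borel" unfolding k_def[abs_def] by measurable
  have k0: "0 \<le> k y" for y using modular_pos[of y] \<phi>0 by (simp add: k_def F_def)
  have k_int: "(\<integral>\<^sup>+y. ennreal (k y) \<partial>M) = (\<integral>\<^sup>+y. ennreal (\<phi> (t + y)) * \<psi> y \<partial>M)"
  proof -
    have "(\<integral>\<^sup>+y. ennreal (k y) \<partial>M) = (\<integral>\<^sup>+y. ennreal (inverse (modular_function M y)) * ennreal (\<phi> (t - y)) * ennreal (F y) \<partial>M)"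
      using modular_pos \<phi>0 by (intro nn_integral_cong) (simp add: k_def ennreal_mult F_def less_imp_le)
    also have "\<dots> = (\<integral>\<^sup>+y. ennreal (inverse (modular_function M y)) * ennreal (\<phi> (t - y)) * \<psi> (- y) \<partial>M)"
      using AE by (intro nn_integral_cong_AE) (auto elim!: eventually_mono)
    also have "\<dots> = (\<integral>\<^sup>+y. ennreal (\<phi> (t + y)) * \<psi> y \<partial>M)"
      by (rule nn_integral_right_convolution) measurable
    finally show ?thesis .
  qed
  have "(\<integral>\<^sup>+y. ennreal (\<phi> (t + y)) * \<psi> y \<partial>M)\<^sup>2 < \<infinity>"
  proof -
    have "compact (uminus ` S)" using S by (intro compact_continuous_image continuous_intros)
    then obtain b where b: "b > 0" "\<And>x. x \<in> uminus ` S \<Longrightarrow> modular_function M x \<le> b"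
      using modular_bounded by blast
    have "(\<integral>\<^sup>+y. (\<psi> y)\<^sup>2 \<partial>M) = (\<integral>\<^sup>+x. (\<psi> (- x))\<^sup>2 * ennreal (inverse (modular_function M x)) \<partial>M)"
      by (rule nn_integral_inverse[symmetric]) measurable
    also have "\<dots> \<le> (\<integral>\<^sup>+x. (\<psi> (- x))\<^sup>2 * ennreal b \<partial>M)"
    proof (intro nn_integral_mono)
      fix x
      show "(\<psi> (- x))\<^sup>2 * ennreal (inverse (modular_function M x)) \<le> (\<psi> (- x))\<^sup>2 * ennreal b"
      proof (cases "\<psi> (- x) = 0")
        case False
        then have "modular_function M (- x) \<le> b" using S by (intro b) auto
        then show ?thesis by (intro mult_left_mono ennreal_leI) (auto simp: modular_uminus)
      qed simp
    qed
    also have "\<dots> < \<infinity>" using \<psi>2 by (simp add: nn_integral_multc ennreal_mult_less_top)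
    finally have fin: "(\<integral>\<^sup>+y. (\<psi> y)\<^sup>2 \<partial>M) < \<infinity>" .
    have "(\<integral>\<^sup>+y. ennreal (\<phi> (t + y)) * \<psi> y \<partial>M)\<^sup>2 \<le> (\<integral>\<^sup>+y. (ennreal (\<phi> (t + y)))\<^sup>2 \<partial>M) * (\<integral>\<^sup>+y. (\<psi> y)\<^sup>2 \<partial>M)"
      by (rule Cauchy_Schwarz_nn_integral) measurable
    also have "(\<integral>\<^sup>+y. (ennreal (\<phi> (t + y)))\<^sup>2 \<partial>M) = (\<integral>\<^sup>+y. (ennreal (\<phi> y))\<^sup>2 \<partial>M)"
      by (rule left_invariantD[OF left_inv]) measurable
    finally show ?thesis using \<phi>2 fin by (simp add: ennreal_mult_less_top order_le_less_trans)
  qed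
  then have fin: "(\<integral>\<^sup>+y. ennreal (k y) \<partial>M) < \<infinity>"
    unfolding k_int by (simp add: power_less_top_ennreal)
  have "integrable M k"
    using fin k0 by (simp add: integrable_iff_bounded)
  then have "(\<integral>\<^sup>+y. ennreal (k y) \<partial>M) = ennreal (LINT y|M. k y)" "0 \<le> (LINT y|M. k y)"
    using k0 by (auto intro!: nn_integral_eq_integral)
  moreover have "right_convolution M (\<lambda>x. complex_of_real (enn2real (\<psi> (- x)))) (\<lambda>x. complex_of_real (\<phi> x)) t
      = complex_of_real (LINT y|M. k y)"
    unfolding right_convolution_def integral_complex_of_real[symmetric]
    by (intro Bochner_Integration.integral_cong) (auto simp: k_def F_def)
  ultimately show ?thesis using k_int by simp
qed

lemma nn_integral_inverse':
  assumes [measurable]: "q \<in> borel_measurable borel"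
  shows "(\<integral>\<^sup>+x. q (- x) \<partial>M) = (\<integral>\<^sup>+x. ennreal (inverse (modular_function M x)) * q x \<partial>M)"
proof -
  have "(\<integral>\<^sup>+x. ennreal (inverse (modular_function M x)) * q x \<partial>M)
    = (\<integral>\<^sup>+x. ennreal (inverse (modular_function M (- x))) * q (- x) * ennreal (inverse (modular_function M x)) \<partial>M)"
    by (rule nn_integral_inverse[symmetric]) measurable
  also have "\<dots> = (\<integral>\<^sup>+x. q (- x) \<partial>M)"
  proof (intro nn_integral_cong)
    fix x
    have "ennreal (modular_function M x) * ennreal (inverse (modular_function M x)) = 1"
      using modular_pos[of x] by (simp add: ennreal_mult[symmetric])
    then show "ennreal (inverse (modular_function M (- x))) * q (- x) * ennreal (inverse (modular_function M x)) = q (- x)"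
      by (simp add: modular_uminus mult_ac)
  qed
  finally show ?thesis ..
qed

end

context central_extension
begin

text \<open>The Cauchy-Schwarz inequality on a coset, where the measure of the support compares the \<open>L\<^sup>1\<close> norm with the
  \<open>L\<^sup>2\<close> norm.\<close>

lemma fibre_integral_square_le:
  assumes [measurable]: "W \<in> borel_measurable borel"
  shows "(fibre_integral W z)\<^sup>2 \<le> emeasure \<nu>A {a. W (z + a) \<noteq> 0} * fibre_integral (\<lambda>x. (W x)\<^sup>2) z"
proof -
  have set: "{a. W (z + a) \<noteq> 0} \<in> sets borel" by measurable
  have "fibre_integral W z = (\<integral>\<^sup>+a. indicator {a. W (z + a) \<noteq> 0} a * W (z + a) \<partial>\<nu>A)"
    unfolding fibre_integral_def by (intro nn_integral_cong) (auto split: split_indicator)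
  moreover have "(\<integral>\<^sup>+a. (indicator {a. W (z + a) \<noteq> 0} a :: ennreal)\<^sup>2 \<partial>\<nu>A) = emeasure \<nu>A {a. W (z + a) \<noteq> 0}"
  proof -
    have "(indicator {a. W (z + a) \<noteq> 0} a :: ennreal)\<^sup>2 = indicator {a. W (z + a) \<noteq> 0} a" for a
      by (simp split: split_indicator)
    then show ?thesis using set by simp
  qed
  ultimately show ?thesis
    using Cauchy_Schwarz_nn_integral[of "indicator {a. W (z + a) \<noteq> 0}" \<nu>A "\<lambda>a. W (z + a)"] set
    by (simp add: fibre_integral_def)
qed

lemma fibre_integral_nonzero:
  assumes "fibre_integral W z \<noteq> 0" obtains a where "a \<in> A" "W (z + a) \<noteq> 0"
proof (rule ccontr)
  assume "\<not> thesis"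
  then have "\<forall>a\<in>A. W (z + a) = 0" using that by blast
  then have "fibre_integral W z = (\<integral>\<^sup>+a. 0 \<partial>\<nu>A)"
    unfolding fibre_integral_def using AE_fibre by (intro nn_integral_cong_AE) (auto elim: eventually_mono)
  with assms show False by simp
qed

text \<open>The substitutions \<open>g \<mapsto> g\<inverse>\<close> on \<open>G\<close> and \<open>x \<mapsto> x\<inverse>\<close> on \<open>E\<close> produce the same factor, by \<open>modular_projection\<close>.\<close>

lemma nn_integral_fibre_inverse:
  assumes [measurable]: "F \<in> borel_measurable borel"
  shows "(\<integral>\<^sup>+g. fibre_integral (\<lambda>x. F (- x)) (s (- g)) \<partial>\<nu>G) = weil_constant * (\<integral>\<^sup>+x. F x \<partial>\<nu>E)"
proof -
  let ?W = "\<lambda>x. F (- x)"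
  have "(\<integral>\<^sup>+g. fibre_integral ?W (s (- g)) \<partial>\<nu>G)
      = (\<integral>\<^sup>+g. ennreal (inverse (modular_function \<nu>G g)) * fibre_integral ?W (s g) \<partial>\<nu>G)"
    by (rule G.nn_integral_inverse') measurable
  also have "\<dots> = (\<integral>\<^sup>+g. fibre_integral (\<lambda>x. ennreal (inverse (modular_function \<nu>E x)) * ?W x) (s g) \<partial>\<nu>G)"
    by (subst fibre_integral_cmult_invariant) (auto simp: modular_projection)
  also have "\<dots> = weil_constant * (\<integral>\<^sup>+x. ennreal (inverse (modular_function \<nu>E x)) * ?W x \<partial>\<nu>E)"
    by (rule weil_formula) measurable
  also have "(\<integral>\<^sup>+x. ennreal (inverse (modular_function \<nu>E x)) * ?W x \<partial>\<nu>E) = (\<integral>\<^sup>+x. F x \<partial>\<nu>E)"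
    using E.nn_integral_inverse[of F] by (simp add: mult.commute)
  finally show ?thesis .
qed

text \<open>The bound on \<open>G\<close> is applied to the function \<open>h\<close> whose value at \<open>g\<close> is the fibre integral of
  \<open>x \<mapsto> |f(x\<inverse>)|\<close> over \<open>g\<inverse>\<close>. Its support lies in the projection of that of \<open>f\<close>, and \<open>B\<close> bounds the measure of the fibres of the support of \<open>f\<close>. The factor \<open>k\<close> enters three times on
  the left of \<open>convolution_fibrewise_bound\<close> and once in each of the squared norms of \<open>h\<close> and \<open>\<phi>\<close>.\<close>

lemma operator_norm_transfer:
  assumes RD: "\<And>h. h \<in> L2_functions \<nu>G \<Longrightarrow> compact (closure {x. h x \<noteq> 0}) \<Longrightarrow> closure {x. h x \<noteq> 0} \<subseteq> S \<Longrightarrow>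
      L2_operator_norm \<nu>G (right_convolution \<nu>G h) \<le> ennreal (c * L2_norm \<nu>G h)"
    and c: "0 \<le> c" and f: "f \<in> L2_functions \<nu>E" and supp: "compact (closure {x. f x \<noteq> 0})"
    and pS: "p ` closure {x. f x \<noteq> 0} \<subseteq> S"
    and B: "0 \<le> B" "\<And>z. emeasure \<nu>A {a. f (- (z + a)) \<noteq> 0} \<le> ennreal B"
    and k: "weil_constant = ennreal k"
  shows "L2_operator_norm \<nu>E (right_convolution \<nu>E f) \<le> ennreal (sqrt (B / k) * c * L2_norm \<nu>E f)"
proof (rule L2_operator_norm_leI)
  have k0: "k > 0" using k weil_constant_pos by (cases "k > 0") (auto simp: ennreal_neg)
  show "0 \<le> sqrt (B / k) * c * L2_norm \<nu>E f" using B c k0 by simp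
  fix g assume g: "g \<in> L2_functions \<nu>E"
  have gm[measurable]: "g \<in> borel_measurable borel" and fm[measurable]: "f \<in> borel_measurable borel"
    using f g by (auto simp: L2_functions_def)
  define H where "H x = ennreal (cmod (g x))" for x
  define W where "W x = ennreal (cmod (f (- x)))" for x
  have H[measurable]: "H \<in> borel_measurable borel" unfolding H_def[abs_def] by measurable
  have W[measurable]: "W \<in> borel_measurable borel" unfolding W_def[abs_def] by measurable
  have Hfin: "(\<integral>\<^sup>+x. (H x)\<^sup>2 \<partial>\<nu>E) < \<infinity>" using g by (simp add: L2_functions_iff H_def)
  define \<phi> where "\<phi> t = sqrt (enn2real (fibre_integral (\<lambda>x. (H x)\<^sup>2) (s t)))" for t
  define \<psi> where "\<psi> t = fibre_integral W (s t)" for t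
  define h where "h x = complex_of_real (enn2real (\<psi> (- x)))" for x
  have \<phi>m[measurable]: "\<phi> \<in> borel_measurable borel" unfolding \<phi>_def[abs_def] by measurable
  have \<psi>m[measurable]: "\<psi> \<in> borel_measurable borel" unfolding \<psi>_def[abs_def] by measurable
  have hm[measurable]: "h \<in> borel_measurable borel" unfolding h_def[abs_def] by measurable
  have \<phi>2: "(\<integral>\<^sup>+x. (ennreal (\<phi> x))\<^sup>2 \<partial>\<nu>G) \<le> weil_constant * (ennreal (L2_norm \<nu>E g))\<^sup>2"
  proof -
    have "(\<integral>\<^sup>+x. (ennreal (\<phi> x))\<^sup>2 \<partial>\<nu>G) \<le> (\<integral>\<^sup>+x. fibre_integral (\<lambda>x. (H x)\<^sup>2) (s x) \<partial>\<nu>G)"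
      by (intro nn_integral_mono) (simp add: \<phi>_def ennreal_power ennreal_enn2real_if)
    also have "\<dots> = weil_constant * (\<integral>\<^sup>+x. (H x)\<^sup>2 \<partial>\<nu>E)" by (rule weil_formula) simp
    finally show ?thesis by (simp add: ennreal_L2_norm[OF g] H_def)
  qed
  have \<psi>2: "(\<integral>\<^sup>+x. (\<psi> (- x))\<^sup>2 \<partial>\<nu>G) \<le> ennreal B * (weil_constant * (ennreal (L2_norm \<nu>E f))\<^sup>2)"
  proof -
    have "(\<integral>\<^sup>+x. (\<psi> (- x))\<^sup>2 \<partial>\<nu>G) \<le> (\<integral>\<^sup>+x. ennreal B * fibre_integral (\<lambda>x. (W x)\<^sup>2) (s (- x)) \<partial>\<nu>G)"
    proof (intro nn_integral_mono)
      fix x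
      have "(\<psi> (- x))\<^sup>2 \<le> emeasure \<nu>A {a. W (s (- x) + a) \<noteq> 0} * fibre_integral (\<lambda>x. (W x)\<^sup>2) (s (- x))"
        unfolding \<psi>_def by (rule fibre_integral_square_le) simp
      also have "\<dots> \<le> ennreal B * fibre_integral (\<lambda>x. (W x)\<^sup>2) (s (- x))"
        using B(2)[of "s (- x)"] by (intro mult_right_mono) (auto simp: W_def ennreal_eq_0_iff)
      finally show "(\<psi> (- x))\<^sup>2 \<le> ennreal B * fibre_integral (\<lambda>x. (W x)\<^sup>2) (s (- x))" .
    qed
    also have "\<dots> = ennreal B * (\<integral>\<^sup>+x. fibre_integral (\<lambda>x. (W x)\<^sup>2) (s (- x)) \<partial>\<nu>G)"
      by (rule nn_integral_cmult) measurable
    also have "(\<integral>\<^sup>+x. fibre_integral (\<lambda>x. (W x)\<^sup>2) (s (- x)) \<partial>\<nu>G) = weil_constant * (\<integral>\<^sup>+x. (ennreal (cmod (f x)))\<^sup>2 \<partial>\<nu>E)"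
      unfolding W_def by (rule nn_integral_fibre_inverse) measurable
    finally show ?thesis by (simp add: ennreal_L2_norm[OF f])
  qed
  have fin1: "(\<integral>\<^sup>+x. (ennreal (\<phi> x))\<^sup>2 \<partial>\<nu>G) < \<infinity>"
    using \<phi>2 by (rule order_le_less_trans) (simp add: k ennreal_mult_less_top ennreal_power)
  have fin2: "(\<integral>\<^sup>+x. (\<psi> (- x))\<^sup>2 \<partial>\<nu>G) < \<infinity>"
    using \<psi>2 by (rule order_le_less_trans) (simp add: k ennreal_mult_less_top ennreal_power)
  have pK: "compact (p ` closure {x. f x \<noteq> 0})"
    by (intro compact_continuous_image p_continuous supp)
  have supp': "x \<in> p ` closure {x. f x \<noteq> 0}" if nz: "\<psi> (- x) \<noteq> 0" for x
  proof -
    obtain a where a: "a \<in> A" "W (s (- x) + a) \<noteq> 0"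
      using nz unfolding \<psi>_def by (rule fibre_integral_nonzero)
    then have "f (- (s (- x) + a)) \<noteq> 0" by (auto simp: W_def)
    then have "- (s (- x) + a) \<in> {x. f x \<noteq> 0}" by simp
    then have mem: "- (s (- x) + a) \<in> closure {x. f x \<noteq> 0}" by (rule subsetD[OF closure_subset])
    have "x = p (- (s (- x) + a))" using a(1) by (simp add: A_iff)
    then show ?thesis using mem by (rule image_eqI[where f = p])
  qed
  have "{x. h x \<noteq> 0} \<subseteq> p ` closure {x. f x \<noteq> 0}"
  proof
    fix x assume "x \<in> {x. h x \<noteq> 0}"
    then have "\<psi> (- x) \<noteq> 0" by (auto simp: h_def)
    then show "x \<in> p ` closure {x. f x \<noteq> 0}" by (rule supp')
  qed
  then have cl: "closure {x. h x \<noteq> 0} \<subseteq> p ` closure {x. f x \<noteq> 0}"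
    using pK by (intro closure_minimal) (auto intro: compact_imp_closed)
  have h_norm: "ennreal (cmod (h x)) \<le> \<psi> (- x)" for x by (simp add: h_def ennreal_enn2real_if)
  have hint: "(\<integral>\<^sup>+x. (ennreal (cmod (h x)))\<^sup>2 \<partial>\<nu>G) \<le> (\<integral>\<^sup>+x. (\<psi> (- x))\<^sup>2 \<partial>\<nu>G)"
    by (intro nn_integral_mono power_mono h_norm) auto
  have hL2: "h \<in> L2_functions \<nu>G"
    using fin2 hint by (auto simp: L2_functions_iff order_le_less_trans)
  have \<phi>L2: "(\<lambda>x. complex_of_real (\<phi> x)) \<in> L2_functions \<nu>G"
    using fin1 by (simp add: L2_functions_iff) (simp add: \<phi>_def)
  have "L2_operator_norm \<nu>G (right_convolution \<nu>G h) \<le> ennreal (c * L2_norm \<nu>G h)"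
  proof (intro RD hL2)
    show "compact (closure {x. h x \<noteq> 0})"
      using compact_Int_closed[OF pK closed_closure, of "{x. h x \<noteq> 0}"] cl by (simp add: Int_absorb1)
    show "closure {x. h x \<noteq> 0} \<subseteq> S" using cl pS by (rule order_trans)
  qed
  from L2_operator_norm_leD[OF this _ \<phi>L2]
  have conv: "right_convolution \<nu>G h (\<lambda>x. complex_of_real (\<phi> x)) \<in> L2_functions \<nu>G"
    "L2_norm \<nu>G (right_convolution \<nu>G h (\<lambda>x. complex_of_real (\<phi> x))) \<le> c * L2_norm \<nu>G h * L2_norm \<nu>G (\<lambda>x. complex_of_real (\<phi> x))"
    using c by auto
  have hn: "L2_norm \<nu>G h \<le> sqrt (B * k) * L2_norm \<nu>E f"
    using order_trans[OF hint \<psi>2] B k0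
    by (intro L2_norm_leI hL2) (auto simp: k ennreal_power ennreal_mult[symmetric] power_mult_distrib mult_ac)
  have \<phi>n: "L2_norm \<nu>G (\<lambda>x. complex_of_real (\<phi> x)) \<le> sqrt k * L2_norm \<nu>E g"
  proof (rule L2_norm_leI[OF \<phi>L2])
    have "ennreal (cmod (complex_of_real (\<phi> x))) = ennreal (\<phi> x)" for x by (simp add: \<phi>_def)
    then show "(\<integral>\<^sup>+x. (ennreal (cmod (complex_of_real (\<phi> x))))\<^sup>2 \<partial>\<nu>G) \<le> (ennreal (sqrt k * L2_norm \<nu>E g))\<^sup>2"
      using \<phi>2 k0 by (simp add: k ennreal_power ennreal_mult[symmetric] power_mult_distrib)
  qed (use k0 in simp)
  have conv_eq: "ennreal (cmod (right_convolution \<nu>G h (\<lambda>x. complex_of_real (\<phi> x)) t))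
      = (\<integral>\<^sup>+y. fibre_norm H (s (t + y)) * fibre_integral W (s y) \<partial>\<nu>G)" for t
    using G.right_convolution_nonneg[OF \<phi>m \<psi>m _ fin1 fin2 pK supp', of t]
    by (simp add: h_def[abs_def] \<phi>_def fibre_norm_def \<psi>_def)
  define C where "C = c * (sqrt (B * k) * L2_norm \<nu>E f) * (sqrt k * L2_norm \<nu>E g)"
  have "c * L2_norm \<nu>G h * L2_norm \<nu>G (\<lambda>x. complex_of_real (\<phi> x)) \<le> C"
    unfolding C_def using hn \<phi>n c B k0 by (intro mult_mono mult_left_mono) auto
  with conv(2) have le_C: "L2_norm \<nu>G (right_convolution \<nu>G h (\<lambda>x. complex_of_real (\<phi> x))) \<le> C" by simp
  let ?T = "\<lambda>x. \<integral>\<^sup>+y. H (x + y) * W y \<partial>\<nu>E"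
  have "weil_constant ^ 3 * (\<integral>\<^sup>+x. (?T x)\<^sup>2 \<partial>\<nu>E)
      \<le> (\<integral>\<^sup>+t. (ennreal (cmod (right_convolution \<nu>G h (\<lambda>x. complex_of_real (\<phi> x)) t)))\<^sup>2 \<partial>\<nu>G)"
    unfolding conv_eq by (rule convolution_fibrewise_bound[OF H W Hfin])
  also have "\<dots> = (ennreal (L2_norm \<nu>G (right_convolution \<nu>G h (\<lambda>x. complex_of_real (\<phi> x)))))\<^sup>2"
    by (rule ennreal_L2_norm[OF conv(1), symmetric])
  also have "\<dots> \<le> (ennreal C)\<^sup>2" using le_C by (intro power_mono ennreal_leI) auto
  finally have T_bound: "weil_constant ^ 3 * (\<integral>\<^sup>+x. (?T x)\<^sup>2 \<partial>\<nu>E) \<le> (ennreal C)\<^sup>2" .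
  define D where "D = sqrt (B / k) * c * L2_norm \<nu>E f * L2_norm \<nu>E g"
  have D0: "0 \<le> D" unfolding D_def using B k0 c by simp
  have CD: "C\<^sup>2 = k ^ 3 * D\<^sup>2"
    using k0 B by (simp add: C_def D_def power_mult_distrib real_sqrt_pow2 power3_eq_cube power2_eq_square[of k] field_simps)
  have "ennreal (k ^ 3) * (\<integral>\<^sup>+x. (?T x)\<^sup>2 \<partial>\<nu>E) \<le> ennreal (k ^ 3) * (ennreal D)\<^sup>2"
    using T_bound k0 D0 CD by (simp add: k ennreal_power ennreal_mult[symmetric] C_def B c)
  then have T_le: "(\<integral>\<^sup>+x. (?T x)\<^sup>2 \<partial>\<nu>E) \<le> (ennreal D)\<^sup>2"
    using k0 by (subst (asm) ennreal_mult_le_mult_iff) auto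
  have "(\<integral>\<^sup>+x. (ennreal (cmod (right_convolution \<nu>E f g x)))\<^sup>2 \<partial>\<nu>E) \<le> (\<integral>\<^sup>+x. (?T x)\<^sup>2 \<partial>\<nu>E)"
    unfolding H_def W_def by (intro nn_integral_mono power_mono E.norm_right_convolution_le) auto
  also note T_le
  finally have bound: "(\<integral>\<^sup>+x. (ennreal (cmod (right_convolution \<nu>E f g x)))\<^sup>2 \<partial>\<nu>E) \<le> (ennreal D)\<^sup>2" .
  note bound
  also have "(ennreal D)\<^sup>2 < \<infinity>" using D0 by (simp add: ennreal_power)
  finally have "right_convolution \<nu>E f g \<in> L2_functions \<nu>E"
    unfolding L2_functions_iff
    using E.right_convolution_measurable[OF fm gm] by simp
  then show "right_convolution \<nu>E f g \<in> L2_functions \<nu>E \<and>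
      L2_norm \<nu>E (right_convolution \<nu>E f g) \<le> sqrt (B / k) * c * L2_norm \<nu>E f * L2_norm \<nu>E g"
    using L2_norm_leI[OF _ D0 bound] by (simp add: D_def)
qed

end

section \<open>Words in a generating set and their growth\<close>

lemma compact_word_power: "compact K \<Longrightarrow> compact (set_word_power K n)"
  for K :: "'a::topological_group_add set"
  by (induction n) (auto intro: compact_plus_group)

lemma word_power_add:
  fixes K :: "'a::monoid_add set"
  assumes "x \<in> set_word_power K m" "y \<in> set_word_power K n"
  shows "x + y \<in> set_word_power K (m + n)"
  using assms(2)
proof (induction n arbitrary: y)
  case 0
  then show ?case using assms(1) by simp
next
  case (Suc n)
  then obtain y' k where y: "y = y' + k" "y' \<in> set_word_power K n" "k \<in> K" by auto
  then have "x + y' \<in> set_word_power K (m + n)" using Suc.IH by blast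
  moreover have "x + y = (x + y') + k" by (simp add: y add.assoc)
  ultimately show ?case using y(3) by auto
qed

lemma word_power_1: "x \<in> K \<Longrightarrow> x \<in> set_word_power K 1" for K :: "'a::monoid_add set"
  by (auto intro!: exI[of _ 0])

lemma word_power_zero: "0 \<in> K \<Longrightarrow> 0 \<in> set_word_power K n" for K :: "'a::monoid_add set"
  by (induction n) (auto intro!: exI[of _ 0])

lemma word_power_mono_exponent:
  fixes K :: "'a::monoid_add set"
  assumes "0 \<in> K" "m \<le> n" "x \<in> set_word_power K m" shows "x \<in> set_word_power K n"
  using word_power_add[OF assms(3) word_power_zero[OF assms(1), of "n - m"]] assms(2) by simp

lemma word_power_mono:
  fixes K :: "'a::monoid_add set"
  assumes "K \<subseteq> T" shows "set_word_power K n \<subseteq> set_word_power T n"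
proof (induction n)
  case (Suc n)
  then show ?case using assms by fastforce
qed simp

lemma word_power_uminus:
  fixes K :: "'a::group_add set"
  assumes K: "uminus ` K = K" and "x \<in> set_word_power K n"
  shows "- x \<in> set_word_power K n"
  using assms(2)
proof (induction n arbitrary: x)
  case (Suc n)
  then obtain y k where x: "x = y + k" "y \<in> set_word_power K n" "k \<in> K" by auto
  have "- k \<in> set_word_power K 1" using K x(3) by (intro word_power_1) blast
  from word_power_add[OF this Suc.IH[OF x(2)]] show ?case by (simp add: x(1) minus_add)
qed simp

lemma word_power_insert_zeroD:
  fixes K :: "'a::monoid_add set"
  assumes "x \<in> set_word_power (insert 0 K) n" shows "\<exists>k\<le>n. x \<in> set_word_power K k"
  using assms
proof (induction n arbitrary: x)
  case (Suc n)
  then obtain y k where x: "x = y + k" "y \<in> set_word_power (insert 0 K) n" "k \<in> insert 0 K" by auto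
  from Suc.IH[OF x(2)] obtain j where j: "j \<le> n" "y \<in> set_word_power K j" by blast
  show ?case
  proof (cases "k = 0")
    case True
    then show ?thesis using j x by (intro exI[of _ j]) auto
  next
    case False
    then have "x \<in> set_word_power K (Suc j)" using j x by auto
    then show ?thesis using j by (intro exI[of _ "Suc j"]) auto
  qed
qed simp

lemma algebraic_length_le:
  assumes "x \<in> set_word_power K n" shows "algebraic_length K x \<le> n"
  unfolding algebraic_length_def using assms by (intro cInf_lower) auto

lemma algebraic_length_word:
  assumes "x \<in> (\<Union>n. set_word_power K n)" shows "x \<in> set_word_power K (algebraic_length K x)"
proof -
  have "algebraic_length K x \<in> {n. x \<in> set_word_power K n}"
    unfolding algebraic_length_def using assms by (intro Inf_nat_def1) auto
  then show ?thesis by simp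
qed

lemma algebraic_length_le_iff:
  assumes "x \<in> (\<Union>n. set_word_power K n)"
  shows "algebraic_length K x \<le> n \<longleftrightarrow> x \<in> set_word_power (insert 0 K) n"
proof
  assume le: "algebraic_length K x \<le> n"
  have "x \<in> set_word_power (insert 0 K) (algebraic_length K x)"
    using subsetD[OF word_power_mono[OF subset_insertI] algebraic_length_word[OF assms]] .
  from word_power_mono_exponent[OF insertI1 le this] show "x \<in> set_word_power (insert 0 K) n" .
next
  assume "x \<in> set_word_power (insert 0 K) n"
  from word_power_insert_zeroD[OF this] obtain k where "k \<le> n" "x \<in> set_word_power K k" by blast
  then show "algebraic_length K x \<le> n" using algebraic_length_le[of x K k] by simp
qed

lemma word_power_subset_generated: "0 \<in> K \<Longrightarrow> K \<subseteq> (\<Union>n. set_word_power K n)" for K :: "'a::monoid_add set"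
  using word_power_1[of _ K] by blast

text \<open>The compact set \<open>C\<close> is covered by finitely many translates of \<open>V\<close>. The condition on \<open>V\<close> refers to the
  subgroup generated by \<open>K\<close>, so that the lemma applies to \<open>A\<close> inside \<open>E\<close> as well as to whole groups.\<close>

lemma compact_subset_word_power:
  fixes K C V :: "'a::topological_group_add set"
  assumes sym: "uminus ` K = K" and zero: "0 \<in> K"
    and V: "open V" "0 \<in> V" "V \<inter> (\<Union>n. set_word_power K n) \<subseteq> set_word_power K m"
    and C: "compact C" "C \<subseteq> (\<Union>n. set_word_power K n)"
  shows "\<exists>N. C \<subseteq> set_word_power K N"
proof -
  obtain D where D: "D \<subseteq> C" "finite D" "C \<subseteq> (\<Union>c\<in>D. {y. - c + y \<in> V})"
  proof (rule compactE_image[OF C(1), of C "\<lambda>c. {y. - c + y \<in> V}"])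
    show "C \<subseteq> (\<Union>c\<in>C. {y. - c + y \<in> V})" using V by auto
  qed (use open_plus_left[OF V(1)] in auto)
  have "\<forall>c. \<exists>n. c \<in> C \<longrightarrow> c \<in> set_word_power K n" using C(2) by blast
  from choice[OF this] obtain n where n: "\<forall>c. c \<in> C \<longrightarrow> c \<in> set_word_power K (n c)" ..
  define N where "N = (\<Sum>c\<in>D. n c) + m"
  have "C \<subseteq> set_word_power K N"
  proof
    fix y assume y: "y \<in> C"
    then obtain c where c: "c \<in> D" "- c + y \<in> V" using D(3) by auto
    have cK: "c \<in> set_word_power K (n c)" and yK: "y \<in> set_word_power K (n y)" using n c D(1) y by auto
    have "- c + y \<in> set_word_power K (n c + n y)"
      by (rule word_power_add[OF word_power_uminus[OF sym cK] yK])
    then have "- c + y \<in> set_word_power K m" using V(3) c(2) by blast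
    from word_power_add[OF cK this] have "y \<in> set_word_power K (n c + m)" by (simp add: add.assoc[symmetric])
    moreover have "n c + m \<le> N" unfolding N_def using D(2) c(1) by (simp add: member_le_sum)
    ultimately show "y \<in> set_word_power K N" using zero word_power_mono_exponent by blast
  qed
  then show ?thesis ..
qed

text \<open>A compact generating set need not be a neighbourhood of the neutral element. But the group is the union of
  the closed sets \<open>K\<^sup>n\<close>, so by Baire's theorem one of them has an interior point \<open>x\<close>, and \<open>x\<inverse> K\<^sup>n\<close> is a neighbourhood
  contained in \<open>K\<^sup>2\<^sup>n\<close>.\<close>

lemma generating_set_contains_nhd:
  fixes K K0 W :: "'a::{topological_group_add, t2_space} set"
  assumes K: "compact K" "uminus ` K = K" "0 \<in> K" "(\<Union>n. set_word_power K n) = UNIV"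
    and W: "open W" "0 \<in> W" "W \<subseteq> K0" "compact K0"
  shows "\<exists>V m. open V \<and> 0 \<in> V \<and> V \<subseteq> set_word_power K m"
proof -
  have lc: "locally_compact_space (euclidean :: 'a topology)"
    unfolding locally_compact_space_def
  proof (intro ballI)
    fix x :: 'a
    have "x \<in> {y. - x + y \<in> W}" using W by simp
    moreover have "{y. - x + y \<in> W} \<subseteq> (\<lambda>y. x + y) ` K0"
    proof
      fix y assume "y \<in> {y. - x + y \<in> W}"
      then show "y \<in> (\<lambda>y. x + y) ` K0" using W by (intro image_eqI[of _ _ "- x + y"]) (auto simp: add.assoc[symmetric])
    qed
    moreover have "compact ((\<lambda>y. x + y) ` K0)" using W by (intro compact_continuous_image continuous_intros)
    ultimately show "\<exists>U C. openin euclidean U \<and> compactin euclidean C \<and> x \<in> U \<and> U \<subseteq> C"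
      using open_plus_left[OF W(1), of "- x"] by (intro exI[of _ "{y. - x + y \<in> W}"] exI[of _ "(\<lambda>y. x + y) ` K0"]) auto
  qed
  have haus: "Hausdorff_space (euclidean :: 'a topology)"
    using hausdorff by (simp add: Hausdorff_space_def disjnt_def) blast
  have "\<exists>n. interior (set_word_power K n) \<noteq> {}"
  proof (rule ccontr)
    assume "\<not> ?thesis"
    then have emp: "interior (set_word_power K n) = {}" for n by blast
    have "euclidean interior_of \<Union> (range (set_word_power K)) = {}"
    proof (rule Baire_category_alt)
      show "completely_metrizable_space euclidean \<or> locally_compact_space (euclidean :: 'a topology) \<and> regular_space (euclidean :: 'a topology)"
        using lc locally_compact_Hausdorff_imp_regular_space[OF lc haus] by simp
      fix T assume "T \<in> range (set_word_power K)"
      then show "closedin euclidean T \<and> euclidean interior_of T = {}"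
        using emp compact_word_power[OF K(1)] by (auto intro: compact_imp_closed)
    qed simp
    then show False using K(4) by simp
  qed
  then obtain n x where x: "x \<in> interior (set_word_power K n)" by blast
  have "{y. x + y \<in> interior (set_word_power K n)} \<subseteq> set_word_power K (n + n)"
  proof
    fix y assume "y \<in> {y. x + y \<in> interior (set_word_power K n)}"
    then have "x + y \<in> interior (set_word_power K n)" by simp
    then have "x + y \<in> set_word_power K n" by (rule subsetD[OF interior_subset])
    moreover have "- x \<in> set_word_power K n"
      by (rule word_power_uminus[OF K(2) subsetD[OF interior_subset x]])
    ultimately have "- x + (x + y) \<in> set_word_power K (n + n)" by (intro word_power_add)
    then show "y \<in> set_word_power K (n + n)" by (simp add: add.assoc[symmetric])
  qed
  moreover have "open {y. x + y \<in> interior (set_word_power K n)}" by (rule open_plus_left) simp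
  moreover have "0 \<in> {y. x + y \<in> interior (set_word_power K n)}" using x by simp
  ultimately show ?thesis by (intro exI[of _ "{y. x + y \<in> interior (set_word_power K n)}"] exI[of _ "n + n"]) simp
qed

lemma symmetric_insert_zero: "uminus ` K = K \<Longrightarrow> uminus ` insert 0 K = insert (0::'a::group_add) K"
  by simp

lemma generated_insert_zero:
  fixes K :: "'a::monoid_add set"
  shows "(\<Union>n. set_word_power (insert 0 K) n) = (\<Union>n. set_word_power K n)"
  using word_power_insert_zeroD[of _ K] word_power_mono[of K "insert 0 K"] by (fastforce simp: subset_eq)

lemma algebraic_length_function:
  fixes K :: "'a::{topological_group_add, t2_space} set"
  assumes K: "compact K" "uminus ` K = K" "0 \<in> K" "(\<Union>n. set_word_power K n) = UNIV"
  shows "length_function (\<lambda>g. real (algebraic_length K g))"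
proof -
  have ball: "algebraic_length K x \<le> n \<longleftrightarrow> x \<in> set_word_power K n" for x n
    using algebraic_length_le_iff[of x K n] K by (simp add: insert_absorb)
  have word: "x \<in> set_word_power K (algebraic_length K x)" for x
    using ball[of x "algebraic_length K x"] by simp
  show ?thesis
    unfolding length_function_def
  proof (intro conjI allI)
    show "(\<lambda>g. real (algebraic_length K g)) \<in> borel_measurable borel"
    proof (rule borel_measurableI_le)
      fix y :: real
      have "{x. real (algebraic_length K x) \<le> y} = (if y < 0 then {} else set_word_power K (nat \<lfloor>y\<rfloor>))"
        using ball[of _ "nat \<lfloor>y\<rfloor>"] by (auto simp: le_nat_floor intro: order_less_le_trans) (simp_all add: le_nat_iff le_floor_iff)
      then show "{x \<in> space borel. real (algebraic_length K x) \<le> y} \<in> sets borel"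
        using borel_compact[OF compact_word_power[OF K(1)]] by simp
    qed
    show "real (algebraic_length K 0) = 0"
      using ball[of 0 0] by simp
    fix g h
    show "real (algebraic_length K (g + h)) \<le> real (algebraic_length K g) + real (algebraic_length K h)"
      using algebraic_length_le[OF word_power_add[OF word word], of g h] by simp
    have le: "algebraic_length K (- g) \<le> algebraic_length K g" for g
      by (rule algebraic_length_le[OF word_power_uminus[OF K(2) word]])
    show "real (algebraic_length K (- g)) = real (algebraic_length K g)"
      using le[of g] le[of "- g"] by simp
  qed simp
qed

text \<open>A word in commuting letters is determined by the multiplicities of its letters. The induction on \<open>F\<close> splits off
  the power \<open>m k\<close> of one letter \<open>f\<close>.\<close>

lemma card_commuting_words:
  fixes F :: "'a::group_add set"
  assumes F: "finite F" "F \<subseteq> A" and A: "0 \<in> A" "\<And>x y. x \<in> A \<Longrightarrow> y \<in> A \<Longrightarrow> x + y \<in> A"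
    and comm: "\<And>x y. x \<in> A \<Longrightarrow> y \<in> A \<Longrightarrow> x + y = y + x"
  shows "finite (set_word_power (insert 0 F) n) \<and> card (set_word_power (insert 0 F) n) \<le> (n + 1) ^ card F"
  using F
proof (induction F)
  case empty
  have "set_word_power {0} n = {0::'a}" by (induction n) auto
  then show ?case by simp
next
  case (insert f F)
  define S where "S n = set_word_power (insert 0 F) n" for n
  define m where "m k = (((+) f) ^^ k) 0" for k
  have subA: "set_word_power (insert 0 F) n \<subseteq> A" for n
    using insert.prems A by (induction n) auto
  have fA: "f \<in> A" using insert.prems by simp
  have mono: "S j \<subseteq> S k" if "j \<le> k" for j k
    unfolding S_def using that by (auto intro: word_power_mono_exponent)
  have sub: "set_word_power (insert 0 (insert f F)) n \<subseteq> (\<lambda>(k, x). m k + x) ` ({..n} \<times> S n)" for n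
  proof (induction n)
    case 0
    then show ?case by (auto simp: S_def m_def image_iff)
  next
    case (Suc n)
    show ?case
    proof
      fix z assume "z \<in> set_word_power (insert 0 (insert f F)) (Suc n)"
      then obtain z' y where z: "z = z' + y" "z' \<in> set_word_power (insert 0 (insert f F)) n" "y \<in> insert 0 (insert f F)"
        by auto
      then obtain k x where kx: "k \<le> n" "x \<in> S n" "z' = m k + x" using Suc.IH by auto
      show "z \<in> (\<lambda>(k, x). m k + x) ` ({..Suc n} \<times> S (Suc n))"
      proof (cases "y = f")
        case True
        have xA: "x \<in> A" using subA kx(2) unfolding S_def by blast
        have mk: "m k + f = m (Suc k)" for k
        proof (induction k)
          case (Suc k)
          then show ?case by (simp add: m_def add.assoc)
        qed (simp add: m_def)
        have "z = m (Suc k) + x" using comm[OF xA fA] by (simp add: z kx True add.assoc mk[symmetric])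
        then show ?thesis using kx mono[of n "Suc n"] by (intro image_eqI[of _ _ "(Suc k, x)"]) auto
      next
        case False
        then have "x + y \<in> S (Suc n)" using kx z(3) by (auto simp: S_def)
        then show ?thesis using kx by (intro image_eqI[of _ _ "(k, x + y)"]) (auto simp: z add.assoc)
      qed
    qed
  qed
  have IH: "finite (S n)" "card (S n) \<le> (n + 1) ^ card F"
    using insert by (auto simp: S_def)
  have "card (set_word_power (insert 0 (insert f F)) n) \<le> card ({..n} \<times> S n)"
    using sub[of n] IH(1) by (meson card_image_le card_mono finite_SigmaI finite_atMost finite_imageI order_trans)
  also have "\<dots> \<le> (n + 1) * (n + 1) ^ card F" using mult_le_mono2[OF IH(2), of "n + 1"] by (simp add: card_cartesian_product)
  finally have "card (set_word_power (insert 0 (insert f F)) n) \<le> (n + 1) ^ card (insert f F)"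
    using insert.hyps by simp
  moreover have "finite (set_word_power (insert 0 (insert f F)) n)"
    using sub[of n] IH(1) by (meson finite_SigmaI finite_atMost finite_imageI finite_subset)
  ultimately show ?case by blast
qed

text \<open>If \<open>KK \<subseteq> FK\<close>, then each further factor of \<open>K\<close> can be exchanged for one of \<open>F\<close>.\<close>

lemma word_power_covering:
  fixes K F :: "'a::monoid_add set"
  assumes F: "\<And>x y. x \<in> K \<Longrightarrow> y \<in> K \<Longrightarrow> \<exists>f\<in>F. \<exists>k\<in>K. x + y = f + k"
    and "x \<in> set_word_power K (Suc n)"
  shows "\<exists>f\<in>set_word_power (insert 0 F) n. \<exists>k\<in>K. x = f + k"
  using assms(2)
proof (induction n arbitrary: x)
  case (Suc n)
  then obtain y k where x: "x = y + k" "y \<in> set_word_power K (Suc n)" "k \<in> K" by auto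
  from Suc.IH[OF x(2)] obtain f l where fl: "f \<in> set_word_power (insert 0 F) n" "l \<in> K" "y = f + l" by blast
  from F[OF fl(2) x(3)] obtain g j where gj: "g \<in> F" "j \<in> K" "l + k = g + j" by blast
  have "x = (f + g) + j" by (simp add: x(1) fl(3) add.assoc gj(3))
  moreover have "f + g \<in> set_word_power (insert 0 F) (Suc n)" using fl(1) gj(1) by auto
  ultimately show ?case using gj(2) by blast
qed auto

lemma poly_power_bound:
  fixes P :: "real poly"
  obtains c e where "c \<ge> 0" "\<And>x. x \<ge> 1 \<Longrightarrow> poly P x \<le> c * x ^ e"
proof -
  have "\<exists>c\<ge>0. \<exists>e. \<forall>x\<ge>1. poly P x \<le> c * x ^ e"
  proof (induction P)
    case 0
    then show ?case by (intro exI[of _ 0]) auto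
  next
    case (pCons a P)
    then obtain c e where ce: "c \<ge> 0" "\<forall>x\<ge>1. poly P x \<le> c * x ^ e" by blast
    have "poly (pCons a P) x \<le> (\<bar>a\<bar> + c) * x ^ Suc e" if "x \<ge> 1" for x
    proof -
      have "1 \<le> x ^ Suc e" using that by (rule one_le_power)
      then have "a \<le> \<bar>a\<bar> * x ^ Suc e"
        using mult_left_mono[of 1 "x ^ Suc e" "\<bar>a\<bar>"] by linarith
      moreover have "x * poly P x \<le> x * (c * x ^ e)" using that ce(2) by (intro mult_left_mono) auto
      ultimately show ?thesis by (simp add: algebra_simps)
    qed
    then show ?case using ce(1) by (intro exI[of _ "\<bar>a\<bar> + c"] conjI exI[of _ "Suc e"] allI impI) simp_all
  qed
  then show ?thesis using that by blast
qed

section \<open>Word length in the extension\<close>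

lemma (in central_extension) fibre_measure_translate:
  assumes f: "f \<in> A" and B[measurable]: "B \<in> sets borel"
  shows "emeasure \<nu>A {x. - f + x \<in> B} = emeasure \<nu>A B" "{x. - f + x \<in> B} \<in> sets borel"
proof -
  have fA: "- f \<in> A" using f by (simp add: A_iff)
  show s: "{x. - f + x \<in> B} \<in> sets borel" by measurable
  have "(\<lambda>x. indicator B (- f + x) :: ennreal) = indicator {x. - f + x \<in> B}"
    by (auto simp: indicator_def)
  then show "emeasure \<nu>A {x. - f + x \<in> B} = emeasure \<nu>A B"
    using fibre_invariant[of "indicator B" "- f"] fA s by simp
qed

text \<open>Finitely many translates of \<open>K\<close> cover the compact set \<open>KK\<close>, and the translating elements commute. So \<open>K\<^sup>n\<close> is
  covered by polynomially many translates of \<open>K\<close>.\<close>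

lemma (in central_extension) fibre_word_growth:
  assumes K: "compact K" "K \<subseteq> A" and V: "open V" "0 \<in> V" "V \<inter> A \<subseteq> K"
  obtains m d where "m \<ge> 0" "\<And>n. emeasure \<nu>A (set_word_power K n) \<le> ennreal (m * (real n + 1) ^ d)"
proof -
  have zero_A: "0 \<in> A" by (simp add: A_iff)
  then have zero: "0 \<in> K" using V by blast
  define T where "T = {x + y | x y. x \<in> K \<and> y \<in> K}"
  have T: "compact T" unfolding T_def by (intro compact_plus_group K)
  have TA: "T \<subseteq> A" using K(2) by (auto simp: T_def A_iff subset_eq)
  obtain F where F: "F \<subseteq> T" "finite F" "T \<subseteq> (\<Union>f\<in>F. {y. - f + y \<in> V})"
  proof (rule compactE_image[OF T, of T "\<lambda>f. {y. - f + y \<in> V}"])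
    show "T \<subseteq> (\<Union>f\<in>T. {y. - f + y \<in> V})" using V by auto
  qed (use open_plus_left[OF V(1)] in auto)
  have FA: "F \<subseteq> A" using F TA by blast
  have cover: "\<exists>f\<in>F. \<exists>k\<in>K. x + y = f + k" if xy: "x \<in> K" "y \<in> K" for x y
  proof -
    have t: "x + y \<in> T" using xy unfolding T_def by blast
    then obtain f where f: "f \<in> F" "- f + (x + y) \<in> V" using subsetD[OF F(3) t] by auto
    have "- f + (x + y) \<in> A" using f(1) FA t TA by (auto simp: A_iff subset_eq)
    then have "- f + (x + y) \<in> K" using f(2) V(3) by blast
    moreover have "x + y = f + (- f + (x + y))" by (simp add: add.assoc[symmetric])
    ultimately show ?thesis using f(1) by blast
  qed
  obtain m where m: "emeasure \<nu>A K = ennreal m" "m \<ge> 0"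
    using fibre_compact_finite[OF K(1)] by (cases "emeasure \<nu>A K") auto
  have Ks: "K \<in> sets borel" using K by (simp add: borel_compact)
  have "emeasure \<nu>A (set_word_power K n) \<le> ennreal (m * (real n + 1) ^ card F)" for n
  proof -
    define S where "S = set_word_power (insert 0 F) n"
    have S: "finite S" "card S \<le> (n + 1) ^ card F"
      unfolding S_def using card_commuting_words[OF F(2) FA zero_A, of n] A_commute by (auto simp: A_iff)
    have SA: "S \<subseteq> A" unfolding S_def using FA by (induction n) (auto simp: A_iff subset_eq)
    have "set_word_power K n \<subseteq> (\<Union>f\<in>S. {x. - f + x \<in> K})"
    proof
      fix x assume "x \<in> set_word_power K n"
      then have "x \<in> set_word_power K (Suc n)" by (rule word_power_mono_exponent[OF zero, rotated]) simp
      from word_power_covering[OF cover this] obtain f k where "f \<in> S" "k \<in> K" "x = f + k"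
        unfolding S_def by blast
      then show "x \<in> (\<Union>f\<in>S. {x. - f + x \<in> K})" by (intro UN_I[of f]) (auto simp: add.assoc[symmetric])
    qed
    then have "emeasure \<nu>A (set_word_power K n) \<le> emeasure \<nu>A (\<Union>f\<in>S. {x. - f + x \<in> K})"
      using S SA fibre_measure_translate(2)[OF _ Ks] by (intro emeasure_mono) auto
    also have "\<dots> \<le> (\<Sum>f\<in>S. emeasure \<nu>A {x. - f + x \<in> K})"
      using S SA fibre_measure_translate(2)[OF _ Ks] by (intro emeasure_subadditive_finite) auto
    also have "\<dots> = (\<Sum>f\<in>S. ennreal m)"
      using fibre_measure_translate(1)[OF _ Ks] SA by (intro sum.cong) (auto simp: m)
    also have "\<dots> = ennreal (m * real (card S))" using m by (simp add: ennreal_mult ennreal_of_nat_eq_real_of_nat mult.commute)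
    also have "\<dots> \<le> ennreal (m * (real n + 1) ^ card F)"
    proof (intro ennreal_leI mult_left_mono m(2))
      have "real (card S) \<le> real ((n + 1) ^ card F)" using S(2) by (rule of_nat_mono)
      then show "real (card S) \<le> (real n + 1) ^ card F" by (simp add: add.commute)
    qed
    finally show ?thesis .
  qed
  then show ?thesis using m(2) that by blast
qed

text \<open>The growth of the cocycle is expressed by powers of sets that contain the neutral element, so that balls are
  powers. The set \<open>K1\<close> generates \<open>A\<close> and is a neighbourhood of the neutral element in \<open>A\<close>; the number \<open>n0\<close> bounds the
  length on \<open>U\<close> with respect to \<open>KG\<close>.\<close>

locale polynomial_extension = central_extension \<nu>E \<nu>G A p s U
  for \<nu>E :: "'e::{topological_group_add, t2_space} measure"
    and \<nu>G :: "'g::{topological_group_add, t2_space} measure"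
    and A :: "'e set" and p :: "'e \<Rightarrow> 'g" and s :: "'g \<Rightarrow> 'e" and U :: "'g set" +
  fixes K1 :: "'e set" and V :: "'e set" and KG :: "'g set" and Gr :: "nat \<Rightarrow> nat" and n0 :: nat
  assumes s_zero: "s 0 = 0"
    and gen_U: "(\<Union>n. set_word_power U n) = UNIV"
    and compact_K1: "compact K1" and sym_K1: "uminus ` K1 = K1" and zero_K1: "0 \<in> K1"
    and gen_K1: "(\<Union>n. set_word_power K1 n) = A"
    and V: "open V" "0 \<in> V" "V \<inter> A \<subseteq> K1"
    and zero_KG: "0 \<in> KG" and n0_pos: "1 \<le> n0"
    and U_KG: "U \<subseteq> set_word_power KG n0"
    and growth: "\<And>n g h. g \<in> set_word_power KG n \<Longrightarrow> h \<in> set_word_power KG n \<Longrightarrow>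
      section_cocycle s g h \<in> set_word_power K1 (Gr n)"
begin

definition KE :: "'e set" where
  "KE = K1 \<union> s ` U \<union> uminus ` s ` U"

lemma K1_KE: "K1 \<subseteq> KE" by (auto simp: KE_def)

lemma zero_KE: "0 \<in> KE" using zero_K1 by (simp add: KE_def)

lemma compact_KE: "compact KE"
  unfolding KE_def by (intro compact_Un compact_K1 compact_sU compact_continuous_image continuous_intros)

lemma sym_KE: "uminus ` KE = KE"
  unfolding KE_def image_Un sym_K1 by (auto simp: image_image)

lemma K1_A: "K1 \<subseteq> A"
  using word_power_subset_generated[OF zero_K1] gen_K1 by simp

lemma K1_words_A: "set_word_power K1 n \<subseteq> A"
  using gen_K1 by blast

lemma U_uminus: "u \<in> U \<Longrightarrow> - u \<in> U"
  using symmetric_U by (metis image_eqI)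

lemma cocycle_eq: "s g + s h = section_cocycle s g h + s (g + h)"
  by (simp add: section_cocycle_def)

lemma zero_U: "0 \<in> U"
  using nhd_U interior_subset by blast

text \<open>Only the generators \<open>s(u)\<inverse>\<close> need an argument: \<open>s(u)\<inverse> = c(u, u\<inverse>)\<inverse> s(u\<inverse>)\<close>, because \<open>s(1) = 1\<close>.\<close>

lemma KE_decomposition:
  assumes "x \<in> KE"
  shows "\<exists>a\<in>set_word_power K1 (1 + Gr n0). \<exists>u\<in>U. x = a + s u"
proof -
  consider "x \<in> K1" | u where "u \<in> U" "x = s u" | u where "u \<in> U" "x = - s u"
    using assms by (auto simp: KE_def)
  then show ?thesis
  proof cases
    case 1
    then have "x \<in> set_word_power K1 (1 + Gr n0)"
      by (intro word_power_mono_exponent[OF zero_K1 _ word_power_1]) auto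
    then show ?thesis using zero_U s_zero by (intro bexI[of _ x] bexI[of _ 0]) auto
  next
    case 2
    then show ?thesis by (intro bexI[of _ 0] bexI[of _ u] word_power_zero zero_K1) auto
  next
    case 3
    let ?c = "section_cocycle s u (- u)"
    have "?c \<in> set_word_power K1 (Gr n0)"
      using 3(1) U_uminus U_KG by (intro growth) auto
    then have c: "- ?c \<in> set_word_power K1 (Gr n0)" by (rule word_power_uminus[OF sym_K1])
    have "s u + s (- u) = ?c" using cocycle_eq[of u "- u"] s_zero by simp
    then have "- s u = s (- u) + - ?c"
      by (metis add.assoc add.right_inverse add_0_right add_left_imp_eq minus_add_cancel)
    also have "\<dots> = - ?c + s (- u)"
      using c K1_words_A by (intro A_commute[symmetric]) blast
    finally show ?thesis using 3 U_uminus word_power_mono_exponent[OF zero_K1 _ c, of "1 + Gr n0"]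
      by (intro bexI[of _ "- ?c"] bexI[of _ "- u"]) auto
  qed
qed

text \<open>Appending a generator \<open>b s(u)\<close> to \<open>a s(g)\<close> gives \<open>a b c(g, u) s(gu)\<close>. The growth function is evaluated at the
  final length throughout, as it need not be monotone.\<close>

lemma KE_word_decomposition:
  assumes "x \<in> set_word_power KE n" "n \<le> N"
  shows "\<exists>a\<in>set_word_power K1 (n * (1 + Gr n0 + Gr (n0 * N))). \<exists>g\<in>set_word_power KG (n0 * n). x = a + s g"
  using assms
proof (induction n arbitrary: x)
  case 0
  then show ?case by (auto simp: s_zero)
next
  case (Suc n)
  define q where "q = 1 + Gr n0 + Gr (n0 * N)"
  from Suc.prems obtain y k where x: "x = y + k" "y \<in> set_word_power KE n" "k \<in> KE" by auto
  from Suc.IH[OF x(2)] Suc.prems obtain a g where ag: "a \<in> set_word_power K1 (n * q)"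
    "g \<in> set_word_power KG (n0 * n)" "y = a + s g" unfolding q_def by auto
  from KE_decomposition[OF x(3)] obtain b u where bu: "b \<in> set_word_power K1 (1 + Gr n0)" "u \<in> U" "k = b + s u" by blast
  let ?c = "section_cocycle s g u"
  have bA: "b \<in> A" using bu(1) K1_words_A by blast
  have n: "n0 * n \<le> n0 * N" "n0 \<le> n0 * N" using Suc.prems by (auto intro: mult_le_mono2)
  have uK: "u \<in> set_word_power KG n0" using bu(2) U_KG by blast
  have c: "?c \<in> set_word_power K1 (Gr (n0 * N))"
    by (intro growth word_power_mono_exponent[OF zero_KG n(1) ag(2)] word_power_mono_exponent[OF zero_KG n(2) uK])
  have "x = a + (s g + b) + s u" by (simp add: x(1) ag(3) bu(3) add.assoc)
  also have "s g + b = b + s g" by (rule A_commute[OF bA, symmetric])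
  also have "a + (b + s g) + s u = a + b + (s g + s u)" by (simp add: add.assoc)
  also have "\<dots> = a + (b + ?c) + s (g + u)" by (simp add: cocycle_eq add.assoc)
  finally have "x = a + (b + ?c) + s (g + u)" .
  moreover have "a + (b + ?c) \<in> set_word_power K1 (n * q + (1 + Gr n0 + Gr (n0 * N)))"
    by (intro word_power_add ag(1) bu(1) c)
  moreover have "g + u \<in> set_word_power KG (n0 * n + n0)" by (intro word_power_add ag(2) uK)
  ultimately show ?case unfolding q_def[symmetric] by (intro bexI[of _ "a + (b + ?c)"] bexI[of _ "g + u"]) (auto simp: q_def algebra_simps)
qed

lemma KE_word_fibre:
  assumes "x \<in> set_word_power KE n" "x \<in> A"
  shows "x \<in> set_word_power K1 (n * (1 + Gr n0 + Gr (n0 * n)))"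
proof -
  obtain a g where ag: "a \<in> set_word_power K1 (n * (1 + Gr n0 + Gr (n0 * n)))" "x = a + s g"
    using KE_word_decomposition[OF assms(1) order_refl] by blast
  have "a \<in> A" using ag(1) K1_words_A by blast
  then have "g = 0" using assms(2) ag(2) by (simp add: A_iff)
  then show ?thesis using ag s_zero by simp
qed

lemma gen_KE: "(\<Union>n. set_word_power KE n) = UNIV"
proof -
  let ?H = "\<Union>n. set_word_power KE n"
  have add: "x + y \<in> ?H" if "x \<in> ?H" "y \<in> ?H" for x y
    using that word_power_add[of x KE _ y] by blast
  have A: "a \<in> ?H" if "a \<in> A" for a
    using that gen_K1 word_power_mono[OF K1_KE] by blast
  have s: "s g \<in> ?H" if "g \<in> set_word_power U n" for g n
    using that
  proof (induction n arbitrary: g)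
    case 0
    then show ?case using A[of 0] by (simp add: s_zero A_iff)
  next
    case (Suc n)
    then obtain h u where g: "g = h + u" "h \<in> set_word_power U n" "u \<in> U" by auto
    have "s u \<in> ?H" using word_power_subset_generated[OF zero_KE] g(3) by (auto simp: KE_def)
    then have 1: "s h + s u \<in> ?H" using Suc.IH[OF g(2)] add by blast
    have "- section_cocycle s h u \<in> A" by (simp add: A_iff section_cocycle_def)
    then have "- section_cocycle s h u + (s h + s u) \<in> ?H" using A add 1 by blast
    then show ?case by (simp add: cocycle_eq g(1) add.assoc[symmetric])
  qed
  have "x \<in> ?H" for x
  proof -
    obtain n where "p x \<in> set_word_power U n" using gen_U by blast
    then have "s (p x) \<in> ?H" by (rule s)
    moreover have "x - s (p x) \<in> ?H" by (rule A) (simp add: A_iff)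
    ultimately have "x - s (p x) + s (p x) \<in> ?H" by (intro add)
    then show ?thesis by simp
  qed
  then show ?thesis by blast
qed

text \<open>For \<open>x\<close> in a compact neighbourhood \<open>K\<close> and over \<open>U\<close>, the \<open>A\<close>-coordinate of \<open>x\<close> varies in the compact subset
  \<open>K s(U)\<inverse> \<inter> A\<close> of \<open>A\<close>, on which word length is bounded.\<close>

lemma KE_contains_nhd: "\<exists>W m. open W \<and> 0 \<in> W \<and> W \<subseteq> set_word_power KE m"
proof -
  from E.compact_nhd obtain K where "\<exists>W. compact K \<and> open W \<and> (0::'e) \<in> W \<and> W \<subseteq> K" ..
  then obtain W where "compact K \<and> open W \<and> (0::'e) \<in> W \<and> W \<subseteq> K" ..
  then have KW: "compact K" "open W" "0 \<in> W" "W \<subseteq> K" by simp_all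
  define T where "T = (\<lambda>q. fst q - snd q) ` (K \<times> s ` U) \<inter> A"
  have "compact ((\<lambda>q. fst q - snd q) ` (K \<times> s ` U))"
    by (intro compact_continuous_image compact_Times KW compact_sU continuous_intros)
  then have T: "compact T" unfolding T_def by (rule compact_Int_closed) (rule closed_A)
  have "V \<inter> A \<subseteq> set_word_power K1 1" by (intro subset_trans[OF V(3)] subsetI word_power_1)
  then have "V \<inter> (\<Union>n. set_word_power K1 n) \<subseteq> set_word_power K1 1" unfolding gen_K1 .
  moreover have "T \<subseteq> (\<Union>n. set_word_power K1 n)" unfolding gen_K1 T_def by simp
  ultimately have "\<exists>N. T \<subseteq> set_word_power K1 N"
    by (intro compact_subset_word_power[OF sym_K1 zero_K1 V(1,2) _ T])
  then obtain N where N: "T \<subseteq> set_word_power K1 N" ..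
  have "W \<inter> p -` interior U \<subseteq> set_word_power KE (N + 1)"
  proof
    fix x assume x: "x \<in> W \<inter> p -` interior U"
    then have "p x \<in> interior U" by simp
    then have pU: "p x \<in> U" by (rule subsetD[OF interior_subset])
    have "(x, s (p x)) \<in> K \<times> s ` U" using x KW(4) pU by auto
    then have "x - s (p x) \<in> T"
      unfolding T_def by (intro IntI image_eqI[of _ _ "(x, s (p x))"]) (simp_all add: A_iff)
    then have 1: "x - s (p x) \<in> set_word_power KE N"
      by (intro subsetD[OF word_power_mono[OF K1_KE]] subsetD[OF N])
    have "s (p x) \<in> set_word_power KE 1" using pU by (intro word_power_1) (auto simp: KE_def)
    from word_power_add[OF 1 this] show "x \<in> set_word_power KE (N + 1)" by simp
  qed
  moreover have "open (W \<inter> p -` interior U)"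
    using KW(2) p_continuous[of UNIV] by (intro open_Int open_vimage) auto
  moreover have "0 \<in> W \<inter> p -` interior U" using KW nhd_U by simp
  ultimately show ?thesis by (intro exI[of _ "W \<inter> p -` interior U"] exI[of _ "N + 1"] conjI)
qed

lemma KE_length_le_iff: "algebraic_length KE x \<le> n \<longleftrightarrow> x \<in> set_word_power KE n"
  using algebraic_length_le_iff[of x KE n] gen_KE zero_KE by (simp add: insert_absorb)

lemma proper_KE_length: "proper_length_function (\<lambda>g. real (algebraic_length KE g))"
  unfolding proper_length_function_def
proof (intro conjI allI impI)
  show "length_function (\<lambda>g. real (algebraic_length KE g))"
    by (rule algebraic_length_function[OF compact_KE sym_KE zero_KE gen_KE])
  fix C :: "'e set" assume C: "compact C"
  obtain W m where W: "open W" "0 \<in> W" "W \<subseteq> set_word_power KE m" using KE_contains_nhd by blast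
  then have "W \<inter> (\<Union>n. set_word_power KE n) \<subseteq> set_word_power KE m" by blast
  from compact_subset_word_power[OF sym_KE zero_KE W(1,2) this C] obtain N where "C \<subseteq> set_word_power KE N"
    using gen_KE by auto
  then have "\<forall>x\<in>C. real (algebraic_length KE x) \<le> real N"
    using KE_length_le_iff by (auto simp: subset_eq)
  then show "bdd_above ((\<lambda>g. real (algebraic_length KE g)) ` C)" by (intro bdd_aboveI2[of _ _ "real N"]) auto
qed

lemma fibre_growth:
  assumes Gr: "\<And>n. real (Gr n) = poly P (real n)"
  obtains m d where "m \<ge> 0" "\<And>n. n \<ge> 1 \<Longrightarrow> emeasure \<nu>A (set_word_power KE n) \<le> ennreal (m * real n ^ d)"
proof -
  obtain m0 d0 where m0: "m0 \<ge> 0" "\<And>n. emeasure \<nu>A (set_word_power K1 n) \<le> ennreal (m0 * (real n + 1) ^ d0)"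
    using fibre_word_growth[OF compact_K1 K1_A V] by blast
  obtain c e where ce: "c \<ge> 0" "\<And>x. x \<ge> 1 \<Longrightarrow> poly P x \<le> c * x ^ e"
    by (rule poly_power_bound) blast
  define M where "M = 2 + real (Gr n0) + c * real n0 ^ e"
  have M0: "M \<ge> 0" unfolding M_def using ce(1) by simp
  have "emeasure \<nu>A (set_word_power KE n) \<le> ennreal ((m0 * M ^ d0) * real n ^ ((e + 1) * d0))" if n: "n \<ge> 1" for n
  proof -
    define l where "l = n * (1 + Gr n0 + Gr (n0 * n))"
    have KEs: "set_word_power KE n \<in> sets borel" "set_word_power K1 l \<in> sets borel"
      by (intro borel_compact compact_word_power compact_KE compact_K1)+
    have "emeasure \<nu>A (set_word_power KE n) \<le> emeasure \<nu>A (set_word_power K1 l)"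
    proof (rule emeasure_mono_AE)
      show "AE x in \<nu>A. x \<in> set_word_power KE n \<longrightarrow> x \<in> set_word_power K1 l"
        using AE_fibre by eventually_elim (unfold l_def, blast intro: KE_word_fibre)
    qed (use KEs in simp)
    also have "\<dots> \<le> ennreal (m0 * (real l + 1) ^ d0)" by (rule m0(2))
    also have "\<dots> \<le> ennreal ((m0 * M ^ d0) * real n ^ ((e + 1) * d0))"
    proof (intro ennreal_leI)
      have n1: "1 \<le> real n ^ e" using n by (intro one_le_power) simp
      have "1 \<le> n0 * n" using n n0_pos by (simp add: Suc_le_eq)
      then have "1 \<le> real (n0 * n)" by linarith
      then have "real (Gr (n0 * n)) \<le> c * real (n0 * n) ^ e" unfolding Gr by (rule ce(2))
      then have gr: "real (Gr (n0 * n)) \<le> (c * real n0 ^ e) * real n ^ e" by (simp add: power_mult_distrib)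
      have "1 \<le> real n * real n ^ e" using n n1 mult_mono[of 1 "real n" 1 "real n ^ e"] by simp
      have "1 + real (Gr n0) \<le> (1 + real (Gr n0)) * real n ^ e"
        using mult_left_mono[OF n1, of "1 + real (Gr n0)"] by simp
      then have "1 + real (Gr n0) + real (Gr (n0 * n)) \<le> (1 + real (Gr n0) + c * real n0 ^ e) * real n ^ e"
        using gr by (simp add: algebra_simps)
      then have "real n * (1 + real (Gr n0) + real (Gr (n0 * n))) \<le> real n * ((1 + real (Gr n0) + c * real n0 ^ e) * real n ^ e)"
        by (intro mult_left_mono) auto
      then have "real l + 1 \<le> M * real n ^ (e + 1)"
        using \<open>1 \<le> real n * real n ^ e\<close> unfolding l_def M_def by (simp add: algebra_simps)
      then have "(real l + 1) ^ d0 \<le> (M * real n ^ (e + 1)) ^ d0" by (intro power_mono) auto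
      also have "\<dots> = M ^ d0 * real n ^ ((e + 1) * d0)" by (simp only: power_mult_distrib power_mult[symmetric])
      finally show "m0 * (real l + 1) ^ d0 \<le> (m0 * M ^ d0) * real n ^ ((e + 1) * d0)"
        using m0(1) by (simp add: mult.assoc mult_left_mono)
    qed
    finally show ?thesis .
  qed
  moreover have "m0 * M ^ d0 \<ge> 0" using m0(1) M0 by simp
  ultimately show ?thesis using that by blast
qed

text \<open>If \<open>zb\<close> and \<open>za\<close> both lie in the symmetric set \<open>K\<^sup>n\<close>, then \<open>b\<inverse>a\<close> lies in \<open>K\<^sup>2\<^sup>n\<close>; so every fibre of the ball of
  radius \<open>n\<close> is contained in a translate of the fibre of the ball of radius \<open>2n\<close> over the neutral element.\<close>

lemma fibre_support_measure:
  assumes f: "\<And>x. f x \<noteq> 0 \<Longrightarrow> x \<in> set_word_power KE n"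
  shows "emeasure \<nu>A {a. f (- (z + a)) \<noteq> 0} \<le> emeasure \<nu>A (set_word_power KE (n + n))"
proof -
  define Z where "Z = {a. z + a \<in> set_word_power KE n}"
  have KEs: "set_word_power KE k \<in> sets borel" for k
    by (intro borel_compact compact_word_power compact_KE)
  note KEs[measurable]
  have Zs: "Z \<in> sets borel" unfolding Z_def by measurable
  have "emeasure \<nu>A {a. f (- (z + a)) \<noteq> 0} \<le> emeasure \<nu>A Z"
  proof (rule emeasure_mono)
    show "{a. f (- (z + a)) \<noteq> 0} \<subseteq> Z"
    proof
      fix a assume "a \<in> {a. f (- (z + a)) \<noteq> 0}"
      then have "- (z + a) \<in> set_word_power KE n" using f by simp
      from word_power_uminus[OF sym_KE this] show "a \<in> Z" by (simp only: Z_def minus_minus mem_Collect_eq)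
    qed
  qed (use Zs in simp)
  also have "\<dots> \<le> emeasure \<nu>A (set_word_power KE (n + n))"
  proof (cases "Z \<inter> A = {}")
    case True
    have "emeasure \<nu>A Z \<le> emeasure \<nu>A {}"
      using AE_fibre True by (intro emeasure_mono_AE) (auto elim!: eventually_mono)
    then show ?thesis by simp
  next
    case False
    then obtain b where b: "b \<in> A" "z + b \<in> set_word_power KE n" by (auto simp: Z_def)
    have "Z \<subseteq> {x. - b + x \<in> set_word_power KE (n + n)}"
    proof
      fix a assume "a \<in> Z"
      then have "z + a \<in> set_word_power KE n" by (simp add: Z_def)
      from word_power_add[OF word_power_uminus[OF sym_KE b(2)] this]
      show "a \<in> {x. - b + x \<in> set_word_power KE (n + n)}"
        by (simp only: minus_add add.assoc minus_add_cancel mem_Collect_eq)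
    qed
    then have "emeasure \<nu>A Z \<le> emeasure \<nu>A {x. - b + x \<in> set_word_power KE (n + n)}"
      using fibre_measure_translate(2)[OF b(1) KEs] by (intro emeasure_mono) auto
    then show ?thesis by (simp add: fibre_measure_translate(1)[OF b(1) KEs])
  qed
  finally show ?thesis .
qed

section \<open>Property RD for the extension\<close>

text \<open>A word of length \<open>n\<close> projects to an element of length at most \<open>c n\<close>, where \<open>c\<close> bounds \<open>L\<close> on the projections
  of the generators. The fibres contribute the square root of the measure bound from \<open>fibre_growth\<close>.\<close>

lemma pair_property_RD_extension:
  assumes RD: "pair_property_RD \<nu>G L" and Gr: "\<And>n. real (Gr n) = poly P (real n)"
  shows "pair_property_RD \<nu>E (\<lambda>g. real (algebraic_length KE g))"
proof -
  have L: "proper_length_function L" using RD by (simp add: pair_property_RD_def)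
  obtain C D where CD: "C \<ge> 0" "D \<ge> 0" "\<And>R f. R \<ge> 1 \<Longrightarrow> f \<in> L2_functions \<nu>G \<Longrightarrow>
      compact (closure {x. f x \<noteq> 0}) \<Longrightarrow> closure {x. f x \<noteq> 0} \<subseteq> length_ball L R \<Longrightarrow>
      L2_operator_norm \<nu>G (right_convolution \<nu>G f) \<le> ennreal (C * R powr D * L2_norm \<nu>G f)"
    using RD unfolding pair_property_RD_def by blast
  obtain m d where md: "m \<ge> 0" "\<And>n. n \<ge> 1 \<Longrightarrow> emeasure \<nu>A (set_word_power KE n) \<le> ennreal (m * real n ^ d)"
    using fibre_growth[OF Gr] by blast
  obtain k where k: "weil_constant = ennreal k" "k > 0"
    using weil_constant_finite weil_constant_pos by (cases weil_constant) (auto simp: zero_less_iff_neq_zero)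
  have "compact (p ` KE)" by (intro compact_continuous_image p_continuous compact_KE)
  then have "bdd_above (L ` p ` KE)"
    by (rule L[unfolded proper_length_function_def, THEN conjunct2, rule_format])
  then obtain b where "\<forall>y\<in>L ` p ` KE. y \<le> b" unfolding bdd_above_def by blast
  then have b: "\<And>x. x \<in> KE \<Longrightarrow> L (p x) \<le> b" by blast
  define c where "c = max 1 b"
  have c: "c \<ge> 1" "\<And>x. x \<in> KE \<Longrightarrow> L (p x) \<le> c" using b by (auto simp: c_def le_max_iff_disj)
  have L_word: "L (p x) \<le> c * real n" if "x \<in> set_word_power KE n" for x n
    using that
  proof (induction n arbitrary: x)
    case 0
    then show ?case using L by (simp add: proper_length_function_def length_function_def)
  next
    case (Suc n)
    then obtain y z where x: "x = y + z" "y \<in> set_word_power KE n" "z \<in> KE" by auto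
    have "L (p x) \<le> L (p y) + L (p z)"
      using L by (simp add: x(1) proper_length_function_def length_function_def)
    also have "\<dots> \<le> c * real n + c" using Suc.IH[OF x(2)] c(2)[OF x(3)] by simp
    finally show ?case by (simp add: algebra_simps)
  qed
  define C' where "C' = sqrt (m * 2 ^ d / k) * (C * c powr D)"
  define D' where "D' = real d / 2 + D"
  have "L2_operator_norm \<nu>E (right_convolution \<nu>E f) \<le> ennreal (C' * R powr D' * L2_norm \<nu>E f)"
    if R: "R \<ge> 1" and f: "f \<in> L2_functions \<nu>E" and supp: "compact (closure {x. f x \<noteq> 0})"
      "closure {x. f x \<noteq> 0} \<subseteq> length_ball (\<lambda>g. real (algebraic_length KE g)) R" for R f
  proof -
    define n where "n = nat \<lfloor>R\<rfloor>"
    have n: "n \<ge> 1" "real n \<le> R" using R by (auto simp: n_def le_nat_iff)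
    have sub: "closure {x. f x \<noteq> 0} \<subseteq> set_word_power KE n"
    proof
      fix x assume "x \<in> closure {x. f x \<noteq> 0}"
      then have "real (algebraic_length KE x) \<le> R" using supp(2) by (auto simp: length_ball_def)
      then have "algebraic_length KE x \<le> n" by (simp add: n_def le_nat_floor)
      then show "x \<in> set_word_power KE n" by (simp add: KE_length_le_iff)
    qed
    have B: "emeasure \<nu>A {a. f (- (z + a)) \<noteq> 0} \<le> ennreal (m * 2 ^ d * R ^ d)" for z
    proof -
      have "emeasure \<nu>A {a. f (- (z + a)) \<noteq> 0} \<le> emeasure \<nu>A (set_word_power KE (n + n))"
      proof (rule fibre_support_measure)
        fix x assume "f x \<noteq> 0"
        then show "x \<in> set_word_power KE n" using subsetD[OF closure_subset, of x "{x. f x \<noteq> 0}"] sub by auto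
      qed
      also have "\<dots> \<le> ennreal (m * real (n + n) ^ d)" using n by (intro md(2)) simp
      also have "\<dots> \<le> ennreal (m * (2 * R) ^ d)"
        using n md(1) by (intro ennreal_leI mult_left_mono power_mono) auto
      finally show ?thesis by (simp add: power_mult_distrib mult.assoc)
    qed
    have "L2_operator_norm \<nu>E (right_convolution \<nu>E f)
        \<le> ennreal (sqrt (m * 2 ^ d * R ^ d / k) * (C * (c * R) powr D) * L2_norm \<nu>E f)"
    proof (rule operator_norm_transfer[where S = "length_ball L (c * R)"])
      have cR: "1 \<le> c * R" using c(1) R mult_mono[of 1 c 1 R] by simp
      show "L2_operator_norm \<nu>G (right_convolution \<nu>G h) \<le> ennreal (C * (c * R) powr D * L2_norm \<nu>G h)"
        if "h \<in> L2_functions \<nu>G" "compact (closure {x. h x \<noteq> 0})" "closure {x. h x \<noteq> 0} \<subseteq> length_ball L (c * R)" for h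
        using CD(3)[OF cR that] .
      show "p ` closure {x. f x \<noteq> 0} \<subseteq> length_ball L (c * R)"
      proof
        fix y assume "y \<in> p ` closure {x. f x \<noteq> 0}"
        then obtain x where x: "x \<in> closure {x. f x \<noteq> 0}" "y = p x" by blast
        have "L y \<le> c * real n" unfolding x(2) using x(1) sub by (intro L_word) blast
        also have "\<dots> \<le> c * R" using n c(1) by (intro mult_left_mono) auto
        finally show "y \<in> length_ball L (c * R)" by (simp add: length_ball_def)
      qed
    qed (use CD(1) md(1) R f supp(1) B k(1) in auto)
    also have "sqrt (m * 2 ^ d * R ^ d / k) * (C * (c * R) powr D) = C' * R powr D'"
    proof -
      have "sqrt (m * 2 ^ d * R ^ d / k) = sqrt (m * 2 ^ d / k) * sqrt (R ^ d)"
        by (simp add: real_sqrt_mult[symmetric])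
      also have "sqrt (R ^ d) = R powr (real d / 2)"
        using R by (simp add: powr_half_sqrt[symmetric] powr_realpow[symmetric] powr_powr)
      finally show ?thesis
        using R c(1) by (simp add: C'_def D'_def powr_mult powr_add)
    qed
    finally show ?thesis .
  qed
  moreover have "C' \<ge> 0" "D' \<ge> 0" using md(1) k(2) CD by (auto simp: C'_def D'_def)
  ultimately show ?thesis unfolding pair_property_RD_def using proper_KE_length by blast
qed

end

lemma compactly_generated_haar_group:
  fixes M :: "'a::{topological_group_add, t2_space} measure"
  assumes M: "left_haar_measure M" and gen: "compactly_generated (UNIV :: 'a set)"
  shows "haar_group M"
proof -
  obtain K V where KV: "compact K" "open V" "(0::'a) \<in> V" "V \<inter> UNIV \<subseteq> K" "(\<Union>n. set_word_power K n) = UNIV"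
    using gen unfolding compactly_generated_def by blast
  show ?thesis
  proof unfold_locales
    show "radon_measure M" "left_haar_measure M" using M by (simp_all add: left_haar_measure_def)
    show "\<exists>K::nat \<Rightarrow> 'a set. (\<forall>n. compact (K n)) \<and> (\<Union>n. K n) = UNIV"
      using KV(5) compact_word_power[OF KV(1)] by (intro exI[of _ "set_word_power K"]) simp
    show "\<exists>K W. compact K \<and> open W \<and> (0::'a) \<in> W \<and> W \<subseteq> K"
      using KV by (intro exI[of _ K] exI[of _ V]) simp
  qed
qed

text \<open>The generating set of \<open>E\<close> is built from \<open>\<sigma>(U)\<close> and from a compact generating set of \<open>A\<close> that is enlarged by
  a neighbourhood of the neutral element in \<open>A\<close>.\<close>

theorem proposition7p2:
  fixes A :: "'e::{topological_group_add, t2_space} set"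
    and p :: "'e \<Rightarrow> 'g::{topological_group_add, t2_space}"
    and \<sigma> :: "'g \<Rightarrow> 'e"
    and U K\<^sub>G :: "'g set"
    and K\<^sub>A :: "'e set"
    and \<nu>\<^sub>E :: "'e measure"
    and \<nu>\<^sub>G :: "'g measure"
  assumes "topological_extension A p"
    and "central_subset A"
    and "compactly_generated A"
    and "compactly_generated (UNIV :: 'e set)"
    and "compactly_generated (UNIV :: 'g set)"
    and "left_haar_measure \<nu>\<^sub>E"
    and "left_haar_measure \<nu>\<^sub>G"
    and "symmetric_compact_generating_set A K\<^sub>A"
    and "symmetric_compact_generating_set UNIV K\<^sub>G"
    and "symmetric_compact_generating_set UNIV U"
    and "0 \<in> interior U"
    and "borel_section p \<sigma>"
    and "\<sigma> 0 = 0"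
    and "compact (\<sigma> ` U)"
    and "cocycle_polynomial_growth (algebraic_length K\<^sub>A) (algebraic_length K\<^sub>G) (section_cocycle \<sigma>)"
    and "property_RD \<nu>\<^sub>G"
  shows "property_RD \<nu>\<^sub>E"
proof -
  have U: "compact U" "uminus ` U = U" "(\<Union>n. set_word_power U n) = UNIV"
    using assms(10) by (auto simp: symmetric_compact_generating_set_def)
  have KG: "compact K\<^sub>G" "uminus ` K\<^sub>G = K\<^sub>G" "(\<Union>n. set_word_power K\<^sub>G n) = UNIV"
    using assms(9) by (auto simp: symmetric_compact_generating_set_def)
  have KA: "compact K\<^sub>A" "uminus ` K\<^sub>A = K\<^sub>A" "(\<Union>n. set_word_power K\<^sub>A n) = A"
    using assms(8) by (auto simp: symmetric_compact_generating_set_def)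
  interpret E: haar_group \<nu>\<^sub>E by (rule compactly_generated_haar_group[OF assms(6,4)])
  interpret G: haar_group \<nu>\<^sub>G by (rule compactly_generated_haar_group[OF assms(7,5)])
  interpret central_extension \<nu>\<^sub>E \<nu>\<^sub>G A p \<sigma> U
    by unfold_locales (use assms U in auto)

  obtain K0 V where K0: "compact K0" "open V" "0 \<in> V" "V \<inter> A \<subseteq> K0" "(\<Union>n. set_word_power K0 n) = A"
    using assms(3) unfolding compactly_generated_def by blast
  define K1 where "K1 = insert 0 (K\<^sub>A \<union> K0 \<union> uminus ` K0)"
  have subA: "K \<subseteq> A" if "(\<Union>n. set_word_power K n) = A" for K
    using word_power_1[of _ K] that by blast
  have K1_A: "K1 \<subseteq> A"
    using subA[OF KA(3)] subA[OF K0(5)] by (auto simp: K1_def A_iff subset_eq)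
  have gen_K1: "(\<Union>n. set_word_power K1 n) = A"
  proof
    have "set_word_power K1 n \<subseteq> A" for n
      by (induction n) (use K1_A in \<open>auto simp: A_iff subset_eq\<close>)
    then show "(\<Union>n. set_word_power K1 n) \<subseteq> A" by blast
    have "set_word_power K\<^sub>A n \<subseteq> set_word_power K1 n" for n
      by (rule word_power_mono) (auto simp: K1_def)
    then show "A \<subseteq> (\<Union>n. set_word_power K1 n)" unfolding KA(3)[symmetric] by blast
  qed

  \<comment> \<open>\<open>K\<^sub>G\<close> need not be a neighbourhood, so that its word length is bounded on \<open>U\<close> requires Baire's theorem.\<close>
  define KG' where "KG' = insert 0 K\<^sub>G"
  have KG': "compact KG'" "uminus ` KG' = KG'" "0 \<in> KG'" "(\<Union>n. set_word_power KG' n) = UNIV"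
    using KG unfolding KG'_def by (auto simp: symmetric_insert_zero generated_insert_zero)
  obtain K W where "compact K" "open W" "(0::'g) \<in> W" "W \<subseteq> K" using G.compact_nhd by blast
  then obtain V' m where V': "open V'" "0 \<in> V'" "V' \<subseteq> set_word_power KG' m"
    using generating_set_contains_nhd[OF KG', of W K] by blast
  have "\<exists>n0. U \<subseteq> set_word_power KG' n0"
    by (rule compact_subset_word_power[OF KG'(2,3) V'(1,2)]) (use V'(3) KG'(4) U(1) in auto)
  then obtain n1 where n1: "U \<subseteq> set_word_power KG' n1" ..
  define n0 where "n0 = Suc n1"
  have n0: "1 \<le> n0" "U \<subseteq> set_word_power KG' n0"
    using n1 word_power_mono_exponent[OF KG'(3), of n1 n0] by (auto simp: n0_def)

  obtain Gr and P :: "real poly" where Gr: "\<And>n. real (Gr n) = poly P (real n)"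
    "cocycle_growth_at_most (algebraic_length K\<^sub>A) (algebraic_length K\<^sub>G) (section_cocycle \<sigma>) Gr"
    using assms(15) unfolding cocycle_polynomial_growth_def by blast

  interpret polynomial_extension \<nu>\<^sub>E \<nu>\<^sub>G A p \<sigma> U K1 V KG' Gr n0
  proof unfold_locales
    show "compact K1" unfolding K1_def
      by (intro compact_insert compact_Un KA K0 compact_continuous_image continuous_intros)
    show "uminus ` K1 = K1" unfolding K1_def using KA(2) by (auto simp: image_Un image_image)
    show "V \<inter> A \<subseteq> K1" using K0(4) by (auto simp: K1_def)
    fix n g h assume gh: "g \<in> set_word_power KG' n" "h \<in> set_word_power KG' n"
    have "algebraic_length K\<^sub>G g \<le> n" "algebraic_length K\<^sub>G h \<le> n"
      using gh KG(3) algebraic_length_le_iff[of _ K\<^sub>G n] unfolding KG'_def by auto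
    then have "algebraic_length K\<^sub>A (section_cocycle \<sigma> g h) \<le> Gr n"
      using Gr(2) unfolding cocycle_growth_at_most_def by blast
    moreover have "section_cocycle \<sigma> g h \<in> (\<Union>n. set_word_power K\<^sub>A n)"
      unfolding KA(3) by (simp add: A_iff section_cocycle_def)
    ultimately have "section_cocycle \<sigma> g h \<in> set_word_power (insert 0 K\<^sub>A) (Gr n)"
      by (simp add: algebraic_length_le_iff)
    then show "section_cocycle \<sigma> g h \<in> set_word_power K1 (Gr n)"
      using word_power_mono[of "insert 0 K\<^sub>A" K1] by (auto simp: K1_def)
  qed (use assms U K0 KG' n0 gen_K1 in \<open>auto simp: K1_def\<close>)

  obtain K where "pair_property_RD \<nu>\<^sub>G (\<lambda>g. real (algebraic_length K g))"
    using assms(16) unfolding property_RD_def by blast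
  then have "pair_property_RD \<nu>\<^sub>E (\<lambda>g. real (algebraic_length KE g))"
    using Gr(1) by (rule pair_property_RD_extension)
  moreover have "symmetric_compact_generating_set UNIV KE"
    unfolding symmetric_compact_generating_set_def using compact_KE sym_KE gen_KE by blast
  ultimately show ?thesis unfolding property_RD_def using assms(4) by blast
qed

end
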